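(* Let $n\geq 4$ be an integer and put $k=\frac{1}{2}\left\lfloor \frac{n+1}{2}\right\rfloor$. For $L\geq 1$, let $f=X^n+a_{n-1}X^{n-1}+\cdots+a_1X+a_0$ be a random monic polynomial whose coefficients $a_0,\ldots,a_{n-1}$ are chosen independently and uniformly from $[-L,L]\cap\mathbb{Z}$. Then there is a constant $c>0$ depending only on $n$ such that, for all sufficiently large $L$, \[ \textnormal{Prob}(G_f = A_n) \geq c\, L^{k-n}. \]
   Context: For a separable polynomial $f\in\mathbb{Q}[X]$ of degree $n$, $G_f$ denotes the Galois group of (the splitting field of) $f$ over $\mathbb{Q}$, viewed as a subgroup of $S_n$ via its action on the roots of $f$ (well defined up to conjugation); $A_n$ is the alternating group. The event "$G_f=A_n$" means $f$ is separable and its Galois group is $A_n$. *)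

theory Defs
  imports
    "HOL-Probability.Probability"
    "HOL-Computational_Algebra.Computational_Algebra"
    "HOL-Algebra.Generated_Fields"
    "HOL-Algebra.Sym_Groups"
    "HOL-Algebra.Algebraic_Closure_Type"
begin

text \<open>Splitting fields over the rationals are taken inside the complex numbers.\<close>

abbreviation complex_poly :: "rat poly \<Rightarrow> complex poly" where
  "complex_poly f \<equiv> map_poly of_rat f"

definition complex_roots :: "rat poly \<Rightarrow> complex set" where
  "complex_roots f = {z. poly (complex_poly f) z = 0}"

text \<open>No repeated roots in the algebraically closed field of complex numbers.\<close>

definition separable :: "rat poly \<Rightarrow> bool" where
  "separable f \<longleftrightarrow> rsquarefree (complex_poly f)"

definition splitting_field :: "rat poly \<Rightarrow> complex ring" where
  "splitting_field f =
     ring_of_type_algebra\<lparr>carrier := generate_field ring_of_type_algebra (\<rat> \<union> complex_roots f)\<rparr>"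

text \<open>Restricting to extensional functions makes an automorphism determined by its
  values on the splitting field.\<close>

definition galois_automorphisms :: "rat poly \<Rightarrow> (complex \<Rightarrow> complex) set" where
  "galois_automorphisms f =
     {\<sigma> \<in> ring_iso (splitting_field f) (splitting_field f) \<inter>
           extensional (carrier (splitting_field f)). \<forall>q\<in>\<rat>. \<sigma> q = q}"

text \<open>The permutation of the indices \<open>1, \<dots>, n\<close> induced by an automorphism when the
  roots are numbered as \<open>r 1, \<dots>, r n\<close>.\<close>

definition perm_of_automorphism ::
    "nat \<Rightarrow> (nat \<Rightarrow> complex) \<Rightarrow> (complex \<Rightarrow> complex) \<Rightarrow> nat \<Rightarrow> nat" where
  "perm_of_automorphism n r \<sigma> =
     (\<lambda>i. if i \<in> {1..n} then inv_into {1..n} r (\<sigma> (r i)) else i)"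

text \<open>\<open>G\<^sub>f = H\<close> for a set \<open>H\<close> of permutations of \<open>1, \<dots>, n\<close>, where \<open>n\<close> is the degree of
  \<open>f\<close>. As \<open>G\<^sub>f\<close> is only defined up to conjugation, equality is required for some numbering
  of the roots; for \<open>H\<close> normal in the symmetric group this is the same as for every one.\<close>

definition galois_group_eq :: "rat poly \<Rightarrow> (nat \<Rightarrow> nat) set \<Rightarrow> bool" where
  "galois_group_eq f H \<longleftrightarrow>
     separable f \<and>
     (\<exists>r. bij_betw r {1..Polynomial.degree f} (complex_roots f) \<and>
          perm_of_automorphism (Polynomial.degree f) r ` galois_automorphisms f = H)"

definition monic_poly :: "nat \<Rightarrow> (nat \<Rightarrow> int) \<Rightarrow> rat poly" where
  "monic_poly n a = Polynomial.monom 1 n + (\<Sum>i<n. Polynomial.monom (of_int (a i)) i)"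

definition random_monic_poly :: "nat \<Rightarrow> real \<Rightarrow> rat poly pmf" where
  "random_monic_poly n L =
     map_pmf (monic_poly n)
       (Pi_pmf {..<n} 0 (\<lambda>_. pmf_of_set {a :: int. real_of_int a \<in> {-L..L}}))"

end

theory Submission
  imports Defs
begin

text \<open>
  Monic polynomials with square discriminant are produced by differential equations. In even
  degree take \<open>f' = n X g\<^sup>2\<close> and \<open>f(0) = \<plusminus> s\<^sup>2\<close>, in odd degree
  \<open>(X\<^sup>2 - d) f' - 2 X f = (n - 2) g\<^sup>2\<close> for a suitable fixed \<open>d\<close>; since the discriminant is up
  to sign the product of the values of \<open>f'\<close> at the roots, it is then a square. The solutions
  depend on parameters, and allowing coefficients of size \<open>B\<^sup>2\<close> leaves about \<open>B\<^sup>m\<close> polynomials,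
  where \<open>m = \<lfloor>(n + 1) / 2\<rfloor>\<close>; with \<open>B \<approx> \<surd>L\<close> this is the claimed bound.

  Congruence conditions on the parameters modulo fixed primes force the group to be all of
  \<open>A\<^sub>n\<close>. If \<open>f\<close> has an integer \<open>a\<close> as a root of multiplicity \<open>j\<close> modulo \<open>p\<close>, all other roots
  are simple and \<open>f(a)\<close> is exactly divisible by \<open>p > n\<close>, then the inertia group at \<open>p\<close>
  acts transitively on the \<open>j\<close> roots near \<open>a\<close> and fixes the others. One prime with
  \<open>j = n - 1\<close> or \<open>j = n - 2\<close>, one with \<open>j = 3\<close>, and transitivity of the whole group
  (\<open>f\<close> has no integer root in even degree, and is Eisenstein in odd degree) give every 3-cycle.

  No algebraic number theory is assumed: inertia groups act on the ring generated by the roots,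
  modulo a maximal ideal containing \<open>p\<close>.
\<close>

text \<open>In odd degree \<open>f' = n g^2\<close> would make the discriminant, up to sign,
  \<open>n^n\<close> times a square, and \<open>n^n\<close> is a square only for special
  \<open>n\<close>. The factor \<open>X^2 - d\<close> repairs this: putting X = +-sqrt d into the
  equation shows that the product of \<open>r_i^2 - d\<close> over the roots is -1/(4d) times a
  rational square, so the choice \<open>d = (-1)^m (n - 2) (n - 4)^2\<close> absorbs the sign and
  the odd power of \<open>n - 2\<close>. Since \<open>X^2 - d\<close> is annihilated by the left
  side, a multiple \<open>t\<close> of it can be added freely. The price is solvability. The left
  side is \<open>(X^2 - d)^2 (f / (X^2 - d))'\<close>, so \<open>g^2 / (X^2 - d)^2\<close> must have
  no residues; this holds when \<open>2 X g' - g\<close> vanishes at X = +-sqrt d. The condition is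
  linear in \<open>g\<close> and leaves \<open>m - 2\<close> parameters of size B besides
  \<open>t\<close>, which may have size B^2. The roots are not assumed distinct: separability is
  itself deduced from ramification. Therefore the group is first treated as the set of permutations
  preserving all rational relations between the roots, and is compared with automorphisms only for
  distinct roots.\<close>

section \<open>Polynomial functions of the roots\<close>

hide_const (open) Divisibility.prime Divisibility.irreducible Module.smult Polynomials.degree
  UnivPoly.coeff UnivPoly.monom UnivPoly.eval Coset.order Polynomials.lead_coeff

declare One_nat_def [simp del]

text \<open>Polynomial maps rather than formal polynomials in \<open>n\<close> variables: only
  values at the tuples \<open>r \<circ> \<pi>\<close> matter, and closure properties become
  inductions over four rules. The coefficient set \<open>A\<close> is \<int> or \<rat> in the
  applications.\<close>

inductive_set polyfun :: "complex set \<Rightarrow> nat \<Rightarrow> ((nat \<Rightarrow> complex) \<Rightarrow> complex) set"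
  for A :: "complex set" and n :: nat where
  const: "c \<in> A \<Longrightarrow> (\<lambda>_. c) \<in> polyfun A n"
| var: "i \<in> {1..n} \<Longrightarrow> (\<lambda>x. x i) \<in> polyfun A n"
| add: "f \<in> polyfun A n \<Longrightarrow> g \<in> polyfun A n \<Longrightarrow> (\<lambda>x. f x + g x) \<in> polyfun A n"
| mult: "f \<in> polyfun A n \<Longrightarrow> g \<in> polyfun A n \<Longrightarrow> (\<lambda>x. f x * g x) \<in> polyfun A n"

lemma polyfun_mono: "f \<in> polyfun A n \<Longrightarrow> A \<subseteq> B \<Longrightarrow> f \<in> polyfun B n"
  by (induction rule: polyfun.induct) (auto intro: polyfun.intros)

lemma polyfun_Ints_Rats: "f \<in> polyfun \<int> n \<Longrightarrow> f \<in> polyfun \<rat> n"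
  by (erule polyfun_mono) (auto elim!: Ints_cases)

lemma polyfun_uminus: "A = \<int> \<or> A = \<rat> \<Longrightarrow> f \<in> polyfun A n \<Longrightarrow> (\<lambda>x. - f x) \<in> polyfun A n"
  using polyfun.mult[OF polyfun.const[of "-1" A n], of f] by auto

lemma polyfun_diff:
  "A = \<int> \<or> A = \<rat> \<Longrightarrow> f \<in> polyfun A n \<Longrightarrow> g \<in> polyfun A n \<Longrightarrow> (\<lambda>x. f x - g x) \<in> polyfun A n"
  using polyfun.add[OF _ polyfun_uminus, of f A n g] by simp

lemma polyfun_sum:
  assumes "A = \<int> \<or> A = \<rat>" "\<And>i. i \<in> J \<Longrightarrow> f i \<in> polyfun A n"
  shows "(\<lambda>x. \<Sum>i\<in>J. f i x) \<in> polyfun A n"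
  using assms(2)
proof (induction J rule: infinite_finite_induct)
  case (infinite J)
  then show ?case using assms(1) polyfun.const[of 0] by auto
next
  case empty
  then show ?case using assms(1) polyfun.const[of 0] by auto
next
  case (insert i J)
  then show ?case using polyfun.add[of "f i" A n] by auto
qed

lemma polyfun_prod:
  assumes "A = \<int> \<or> A = \<rat>" "\<And>i. i \<in> J \<Longrightarrow> f i \<in> polyfun A n"
  shows "(\<lambda>x. \<Prod>i\<in>J. f i x) \<in> polyfun A n"
  using assms(2)
proof (induction J rule: infinite_finite_induct)
  case (infinite J)
  then show ?case using assms(1) polyfun.const[of 1] by auto
next
  case empty
  then show ?case using assms(1) polyfun.const[of 1] by auto
next
  case (insert i J)
  then show ?case using polyfun.mult[of "f i" A n] by auto
qed

lemma polyfun_power: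
  "A = \<int> \<or> A = \<rat> \<Longrightarrow> f \<in> polyfun A n \<Longrightarrow> (\<lambda>x. f x ^ k) \<in> polyfun A n"
  using polyfun_prod[of A "{..<k}" "\<lambda>_. f"] by simp

lemma polyfun_permute:
  assumes "f \<in> polyfun A n" "\<And>i. i \<in> {1..n} \<Longrightarrow> \<pi> i \<in> {1..n}"
  shows "(\<lambda>x. f (x \<circ> \<pi>)) \<in> polyfun A n"
  using assms(1)
proof (induction rule: polyfun.induct)
  case (var i)
  then show ?case using polyfun.var[OF assms(2)[OF var]] by simp
qed (auto intro: polyfun.intros)

lemma polyfun_poly:
  assumes "A = \<int> \<or> A = \<rat>" "\<And>k. poly.coeff Q k \<in> A" "f \<in> polyfun A n"
  shows "(\<lambda>x. poly Q (f x)) \<in> polyfun A n"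
  unfolding poly_altdef
  by (intro polyfun_sum polyfun.mult polyfun.const polyfun_power assms)

text \<open>The expanded form: sums over all permutations are computed monomial by monomial.\<close>

inductive_set monspan :: "complex set \<Rightarrow> nat \<Rightarrow> ((nat \<Rightarrow> complex) \<Rightarrow> complex) set"
  for A :: "complex set" and n :: nat where
  mon: "c \<in> A \<Longrightarrow> (\<lambda>x. c * (\<Prod>i\<in>{1..n}. x i ^ e i)) \<in> monspan A n"
| add: "f \<in> monspan A n \<Longrightarrow> g \<in> monspan A n \<Longrightarrow> (\<lambda>x. f x + g x) \<in> monspan A n"

lemma monspan_mult:
  assumes "A = \<int> \<or> A = \<rat>" "f \<in> monspan A n" "g \<in> monspan A n"
  shows "(\<lambda>x. f x * g x) \<in> monspan A n"
  using assms(2)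
proof (induction rule: monspan.induct)
  case (mon c e)
  show ?case using assms(3)
  proof (induction rule: monspan.induct)
    case (mon d e')
    have "c * d \<in> A" using assms(1) \<open>c \<in> A\<close> mon by auto
    from monspan.mon[OF this, where n = n and e = "\<lambda>i. e i + e' i"] show ?case
      by (simp add: power_add prod.distrib mult_ac)
  next
    case (add f g)
    then show ?case using monspan.add[OF add.IH] by (simp add: algebra_simps)
  qed
next
  case (add f f')
  then show ?case using monspan.add[OF add.IH] by (simp add: algebra_simps)
qed

lemma polyfun_imp_monspan:
  assumes "A = \<int> \<or> A = \<rat>" "f \<in> polyfun A n"
  shows "f \<in> monspan A n"
  using assms(2)
proof (induction rule: polyfun.induct)
  case (const c)
  then show ?case using monspan.mon[of c A, where n = n and e = "\<lambda>_. 0"] by simp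
next
  case (var j)
  have "(\<Prod>i\<in>{1..n}. x i ^ (if i = j then 1 else 0)) = x j" for x :: "nat \<Rightarrow> complex"
    using var by (subst prod.remove[of _ j]) auto
  then show ?case using monspan.mon[of 1 A, where n = n and e = "\<lambda>i. if i = j then 1 else 0"] assms(1) by auto
qed (auto intro: monspan.add monspan_mult[OF assms(1)])

text \<open>Roots are listed with multiplicity. Injectivity of \<open>r\<close> is deliberately
  absent; it is proved later from a ramification condition in \<open>distinct_roots\<close>.\<close>

locale root_enum =
  fixes n :: nat and r :: "nat \<Rightarrow> complex" and F :: "int poly"
  assumes F_eq: "map_poly of_int F = (\<Prod>i\<in>{1..n}. [:- r i, 1:])"
begin

lemma poly_F: "poly (map_poly of_int F) z = (\<Prod>i\<in>{1..n}. z - r i)"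
  unfolding F_eq by (simp add: poly_prod)

text \<open>Newton's identities in disguise. With P = (X - r_i) s_i, the sums \<open>S k j\<close>
  of r_i^k times the j-th coefficient of s_i satisfy a recursion in k over the integers. They start
  from the coefficients of P', and at j = n - 1 they are the power sums, because each s_i is monic
  of that degree.\<close>

lemma power_sum_Ints: "(\<Sum>i\<in>{1..n}. r i ^ k) \<in> \<int>"
proof (cases "n = 0")
  case False
  define P :: "complex poly" where "P = map_poly of_int F"
  define s where "s i = synthetic_div P (r i)" for i
  define S where "S k j = (\<Sum>i\<in>{1..n}. r i ^ k * poly.coeff (s i) j)" for k j
  have root: "poly P (r i) = 0" if "i \<in> {1..n}" for i
    unfolding P_def poly_F using that by (auto simp: prod_zero_iff)
  have cP: "poly.coeff P j \<in> \<int>" for j by (simp add: P_def coeff_map_poly)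
  have c0: "r i * poly.coeff (s i) 0 = - poly.coeff P 0" if "i \<in> {1..n}" for i
    using arg_cong[OF synthetic_div_correct[of P "r i"], of "\<lambda>p. poly.coeff p 0"] root[OF that]
    by (simp add: s_def add_eq_0_iff add.commute)
  have cS: "r i * poly.coeff (s i) (Suc j) = poly.coeff (s i) j - poly.coeff P (Suc j)" if "i \<in> {1..n}" for i j
    using arg_cong[OF synthetic_div_correct[of P "r i"], of "\<lambda>p. poly.coeff p (Suc j)"] root[OF that]
    by (simp add: s_def algebra_simps)
  have s_prod: "s i = (\<Prod>j\<in>{1..n}-{i}. [:- r j, 1:])" if "i \<in> {1..n}" for i
  proof -
    have "[:- r i, 1:] * s i = P"
      using synthetic_div_correct'[of "r i" P] root[OF that] by (simp add: s_def)
    also have "P = [:- r i, 1:] * (\<Prod>j\<in>{1..n}-{i}. [:- r j, 1:])"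
      unfolding P_def F_eq using that by (subst prod.remove[of _ i]) auto
    finally show ?thesis by (subst (asm) mult_cancel_left) auto
  qed
  have lead: "poly.coeff (s i) (n - 1) = 1" if "i \<in> {1..n}" for i
  proof -
    have "degree (s i) = n - 1"
      unfolding s_prod[OF that] using that by (subst degree_prod_eq_sum_degree) auto
    moreover have "lead_coeff (s i) = 1" unfolding s_prod[OF that] by (simp add: lead_coeff_prod)
    ultimately show ?thesis by simp
  qed
  have p: "(\<Sum>i\<in>{1..n}. r i ^ k) = S k (n - 1)" for k
    unfolding S_def by (intro sum.cong refl) (simp only: lead mult_1_right)
  have "pderiv P = (\<Sum>i\<in>{1..n}. s i)"
    unfolding P_def F_eq pderiv_prod by (intro sum.cong) (auto simp: s_prod pderiv_pCons)
  then have "S 0 j = poly.coeff (pderiv P) j" for j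
    by (simp add: S_def coeff_sum)
  then have base: "S 0 j \<in> \<int>" for j by (auto simp: coeff_pderiv intro!: Ints_mult cP)
  have "\<forall>j. S k j \<in> \<int>"
  proof (induction k)
    case 0
    then show ?case using base by blast
  next
    case (Suc k)
    have pk: "(\<Sum>i\<in>{1..n}. r i ^ k) \<in> \<int>" unfolding p using Suc by blast
    show ?case
    proof
      fix j
      show "S (Suc k) j \<in> \<int>"
      proof (cases j)
        case 0
        have "S (Suc k) 0 = (\<Sum>i\<in>{1..n}. r i ^ k * (r i * poly.coeff (s i) 0))"
          unfolding S_def by (intro sum.cong) auto
        also have "\<dots> = (\<Sum>i\<in>{1..n}. r i ^ k * (- poly.coeff P 0))"
          by (intro sum.cong) (auto simp: c0)
        also have "\<dots> = - poly.coeff P 0 * (\<Sum>i\<in>{1..n}. r i ^ k)"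
          by (simp add: sum_distrib_left mult.commute sum_negf)
        also have "\<dots> \<in> \<int>" using pk cP by (intro Ints_mult Ints_minus)
        finally show ?thesis using 0 by simp
      next
        case (Suc j')
        have "S (Suc k) j = (\<Sum>i\<in>{1..n}. r i ^ k * (r i * poly.coeff (s i) (Suc j')))"
          unfolding S_def Suc by (intro sum.cong) auto
        also have "\<dots> = (\<Sum>i\<in>{1..n}. r i ^ k * poly.coeff (s i) j' - poly.coeff P (Suc j') * r i ^ k)"
          by (intro sum.cong) (auto simp: cS algebra_simps)
        also have "\<dots> = S k j' - poly.coeff P (Suc j') * (\<Sum>i\<in>{1..n}. r i ^ k)"
          by (simp add: S_def sum_subtractf sum_distrib_left)
        also have "\<dots> \<in> \<int>" using pk cP Suc.IH by (intro Ints_mult Ints_diff) auto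
        finally show ?thesis .
      qed
    qed
  qed
  then show ?thesis unfolding p by blast
qed simp

text \<open>Let the image of one index \<open>j\<close> run over all of \<open>{1..n}\<close>, which
  splits off a power sum, and subtract the cases where it meets the image of some \<open>k\<close>,
  which merges the exponents into \<open>e k + e j\<close>. Both leave fewer indices; the merging is
  why \<open>e\<close> is arbitrary in the induction.\<close>

lemma inj_sum_Ints:
  assumes "finite I"
  shows "(\<Sum>h | h \<in> I \<rightarrow>\<^sub>E {1..n} \<and> inj_on h I. \<Prod>i\<in>I. r (h i) ^ e i) \<in> \<int>"
  using assms
proof (induction I arbitrary: e rule: finite_induct)
  case empty
  then show ?case by simp
next
  case (insert j I)
  define H where "H J = {h. h \<in> J \<rightarrow>\<^sub>E {1..n} \<and> inj_on h J}" for J :: "'a set"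
  define T where "T e = (\<Sum>h\<in>H I. \<Prod>i\<in>I. r (h i) ^ e i)" for e
  have T: "T e \<in> \<int>" for e using insert.IH by (simp add: T_def H_def)
  have "(\<Sum>h\<in>H (insert j I). \<Prod>i\<in>insert j I. r (h i) ^ e i) =
        (\<Sum>(h,v)\<in>(SIGMA h:H I. {1..n} - h ` I). (\<Prod>i\<in>I. r (h i) ^ e i) * r v ^ e j)"
  proof (rule sum.reindex_bij_witness[where j = "\<lambda>h. (restrict h I, h j)" and i = "\<lambda>(h,v). h(j := v)"])
    fix h assume h: "h \<in> H (insert j I)"
    show "(case (restrict h I, h j) of (h, v) \<Rightarrow> h(j := v)) = h"
      using h insert.hyps by (auto simp: H_def fun_eq_iff PiE_def extensional_def)
    show "(restrict h I, h j) \<in> (SIGMA h:H I. {1..n} - h ` I)"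
      using h insert.hyps by (auto simp: H_def PiE_def Pi_def inj_on_def)
    show "(case (restrict h I, h j) of (h, v) \<Rightarrow> (\<Prod>i\<in>I. r (h i) ^ e i) * r v ^ e j) =
        (\<Prod>i\<in>insert j I. r (h i) ^ e i)"
      using insert.hyps by (simp add: mult.commute)
  next
    fix p assume p: "p \<in> (SIGMA h:H I. {1..n} - h ` I)"
    obtain h v where hv: "p = (h, v)" by force
    show "(restrict (case p of (h, v) \<Rightarrow> h(j := v)) I, (case p of (h, v) \<Rightarrow> h(j := v)) j) = p"
      using p insert.hyps unfolding hv by (auto simp: H_def fun_eq_iff PiE_def extensional_def)
    show "(case p of (h, v) \<Rightarrow> h(j := v)) \<in> H (insert j I)"
      using p insert.hyps unfolding hv
      by (auto simp: H_def PiE_def Pi_def inj_on_def extensional_def image_iff)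
  qed
  also have "\<dots> = (\<Sum>h\<in>H I. \<Sum>v\<in>{1..n} - h ` I. (\<Prod>i\<in>I. r (h i) ^ e i) * r v ^ e j)"
  proof -
    have "finite (H I)" unfolding H_def
      by (rule finite_subset[of _ "I \<rightarrow>\<^sub>E {1..n}"]) (auto intro: finite_PiE insert.hyps)
    then show ?thesis by (subst sum.Sigma) auto
  qed
  also have "\<dots> = (\<Sum>h\<in>H I. (\<Prod>i\<in>I. r (h i) ^ e i) * (\<Sum>v\<in>{1..n}. r v ^ e j) -
       (\<Sum>k\<in>I. \<Prod>i\<in>I. r (h i) ^ (if i = k then e i + e j else e i)))"
  proof (rule sum.cong)
    fix h assume h: "h \<in> H I"
    have sub: "h ` I \<subseteq> {1..n}" and inj: "inj_on h I" using h by (auto simp: H_def PiE_def Pi_def)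
    have "(\<Sum>v\<in>{1..n} - h ` I. r v ^ e j) = (\<Sum>v\<in>{1..n}. r v ^ e j) - (\<Sum>k\<in>I. r (h k) ^ e j)"
      using sub by (subst sum_diff) (auto simp: sum.reindex[OF inj])
    moreover have "(\<Prod>i\<in>I. r (h i) ^ (if i = k then e i + e j else e i)) =
        (\<Prod>i\<in>I. r (h i) ^ e i) * r (h k) ^ e j" if "k \<in> I" for k
      using that insert.hyps by (subst (1 2) prod.remove[of I k]) (auto simp: power_add)
    ultimately show "(\<Sum>v\<in>{1..n} - h ` I. (\<Prod>i\<in>I. r (h i) ^ e i) * r v ^ e j) =
        (\<Prod>i\<in>I. r (h i) ^ e i) * (\<Sum>v\<in>{1..n}. r v ^ e j) -
       (\<Sum>k\<in>I. \<Prod>i\<in>I. r (h i) ^ (if i = k then e i + e j else e i))"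
      by (simp add: sum_distrib_left [symmetric] right_diff_distrib)
  qed simp
  also have "\<dots> = T e * (\<Sum>v\<in>{1..n}. r v ^ e j) - (\<Sum>k\<in>I. T (\<lambda>i. if i = k then e i + e j else e i))"
  proof -
    have "(\<Sum>k\<in>I. T (\<lambda>i. if i = k then e i + e j else e i)) =
        (\<Sum>h\<in>H I. \<Sum>k\<in>I. \<Prod>i\<in>I. r (h i) ^ (if i = k then e i + e j else e i))"
      unfolding T_def by (rule sum.swap)
    then show ?thesis by (simp add: T_def sum_subtractf sum_distrib_right)
  qed
  also have "\<dots> \<in> \<int>"
    by (intro Ints_diff Ints_mult T power_sum_Ints Ints_sum)
  finally show ?case by (simp add: H_def)
qed

text \<open>Takes the place of the fundamental theorem on symmetric polynomials. Summing over
  permutations costs a factor n! for symmetric \<open>f\<close>, which is removed later by bounding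
  denominators.\<close>

lemma perm_sum_mem:
  assumes A: "A = \<int> \<or> A = \<rat>" and f: "f \<in> polyfun A n"
  shows "(\<Sum>\<pi> | \<pi> permutes {1..n}. f (r \<circ> \<pi>)) \<in> A"
proof -
  have *: "(\<Sum>\<pi> | \<pi> permutes {1..n}. \<Prod>i\<in>{1..n}. r (\<pi> i) ^ e i) \<in> \<int>" for e
  proof -
    have "(\<Sum>\<pi> | \<pi> permutes {1..n}. \<Prod>i\<in>{1..n}. r (\<pi> i) ^ e i) =
       (\<Sum>h | h \<in> {1..n} \<rightarrow>\<^sub>E {1..n} \<and> inj_on h {1..n}. \<Prod>i\<in>{1..n}. r (h i) ^ e i)"
    proof (rule sum.reindex_bij_witness[where j = "\<lambda>\<pi>. restrict \<pi> {1..n}"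
          and i = "\<lambda>h i. if i \<in> {1..n} then h i else i"])
      fix \<pi> assume "\<pi> \<in> {\<pi>. \<pi> permutes {1..n}}"
      then have \<pi>: "\<pi> permutes {1..n}" by simp
      show "(\<lambda>i. if i \<in> {1..n} then restrict \<pi> {1..n} i else i) = \<pi>"
        using permutes_not_in[OF \<pi>] by (auto simp: fun_eq_iff)
      show "restrict \<pi> {1..n} \<in> {h. h \<in> {1..n} \<rightarrow>\<^sub>E {1..n} \<and> inj_on h {1..n}}"
        using permutes_in_image[OF \<pi>] permutes_inj_on[OF \<pi>] by (auto simp: inj_on_def)
    next
      fix h assume "h \<in> {h. h \<in> {1..n} \<rightarrow>\<^sub>E {1..n} \<and> inj_on h {1..n}}"
      then have h: "h \<in> {1..n} \<rightarrow>\<^sub>E {1..n}" "inj_on h {1..n}" by auto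
      show "restrict (\<lambda>i. if i \<in> {1..n} then h i else i) {1..n} = h"
        using h by (auto simp: fun_eq_iff PiE_def extensional_def)
      have "bij_betw h {1..n} {1..n}"
        unfolding bij_betw_def by (intro conjI h(2) endo_inj_surj) (use h(1) in \<open>auto simp: PiE_def Pi_def\<close>)
      then have "bij_betw (\<lambda>i. if i \<in> {1..n} then h i else i) {1..n} {1..n}"
        by (subst bij_betw_cong[of _ _ h]) auto
      then show "(\<lambda>i. if i \<in> {1..n} then h i else i) \<in> {\<pi>. \<pi> permutes {1..n}}"
        by (auto intro!: bij_imp_permutes)
    qed (auto intro!: prod.cong)
    also have "\<dots> \<in> \<int>" by (rule inj_sum_Ints) simp
    finally show ?thesis .
  qed
  from polyfun_imp_monspan[OF A f] show ?thesis
  proof (induction rule: monspan.induct)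
    case (mon c e)
    have "(\<Sum>\<pi> | \<pi> permutes {1..n}. c * (\<Prod>i\<in>{1..n}. (r \<circ> \<pi>) i ^ e i)) =
        c * (\<Sum>\<pi> | \<pi> permutes {1..n}. \<Prod>i\<in>{1..n}. r (\<pi> i) ^ e i)"
      by (simp add: sum_distrib_left)
    also have "\<dots> \<in> A" using A
    proof
      assume "A = \<int>"
      then show ?thesis using mon *[of e] by simp
    next
      assume "A = \<rat>"
      then show ?thesis using mon *[of e] Ints_subset_Rats by (auto intro!: Rats_mult)
    qed
    finally show ?case .
  next
    case (add f g)
    then show ?case using A by (auto simp: sum.distrib)
  qed
qed

end

text \<open>If \<open>q = a / b\<close> in lowest terms, every power of b divides \<open>N\<close>.
  Already the \<open>N\<close>-th power forces b = 1, since 2^N > N.\<close>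

lemma Ints_if_power_denominators_bounded:
  fixes q :: complex
  assumes "q \<in> \<rat>" "N > 0" "\<And>k. of_nat N * q ^ k \<in> \<int>"
  shows "q \<in> \<int>"
proof -
  obtain a b :: int where ab: "b > 0" "coprime a b" "q = of_int a / of_int b"
    using assms(1) by (elim Rats_cases') blast
  have "b ^ k dvd int N" for k
  proof -
    obtain c where c: "of_nat N * q ^ k = of_int c" using assms(3)[of k] by (elim Ints_cases)
    have "(of_int (int N * a ^ k) :: complex) = of_int (c * b ^ k)"
      using c ab by (simp add: power_divide field_simps)
    then have "int N * a ^ k = c * b ^ k" by (simp only: of_int_eq_iff)
    then have "b ^ k dvd int N * a ^ k" by simp
    then show ?thesis using ab(2) by (meson coprime_commute coprime_dvd_mult_left_iff coprime_power_left_iff coprime_power_right_iff)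
  qed
  from zdvd_imp_le[OF this[of N]] assms(2) have le: "b ^ N \<le> int N" by simp
  have "b = 1"
  proof (rule ccontr)
    assume "b \<noteq> 1"
    then have "2 ^ N \<le> b ^ N" using ab(1) by (intro power_mono) auto
    moreover have "int N < 2 ^ N" using less_exp[of N] by (metis of_nat_less_iff of_nat_numeral of_nat_power)
    ultimately show False using le by linarith
  qed
  then show ?thesis using ab by simp
qed

lemma polyfun_coeff_prod_linear:
  assumes "A = \<int> \<or> A = \<rat>" "finite J" "\<And>j. j \<in> J \<Longrightarrow> g j \<in> polyfun A n"
  shows "(\<lambda>x. poly.coeff (\<Prod>j\<in>J. [:- g j x, 1:]) k) \<in> polyfun A n"
  using assms(2,3)
proof (induction J arbitrary: k rule: finite_induct)
  case empty
  show ?case using assms(1) by (auto intro!: polyfun.const simp: coeff_1)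
next
  case (insert j J)
  have *: "(\<lambda>x. - (g j x) * poly.coeff (\<Prod>j\<in>J. [:- g j x, 1:]) k) \<in> polyfun A n" for k
    using insert by (intro polyfun.mult polyfun_uminus assms(1)) auto
  show ?case
  proof (cases k)
    case 0
    then show ?thesis using * insert.hyps by simp
  next
    case (Suc k')
    then show ?thesis
      using polyfun.add[OF *[of k] insert.IH[of k']] insert.hyps insert.prems by simp
  qed
qed

section \<open>Symmetric values, resolvents and the group of relations\<close>

context root_enum
begin

abbreviation perms :: "(nat \<Rightarrow> nat) set" where
  "perms \<equiv> {\<pi>. \<pi> permutes {1..n}}"

lemma finite_perms: "finite perms"
  by (simp add: finite_permutations)

lemma sym_value_Rats:
  assumes "f \<in> polyfun \<rat> n" "\<And>\<pi>. \<pi> permutes {1..n} \<Longrightarrow> f (r \<circ> \<pi>) = f r"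
  shows "f r \<in> \<rat>"
proof -
  have "of_nat (fact n) * f r = (\<Sum>\<pi>\<in>perms. f (r \<circ> \<pi>))"
    using assms(2) card_permutations[of "{1..n}" n] by simp
  also have "\<dots> \<in> \<rat>" by (rule perm_sum_mem) (use assms in auto)
  finally have "of_nat (fact n) * f r / of_nat (fact n) \<in> \<rat>" by (rule Rats_divide) (rule Rats_of_nat)
  then show ?thesis by simp
qed

text \<open>Averaging yields only \<open>fact n * f r \<in> \<int>\<close>. But every power of
  \<open>f\<close> is symmetric as well, so \<open>fact n\<close> bounds the denominators of all
  powers of \<open>f r\<close>.\<close>

lemma sym_value_Ints:
  assumes "f \<in> polyfun \<int> n" "\<And>\<pi>. \<pi> permutes {1..n} \<Longrightarrow> f (r \<circ> \<pi>) = f r"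
  shows "f r \<in> \<int>"
proof (rule Ints_if_power_denominators_bounded)
  show "f r \<in> \<rat>" by (intro sym_value_Rats polyfun_Ints_Rats assms)
  show "(0::nat) < fact n" by simp
  fix k
  have "of_nat (fact n) * f r ^ k = (\<Sum>\<pi>\<in>perms. f (r \<circ> \<pi>) ^ k)"
    using assms(2) card_permutations[of "{1..n}" n] by simp
  also have "\<dots> \<in> \<int>"
    by (rule perm_sum_mem[of _ "\<lambda>x. f x ^ k"]) (use assms polyfun_power in auto)
  finally show "of_nat (fact n) * f r ^ k \<in> \<int>" .
qed

text \<open>The resolvent of \<open>f\<close>: a monic substitute for the minimal polynomial of
  \<open>f r\<close>, with all conjugates under the full symmetric group as roots.\<close>

definition conj_poly :: "((nat \<Rightarrow> complex) \<Rightarrow> complex) \<Rightarrow> complex poly" where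
  "conj_poly f = (\<Prod>\<pi>\<in>perms. [:- f (r \<circ> \<pi>), 1:])"

lemma poly_conj_poly: "\<pi> permutes {1..n} \<Longrightarrow> poly (conj_poly f) (f (r \<circ> \<pi>)) = 0"
  unfolding conj_poly_def poly_prod using finite_perms by (intro prod_zero) auto

lemma lead_coeff_conj_poly: "lead_coeff (conj_poly f) = 1"
  unfolding conj_poly_def by (simp add: lead_coeff_prod)

lemma conj_poly_sym:
  assumes "\<rho> permutes {1..n}"
  shows "(\<Prod>\<pi>\<in>perms. [:- f (r \<circ> \<rho> \<circ> \<pi>), 1:]) = conj_poly f"
  unfolding conj_poly_def
  by (rule prod.reindex_bij_witness[where j = "\<lambda>\<pi>. \<rho> \<circ> \<pi>" and i = "\<lambda>\<pi>. inv' \<rho> \<circ> \<pi>"])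
     (use assms in \<open>auto simp: permutes_compose permutes_inv o_assoc permutes_inv_o fun_eq_iff permutes_inverses\<close>)

lemma coeff_conj_poly_aux:
  assumes "A = \<int> \<or> A = \<rat>" "f \<in> polyfun A n"
  shows "(\<lambda>x. poly.coeff (\<Prod>\<pi>\<in>perms. [:- f (x \<circ> \<pi>), 1:]) k) \<in> polyfun A n"
proof (rule polyfun_coeff_prod_linear[OF assms(1) finite_perms])
  fix \<pi> assume "\<pi> \<in> perms"
  then show "(\<lambda>x. f (x \<circ> \<pi>)) \<in> polyfun A n"
    by (intro polyfun_permute[OF assms(2)]) (auto dest: permutes_in_image)
qed

lemma coeff_conj_poly_Rats: "f \<in> polyfun \<rat> n \<Longrightarrow> poly.coeff (conj_poly f) k \<in> \<rat>"
  using sym_value_Rats[OF coeff_conj_poly_aux[of \<rat> f k]] conj_poly_sym[of _ f] conj_poly_def[of f] by auto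

lemma coeff_conj_poly_Ints: "f \<in> polyfun \<int> n \<Longrightarrow> poly.coeff (conj_poly f) k \<in> \<int>"
  using sym_value_Ints[OF coeff_conj_poly_aux[of \<int> f k]] conj_poly_sym[of _ f] conj_poly_def[of f] by auto

lemma value_Rats_imp_Ints:
  assumes "f \<in> polyfun \<int> n" "f r \<in> \<rat>"
  shows "f r \<in> \<int>"
proof -
  have "algebraic_int (f r)"
    using lead_coeff_conj_poly coeff_conj_poly_Ints[OF assms(1)] poly_conj_poly[OF permutes_id, of f]
    by (intro algebraic_int.intros[of "conj_poly f"]) auto
  then show ?thesis using assms(2) rational_algebraic_int_is_int by blast
qed

text \<open>Removing the power of X leaves a rational \<open>E\<close> that vanishes at all nonzero
  conjugates of \<open>f r\<close> but not at 0. This factor yields both indicator functions and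
  inverses in the field of the roots.\<close>

lemma conj_poly_decomp:
  assumes "f \<in> polyfun \<rat> n"
  obtains E k where "conj_poly f = monom 1 k * E" "poly E 0 \<noteq> 0" "\<forall>i. poly.coeff E i \<in> \<rat>" "poly E 0 \<in> \<rat>"
proof -
  have nz: "conj_poly f \<noteq> 0" using lead_coeff_conj_poly[of f] by auto
  obtain E where E: "conj_poly f = [:- 0, 1:] ^ order 0 (conj_poly f) * E" "\<not> [:- 0, 1:] dvd E"
    using order_decomp[OF nz, of 0] by blast
  define k where "k = order 0 (conj_poly f)"
  have 1: "conj_poly f = monom 1 k * E" using E(1) by (simp add: monom_altdef k_def)
  have 2: "poly E 0 \<noteq> 0" using E(2) by (simp add: poly_eq_0_iff_dvd)
  have 3: "poly.coeff E i \<in> \<rat>" for i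
    using coeff_conj_poly_Rats[OF assms, of "k + i"] by (simp add: 1 coeff_monom_mult)
  have 4: "poly E 0 \<in> \<rat>" using 3[of 0] by (simp add: poly_0_coeff_0)
  show ?thesis using that 1 2 3 4 by blast
qed

lemma vanishing_indicator:
  assumes "f \<in> polyfun \<rat> n"
  shows "\<exists>e \<in> polyfun \<rat> n. \<forall>\<pi>\<in>perms. e (r \<circ> \<pi>) = (if f (r \<circ> \<pi>) = 0 then 1 else 0)"
proof -
  obtain E k where E: "conj_poly f = monom 1 k * E" "poly E 0 \<noteq> 0" "\<forall>i. poly.coeff E i \<in> \<rat>" "poly E 0 \<in> \<rat>"
    by (rule conj_poly_decomp[OF assms])
  define e where "e x = poly (smult (inverse (poly E 0)) E) (f x)" for x
  have "e \<in> polyfun \<rat> n" unfolding e_def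
    using E(3,4) by (intro polyfun_poly assms) auto
  moreover have "e (r \<circ> \<pi>) = (if f (r \<circ> \<pi>) = 0 then 1 else 0)" if "\<pi> \<in> perms" for \<pi>
  proof -
    have "f (r \<circ> \<pi>) ^ k * poly E (f (r \<circ> \<pi>)) = 0"
      using poly_conj_poly[of \<pi> f] that by (simp add: E(1) poly_monom)
    then show ?thesis using E(2) by (auto simp: e_def)
  qed
  ultimately show ?thesis by blast
qed

text \<open>Galois' original definition of the group, which avoids field automorphisms.\<close>

definition gal :: "(nat \<Rightarrow> nat) set" where
  "gal = {\<pi>. \<pi> permutes {1..n} \<and> (\<forall>f\<in>polyfun \<rat> n. f r = 0 \<longrightarrow> f (r \<circ> \<pi>) = 0)}"

lemma gal_permutes: "\<pi> \<in> gal \<Longrightarrow> \<pi> permutes {1..n}"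
  by (simp add: gal_def)

lemma finite_gal: "finite gal"
  by (rule finite_subset[OF _ finite_perms]) (auto simp: gal_def)

lemma gal_in: "\<pi> \<in> gal \<Longrightarrow> i \<in> {1..n} \<Longrightarrow> \<pi> i \<in> {1..n}"
  using permutes_in_image[OF gal_permutes] by blast

lemma gal_relation:
  assumes "\<pi> \<in> gal" "f \<in> polyfun \<rat> n" "g \<in> polyfun \<rat> n" "f r = g r"
  shows "f (r \<circ> \<pi>) = g (r \<circ> \<pi>)"
  using assms polyfun_diff[of \<rat> f n g] by (auto simp: gal_def dest!: bspec[of _ _ "\<lambda>x. f x - g x"])

lemma gal_polyfun: "A = \<int> \<or> A = \<rat> \<Longrightarrow> \<pi> \<in> gal \<Longrightarrow> f \<in> polyfun A n \<Longrightarrow> (\<lambda>x. f (x \<circ> \<pi>)) \<in> polyfun A n"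
  by (intro polyfun_permute) (auto dest: gal_in)

lemma gal_id: "id \<in> gal"
  by (simp add: gal_def permutes_id)

lemma gal_comp:
  assumes "\<pi> \<in> gal" "\<rho> \<in> gal"
  shows "\<pi> \<circ> \<rho> \<in> gal"
  unfolding gal_def
proof (intro CollectI conjI ballI impI)
  show "\<pi> \<circ> \<rho> permutes {1..n}" using assms by (intro permutes_compose gal_permutes)
  fix f assume f: "f \<in> polyfun \<rat> n" "f r = 0"
  have "(\<lambda>x. f (x \<circ> \<rho>)) \<in> polyfun \<rat> n" using gal_polyfun assms f by blast
  moreover have "f (r \<circ> \<rho>) = 0" using assms f by (auto simp: gal_def)
  ultimately have "f (r \<circ> \<pi> \<circ> \<rho>) = 0"
    using assms(1) unfolding gal_def by (auto dest: bspec[of _ _ "\<lambda>x. f (x \<circ> \<rho>)"])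
  then show "f (r \<circ> (\<pi> \<circ> \<rho>)) = 0" by (simp add: o_assoc)
qed

text \<open>The defining condition of \<open>gal\<close> is one-sided, so inverses come from
  finiteness: composition with \<open>\<pi>\<close> is an injective self-map of \<open>gal\<close>
  and therefore hits \<open>id\<close>.\<close>

lemma gal_inv:
  assumes "\<pi> \<in> gal"
  shows "inv' \<pi> \<in> gal"
proof -
  have "inj_on (\<lambda>\<rho>. \<pi> \<circ> \<rho>) gal"
    using permutes_inj[OF gal_permutes[OF assms]] by (auto simp: inj_on_def fun_eq_iff inj_def)
  then have "(\<lambda>\<rho>. \<pi> \<circ> \<rho>) ` gal = gal"
    using gal_comp[OF assms] by (intro endo_inj_surj finite_gal) auto
  then obtain \<rho> where \<rho>: "\<rho> \<in> gal" "\<pi> \<circ> \<rho> = id" using gal_id by (metis imageE)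
  have "inv' \<pi> = inv' \<pi> \<circ> (\<pi> \<circ> \<rho>)" using \<rho> by simp
  also have "\<dots> = \<rho>" using permutes_inv_o(2)[OF gal_permutes[OF assms]] by (simp add: o_assoc)
  finally show ?thesis using \<rho> by simp
qed

text \<open>Each permutation outside \<open>gal\<close> violates some rational relation. The
  indicator of the vanishing of that relation is 1 on \<open>gal\<close> and 0 at this permutation;
  the product over all outsiders is the desired function.\<close>

lemma gal_indicator:
  "\<exists>e \<in> polyfun \<rat> n. \<forall>\<pi>\<in>perms. e (r \<circ> \<pi>) = (if \<pi> \<in> gal then 1 else 0)"
proof -
  have "\<forall>\<pi>\<in>perms - gal. \<exists>f\<in>polyfun \<rat> n. f r = 0 \<and> f (r \<circ> \<pi>) \<noteq> 0"
    by (auto simp: gal_def)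
  then obtain f where f: "\<And>\<pi>. \<pi> \<in> perms - gal \<Longrightarrow> f \<pi> \<in> polyfun \<rat> n \<and> f \<pi> r = 0 \<and> f \<pi> (r \<circ> \<pi>) \<noteq> 0"
    by metis
  then have "\<forall>\<pi>\<in>perms - gal. \<exists>e \<in> polyfun \<rat> n. \<forall>\<sigma>\<in>perms. e (r \<circ> \<sigma>) = (if f \<pi> (r \<circ> \<sigma>) = 0 then 1 else 0)"
    using vanishing_indicator by blast
  then obtain e where e: "\<And>\<pi>. \<pi> \<in> perms - gal \<Longrightarrow> e \<pi> \<in> polyfun \<rat> n"
      "\<And>\<pi> \<sigma>. \<pi> \<in> perms - gal \<Longrightarrow> \<sigma> \<in> perms \<Longrightarrow> e \<pi> (r \<circ> \<sigma>) = (if f \<pi> (r \<circ> \<sigma>) = 0 then 1 else 0)"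
    by metis
  define E where "E x = (\<Prod>\<pi>\<in>perms - gal. e \<pi> x)" for x
  have "E \<in> polyfun \<rat> n" unfolding E_def using e(1) by (intro polyfun_prod) auto
  moreover have "E (r \<circ> \<sigma>) = (if \<sigma> \<in> gal then 1 else 0)" if "\<sigma> \<in> perms" for \<sigma>
  proof (cases "\<sigma> \<in> gal")
    case True
    then have "f \<pi> (r \<circ> \<sigma>) = 0" if "\<pi> \<in> perms - gal" for \<pi> using f[OF that] by (auto simp: gal_def)
    then have "E (r \<circ> \<sigma>) = (\<Prod>\<pi>\<in>perms - gal. 1)"
      unfolding E_def using that e(2) by (intro prod.cong) auto
    then show ?thesis using True by simp
  next
    case False
    then have "e \<sigma> (r \<circ> \<sigma>) = 0" using e(2)[of \<sigma> \<sigma>] f[of \<sigma>] that by auto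
    then show ?thesis using False that finite_perms unfolding E_def by (auto intro!: prod_zero)
  qed
  ultimately show ?thesis by blast
qed

text \<open>Multiplying by the indicator of \<open>gal\<close> extends the sum to all permutations,
  where rationality is already known.\<close>

lemma trace_Rats:
  assumes "f \<in> polyfun \<rat> n"
  shows "(\<Sum>\<pi>\<in>gal. f (r \<circ> \<pi>)) \<in> \<rat>"
proof -
  obtain e where e: "e \<in> polyfun \<rat> n" "\<And>\<pi>. \<pi>\<in>perms \<Longrightarrow> e (r \<circ> \<pi>) = (if \<pi> \<in> gal then 1 else 0)"
    using gal_indicator by blast
  have "(\<Sum>\<pi>\<in>perms. f (r \<circ> \<pi>) * e (r \<circ> \<pi>)) = (\<Sum>\<pi>\<in>gal. f (r \<circ> \<pi>))"
    using finite_perms gal_permutes by (intro sum.mono_neutral_cong_right) (auto simp: e(2))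
  moreover have "(\<Sum>\<pi>\<in>perms. f (r \<circ> \<pi>) * e (r \<circ> \<pi>)) \<in> \<rat>"
    by (rule perm_sum_mem[of _ "\<lambda>x. f x * e x"]) (use assms e in \<open>auto intro: polyfun.mult\<close>)
  ultimately show ?thesis by simp
qed

lemma trace_Ints:
  assumes "f \<in> polyfun \<int> n"
  shows "(\<Sum>\<pi>\<in>gal. f (r \<circ> \<pi>)) \<in> \<int>"
  by (rule value_Rats_imp_Ints[of "\<lambda>x. \<Sum>\<pi>\<in>gal. f (x \<circ> \<pi>)"])
     (use assms in \<open>auto intro!: polyfun_sum gal_polyfun trace_Rats polyfun_Ints_Rats\<close>)

lemma gal_fixed_Rats:
  assumes "f \<in> polyfun \<rat> n" "\<And>\<pi>. \<pi> \<in> gal \<Longrightarrow> f (r \<circ> \<pi>) = f r"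
  shows "f r \<in> \<rat>"
proof -
  have "of_nat (card gal) * f r \<in> \<rat>" using trace_Rats[OF assms(1)] assms(2) by simp
  moreover have "card gal > 0" using finite_gal gal_id by (auto simp: card_gt_0_iff)
  ultimately have "of_nat (card gal) * f r / of_nat (card gal) \<in> \<rat>" by (intro Rats_divide) auto
  then show ?thesis using \<open>card gal > 0\<close> by simp
qed

lemma gal_fixed_Ints:
  assumes "f \<in> polyfun \<int> n" "\<And>\<pi>. \<pi> \<in> gal \<Longrightarrow> f (r \<circ> \<pi>) = f r"
  shows "f r \<in> \<int>"
  using assms by (intro value_Rats_imp_Ints gal_fixed_Rats polyfun_Ints_Rats)

end

section \<open>Prime ideals above \<open>p\<close> and inertia\<close>

abbreviation ipoly :: "int poly \<Rightarrow> complex \<Rightarrow> complex" where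
  "ipoly Q \<equiv> poly (map_poly of_int Q)"

context root_enum
begin

definition rootring :: "complex set" where
  "rootring = (\<lambda>f. f r) ` polyfun \<int> n"

lemma rootringI: "f \<in> polyfun \<int> n \<Longrightarrow> f r \<in> rootring"
  by (auto simp: rootring_def)

lemma rootringE:
  assumes "x \<in> rootring" obtains f where "f \<in> polyfun \<int> n" "x = f r"
  using assms by (auto simp: rootring_def)

lemma rootring_perm: "f \<in> polyfun \<int> n \<Longrightarrow> \<pi> \<in> gal \<Longrightarrow> f (r \<circ> \<pi>) \<in> rootring"
  using rootringI[OF gal_polyfun[of \<int> \<pi> f]] by simp

lemma rootring_Ints: "x \<in> \<int> \<Longrightarrow> x \<in> rootring"
  using rootringI[OF polyfun.const] by simp

lemma rootring_root [simp]: "i \<in> {1..n} \<Longrightarrow> r i \<in> rootring"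
  using rootringI[OF polyfun.var] by simp

lemma rootring_add: "x \<in> rootring \<Longrightarrow> y \<in> rootring \<Longrightarrow> x + y \<in> rootring"
  by (elim rootringE) (auto intro: rootringI[OF polyfun.add])

lemma rootring_mult: "x \<in> rootring \<Longrightarrow> y \<in> rootring \<Longrightarrow> x * y \<in> rootring"
  by (elim rootringE) (auto intro: rootringI[OF polyfun.mult])

lemma rootring_diff: "x \<in> rootring \<Longrightarrow> y \<in> rootring \<Longrightarrow> x - y \<in> rootring"
  by (elim rootringE) (auto intro: rootringI[OF polyfun_diff])

lemma rootring_uminus: "x \<in> rootring \<Longrightarrow> - x \<in> rootring"
  by (elim rootringE) (auto intro: rootringI[OF polyfun_uminus])

lemma rootring_of_int [simp]: "of_int k \<in> rootring" and rootring_0 [simp]: "0 \<in> rootring"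
  and rootring_1 [simp]: "1 \<in> rootring" and rootring_of_nat [simp]: "of_nat m \<in> rootring"
  by (auto intro: rootring_Ints)

lemma rootring_sum: "(\<And>i. i \<in> J \<Longrightarrow> f i \<in> rootring) \<Longrightarrow> sum f J \<in> rootring"
  by (induction J rule: infinite_finite_induct) (auto intro: rootring_add)

lemma rootring_prod: "(\<And>i. i \<in> J \<Longrightarrow> f i \<in> rootring) \<Longrightarrow> prod f J \<in> rootring"
  by (induction J rule: infinite_finite_induct) (auto intro: rootring_mult)

lemma rootring_power: "x \<in> rootring \<Longrightarrow> x ^ k \<in> rootring"
  using rootring_prod[of "{..<k}" "\<lambda>_. x"] by simp

lemma rootring_ipoly: "x \<in> rootring \<Longrightarrow> ipoly Q x \<in> rootring"
  unfolding poly_altdef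
  by (intro rootring_sum rootring_mult rootring_power) (auto simp: coeff_map_poly)

lemmas rootring_intros = rootring_add rootring_mult rootring_diff rootring_uminus rootring_sum
  rootring_prod rootring_power rootring_ipoly rootring_root

lemma rootring_Rats_Ints: "x \<in> rootring \<Longrightarrow> x \<in> \<rat> \<Longrightarrow> x \<in> \<int>"
  by (auto elim!: rootringE intro: value_Rats_imp_Ints)

lemma ipoly_root: "i \<in> {1..n} \<Longrightarrow> ipoly F (r i) = 0"
  unfolding poly_F by (intro prod_zero) auto

definition ideal_over :: "int \<Rightarrow> complex set \<Rightarrow> bool" where
  "ideal_over p M \<longleftrightarrow> M \<subseteq> rootring \<and> of_int p \<in> M \<and> 1 \<notin> M \<and>
     (\<forall>x\<in>M. \<forall>y\<in>M. x + y \<in> M) \<and> (\<forall>x\<in>rootring. \<forall>y\<in>M. x * y \<in> M)"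

text \<open>The ideal generated by \<open>p\<close> is proper: otherwise 1/p would lie in
  \<open>rootring\<close>, whose rational elements are integers. Zorn's lemma enlarges it to a
  maximal one, and maximality is recorded as invertibility modulo \<open>M\<close>, the form used
  later.\<close>

lemma ex_maximal_ideal:
  assumes "prime p"
  shows "\<exists>M. ideal_over p M \<and> (\<forall>x\<in>rootring. x \<notin> M \<longrightarrow> (\<exists>y\<in>rootring. x * y - 1 \<in> M))"
proof -
  define \<A> where "\<A> = {M. ideal_over p M}"
  have p1: "\<bar>p\<bar> \<noteq> 1" using assms by (metis not_prime_unit zdvd1_eq)
  have "(\<lambda>x. of_int p * x) ` rootring \<in> \<A>"
  proof -
    have "1 \<noteq> of_int p * x" if x: "x \<in> rootring" for x
    proof
      assume *: "1 = of_int p * x"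
      then have "of_int p \<noteq> (0::complex)" by auto
      with * have "x = 1 / of_int p" by (simp add: field_simps)
      then have "x \<in> \<rat>" by simp
      then obtain k where "x = of_int k" using Ints_cases[OF rootring_Rats_Ints[OF x]] by blast
      with * have "(of_int 1 :: complex) = of_int (p * k)" by simp
      then have "1 = p * k" by (simp only: of_int_eq_iff)
      then show False using p1 zmult_eq_1_iff by force
    qed
    moreover have "of_int p * x + of_int p * y \<in> (\<lambda>x. of_int p * x) ` rootring"
      if "x \<in> rootring" "y \<in> rootring" for x y
      using rootring_add[OF that] by (auto simp: distrib_left[symmetric])
    moreover have "z * (of_int p * y) \<in> (\<lambda>x. of_int p * x) ` rootring"
      if "z \<in> rootring" "y \<in> rootring" for z y
      using rootring_mult[OF that] by (intro image_eqI[of _ _ "z * y"]) auto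
    moreover have "of_int p \<in> (\<lambda>x. of_int p * x) ` rootring"
      by (intro image_eqI[of _ _ 1]) auto
    ultimately show ?thesis
      by (auto simp: \<A>_def ideal_over_def image_iff intro!: rootring_mult)
  qed
  then have "\<A> \<noteq> {}" by blast
  moreover have "\<Union>\<C> \<in> \<A>" if "\<C> \<noteq> {}" "subset.chain \<A> \<C>" for \<C>
  proof -
    have sub: "\<And>M. M \<in> \<C> \<Longrightarrow> ideal_over p M" using that by (auto simp: subset.chain_def \<A>_def)
    have "x + y \<in> \<Union>\<C>" if xy: "x \<in> \<Union>\<C>" "y \<in> \<Union>\<C>" for x y
    proof -
      obtain M N where MN: "M \<in> \<C>" "N \<in> \<C>" "x \<in> M" "y \<in> N" using xy by blast
      then have "M \<subseteq> N \<or> N \<subseteq> M"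
        using \<open>subset.chain \<A> \<C>\<close> by (auto simp: subset.chain_def)
      then show ?thesis using MN sub unfolding ideal_over_def by blast
    qed
    moreover have "\<Union>\<C> \<subseteq> rootring" "1 \<notin> \<Union>\<C>" using sub unfolding ideal_over_def by blast+
    moreover have "of_int p \<in> \<Union>\<C>" using sub that(1) by (auto simp: ideal_over_def)
    moreover have "x * y \<in> \<Union>\<C>" if "x \<in> rootring" "y \<in> \<Union>\<C>" for x y
      using sub that by (fastforce simp: ideal_over_def)
    ultimately show ?thesis
      unfolding \<A>_def ideal_over_def by simp
  qed
  ultimately have "\<exists>M\<in>\<A>. \<forall>N\<in>\<A>. M \<subseteq> N \<longrightarrow> N = M" by (rule subset_Zorn_nonempty)
  then obtain M where M: "ideal_over p M" and max: "\<And>N. ideal_over p N \<Longrightarrow> M \<subseteq> N \<Longrightarrow> N = M"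
    by (auto simp: \<A>_def)
  have "\<exists>y\<in>rootring. x * y - 1 \<in> M" if x: "x \<in> rootring" "x \<notin> M" for x
  proof (rule ccontr)
    assume neg: "\<not> (\<exists>y\<in>rootring. x * y - 1 \<in> M)"
    \<comment> \<open>The ideal generated by \<open>M\<close> and \<open>x\<close>; it omits 1
      because \<open>x\<close> has no inverse modulo \<open>M\<close>.\<close>
    define N where "N = {m + x * y | m y. m \<in> M \<and> y \<in> rootring}"
    have M0: "0 \<in> M" using M unfolding ideal_over_def by (metis ex_in_conv mult_zero_left rootring_0 subsetD)
    have Mneg: "- m \<in> M" if "m \<in> M" for m
      using M that rootring_of_int[of "-1"] unfolding ideal_over_def by (metis mult_minus1 of_int_1 of_int_minus)
    have "M \<subseteq> N" unfolding N_def using rootring_0 by force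
    moreover have "x \<in> N" unfolding N_def using M0 rootring_1 by force
    moreover have "ideal_over p N"
      unfolding ideal_over_def
    proof (intro conjI ballI)
      show "N \<subseteq> rootring"
        using M x by (auto simp: N_def ideal_over_def intro!: rootring_add rootring_mult)
      show "of_int p \<in> N" using M \<open>M \<subseteq> N\<close> by (auto simp: ideal_over_def)
      show "1 \<notin> N"
      proof
        assume "1 \<in> N"
        then obtain m y where "m \<in> M" "y \<in> rootring" "1 = m + x * y" by (auto simp: N_def)
        then have "x * y - 1 = - m" by (simp add: algebra_simps)
        then show False using neg Mneg \<open>m \<in> M\<close> \<open>y \<in> rootring\<close> by metis
      qed
      fix u v assume "u \<in> N" "v \<in> N"
      then obtain m y m' y' where *: "m \<in> M" "y \<in> rootring" "m' \<in> M" "y' \<in> rootring"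
        "u = m + x * y" "v = m' + x * y'" by (auto simp: N_def)
      have "u + v = (m + m') + x * (y + y')" using * by (simp add: algebra_simps)
      moreover have "m + m' \<in> M" using * M by (auto simp: ideal_over_def)
      ultimately show "u + v \<in> N" unfolding N_def using * rootring_add by blast
    next
      fix u v assume "u \<in> rootring" "v \<in> N"
      then obtain m y where *: "m \<in> M" "y \<in> rootring" "v = m + x * y" by (auto simp: N_def)
      have "u * v = u * m + x * (u * y)" using * by (simp add: algebra_simps)
      moreover have "u * m \<in> M" using * M \<open>u \<in> rootring\<close> by (auto simp: ideal_over_def)
      ultimately show "u * v \<in> N" unfolding N_def using * rootring_mult \<open>u \<in> rootring\<close> by blast
    qed
    ultimately show False using max x by blast
  qed
  then show ?thesis using M by blast
qed

end

locale prime_over = root_enum +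
  fixes M :: "complex set" and p :: int
  assumes prime_p: "prime p" and M: "ideal_over p M"
    and M_maximal: "\<And>x. x \<in> rootring \<Longrightarrow> x \<notin> M \<Longrightarrow> \<exists>y\<in>rootring. x * y - 1 \<in> M"
begin

lemma M_sub: "x \<in> M \<Longrightarrow> x \<in> rootring" and M_p: "of_int p \<in> M" and M_1: "1 \<notin> M"
  and M_add: "x \<in> M \<Longrightarrow> y \<in> M \<Longrightarrow> x + y \<in> M"
  and M_mult: "z \<in> rootring \<Longrightarrow> y \<in> M \<Longrightarrow> z * y \<in> M"
  using M by (auto simp: ideal_over_def)

lemma M_mult2: "z \<in> rootring \<Longrightarrow> y \<in> M \<Longrightarrow> y * z \<in> M"
  by (subst mult.commute) (rule M_mult)

lemma M_0 [simp]: "0 \<in> M"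
  using M_mult[OF rootring_0 M_p] by simp

lemma M_uminus: "x \<in> M \<Longrightarrow> - x \<in> M"
  using M_mult[of "-1" x] rootring_of_int[of "-1"] by simp

lemma M_diff: "x \<in> M \<Longrightarrow> y \<in> M \<Longrightarrow> x - y \<in> M"
  using M_add[of x "- y"] M_uminus[of y] by simp

lemma M_swap: "x - y \<in> M \<Longrightarrow> y - x \<in> M"
  using M_uminus[of "x - y"] by simp

lemma M_trans: "x - y \<in> M \<Longrightarrow> y - z \<in> M \<Longrightarrow> x - z \<in> M"
  using M_add[of "x - y" "y - z"] by simp

lemma M_sum: "(\<And>i. i \<in> J \<Longrightarrow> f i \<in> M) \<Longrightarrow> sum f J \<in> M"
  by (induction J rule: infinite_finite_induct) (auto intro: M_add)

lemma M_cong: "x - y \<in> M \<Longrightarrow> x \<in> M \<longleftrightarrow> y \<in> M"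
  using M_add[of "x - y" y] M_diff[of x "x - y"] by auto

lemma M_cong_mult:
  assumes "x - x' \<in> M" "y - y' \<in> M" "x' \<in> rootring" "y \<in> rootring"
  shows "x * y - x' * y' \<in> M"
proof -
  have "x * y - x' * y' = (x - x') * y + x' * (y - y')" by (simp add: algebra_simps)
  then show ?thesis using M_add M_mult M_mult2 assms by simp
qed

lemma M_cong_add: "x - x' \<in> M \<Longrightarrow> y - y' \<in> M \<Longrightarrow> (x + y) - (x' + y') \<in> M"
  using M_add[of "x - x'" "y - y'"] by (simp add: algebra_simps)

lemma M_prime:
  assumes "x * y \<in> M" "x \<in> rootring" "y \<in> rootring"
  shows "x \<in> M \<or> y \<in> M"
proof (rule ccontr)
  assume *: "\<not> ?thesis"
  then obtain z where z: "z \<in> rootring" "x * z - 1 \<in> M" using M_maximal assms by blast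
  have "y = z * (x * y) - y * (x * z - 1)" by (simp add: algebra_simps)
  also have "\<dots> \<in> M" by (rule M_diff[OF M_mult[OF z(1) assms(1)] M_mult[OF assms(3) z(2)]])
  finally show False using * by blast
qed

lemma M_prime_prod:
  assumes "finite J" "\<And>i. i \<in> J \<Longrightarrow> f i \<in> rootring" "prod f J \<in> M"
  shows "\<exists>i\<in>J. f i \<in> M"
  using assms
proof (induction J rule: finite_induct)
  case empty
  then show ?case using M_1 by simp
next
  case (insert i J)
  then show ?case using M_prime[of "f i" "prod f J"] rootring_prod[of J f] by auto
qed

lemma M_prime_power: "x ^ k \<in> M \<Longrightarrow> x \<in> rootring \<Longrightarrow> x \<in> M"
  using M_prime_prod[of "{..<k}" "\<lambda>_. x"] by auto

lemma M_prod: "finite J \<Longrightarrow> i \<in> J \<Longrightarrow> f i \<in> M \<Longrightarrow> (\<And>i. i \<in> J \<Longrightarrow> f i \<in> rootring) \<Longrightarrow> prod f J \<in> M"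
  by (subst prod.remove[of J i]) (auto intro!: M_mult2 rootring_prod)

lemma M_of_int: "of_int a \<in> M \<longleftrightarrow> p dvd a"
proof
  assume a: "of_int a \<in> M"
  show "p dvd a"
  proof (rule ccontr)
    assume "\<not> p dvd a"
    then have "coprime p a" using prime_p by (rule prime_imp_coprime[rotated])
    then obtain u v where "u * p + v * a = 1" by (metis bezout_int coprime_imp_gcd_eq_1)
    then have "(1::complex) = of_int (u * p + v * a)" by simp
    also have "\<dots> = of_int u * of_int p + of_int v * of_int a" by simp
    also have "\<dots> \<in> M" by (intro M_add M_mult a M_p) auto
    finally show False using M_1 by simp
  qed
next
  assume "p dvd a"
  then obtain k where "a = p * k" by blast
  then show "of_int a \<in> M" using M_mult2[OF _ M_p, of "of_int k"] by simp
qed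

lemma M_cong_polyfun:
  assumes "f \<in> polyfun \<int> n" "\<And>i. i \<in> {1..n} \<Longrightarrow> \<pi> i \<in> {1..n}" "\<And>i. i \<in> {1..n} \<Longrightarrow> r (\<pi> i) - r i \<in> M"
  shows "f (r \<circ> \<pi>) - f r \<in> M"
  using assms(1)
proof (induction rule: polyfun.induct)
  case (add f g)
  then show ?case using M_cong_add by simp
next
  case (mult f g)
  have "g (r \<circ> \<pi>) \<in> rootring"
    using rootringI[OF polyfun_permute[OF mult.hyps(2) assms(2)]] .
  from M_cong_mult[OF mult.IH rootringI[OF mult.hyps(1)] this] show ?case .
qed (use assms(3) in auto)

lemma M_cong_ipoly:
  assumes "x \<in> rootring" "y \<in> rootring" "x - y \<in> M"
  shows "ipoly Q x - ipoly Q y \<in> M"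
proof (induction Q)
  case 0
  then show ?case by simp
next
  case (pCons a Q)
  have "(of_int a + x * ipoly Q x) - (of_int a + y * ipoly Q y) \<in> M"
    using pCons assms by (intro M_cong_add M_cong_mult) (auto intro: rootring_ipoly)
  then show ?case by (simp add: map_poly_pCons)
qed

text \<open>Triviality modulo \<open>M\<close> is asked of the generators \<open>r i\<close> only;
  \<open>M_cong_polyfun\<close> extends it to all of \<open>rootring\<close>.\<close>

definition inertia :: "(nat \<Rightarrow> nat) set" where
  "inertia = {\<pi> \<in> gal. \<forall>i\<in>{1..n}. r (\<pi> i) - r i \<in> M}"

lemma inertia_gal: "\<pi> \<in> inertia \<Longrightarrow> \<pi> \<in> gal"
  by (simp add: inertia_def)

lemma finite_inertia: "finite inertia"
  by (rule finite_subset[OF _ finite_gal]) (auto simp: inertia_def)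

lemma inertia_id: "id \<in> inertia"
  by (simp add: inertia_def gal_id)

lemma inertia_comp:
  assumes "\<pi> \<in> inertia" "\<rho> \<in> inertia" shows "\<pi> \<circ> \<rho> \<in> inertia"
proof -
  have "r (\<pi> (\<rho> i)) - r i \<in> M" if "i \<in> {1..n}" for i
    by (rule M_trans[of _ "r (\<rho> i)"]) (use assms that gal_in in \<open>auto simp: inertia_def\<close>)
  then show ?thesis using assms gal_comp by (auto simp: inertia_def)
qed

lemma inertia_inv:
  assumes "\<pi> \<in> inertia" shows "inv' \<pi> \<in> inertia"
proof -
  have \<pi>: "\<pi> permutes {1..n}" "inv' \<pi> \<in> gal" using assms gal_permutes gal_inv by (auto simp: inertia_def)
  have "r (inv' \<pi> i) - r i \<in> M" if "i \<in> {1..n}" for i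
  proof -
    have "r (\<pi> (inv' \<pi> i)) - r (inv' \<pi> i) \<in> M"
      using assms gal_in[OF \<pi>(2) that] by (simp add: inertia_def)
    then show ?thesis using M_swap permutes_inverses(1)[OF \<pi>(1)] by simp
  qed
  then show ?thesis using \<pi> by (auto simp: inertia_def)
qed

lemma inertia_cong: "\<pi> \<in> inertia \<Longrightarrow> f \<in> polyfun \<int> n \<Longrightarrow> f (r \<circ> \<pi>) - f r \<in> M"
  by (rule M_cong_polyfun) (auto simp: inertia_def dest: gal_in)

text \<open>Tameness: \<open>inertia\<close> is a subgroup of the symmetric group, so its order
  divides \<open>fact n\<close>, which is prime to \<open>p\<close>.\<close>

lemma card_inertia:
  assumes "p > int n"
  shows "\<not> p dvd int (card inertia)"
proof
  assume dvd: "p dvd int (card inertia)"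
  interpret S: Group.group "sym_group n" by (rule sym_group_is_group)
  have "subgroup inertia (sym_group n)"
  proof (rule S.subgroupI)
    show "inertia \<subseteq> carrier (sym_group n)"
      using inertia_gal gal_permutes by (auto simp: sym_group_carrier)
    show "inertia \<noteq> {}" using inertia_id by blast
    fix a assume "a \<in> inertia"
    then show "inv\<^bsub>sym_group n\<^esub> a \<in> inertia"
      using inertia_inv inertia_gal gal_permutes by (subst sym_group_inv_equality) (auto simp: sym_group_carrier)
  qed (auto simp: sym_group_mult inertia_comp)
  from S.lagrange[OF this] have "card inertia dvd fact n"
    by (metis dvd_triv_right Coset.order_def sym_group_card_carrier)
  then have "p dvd int (fact n)" using dvd by (meson dvd_trans of_nat_dvd_iff)
  then have "nat p dvd fact n" using prime_p by (metis int_dvd_int_iff nat_0_le prime_ge_0_int)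
  then show False using prime_p assms prime_dvd_fact_iff[of "nat p" n] by auto
qed

text \<open>A power of \<open>p\<close> enters only to the first order: if an element of \<open>M\<close> is fixed by the
  inertia group, then its valuation at \<open>M\<close> is at least that of \<open>p\<close>, since the extension is
  unramified below the inertia field.\<close>

lemma inertia_fixed_divisible:
  assumes f: "f \<in> polyfun \<int> n" "f r \<in> M" and fixed: "\<And>\<pi>. \<pi> \<in> inertia \<Longrightarrow> f (r \<circ> \<pi>) = f r"
    and card: "\<not> p dvd int (card inertia)"
  shows "\<exists>w y. w \<in> rootring \<and> w \<notin> M \<and> y \<in> rootring \<and> w * f r = of_int p * y"
proof -
  \<comment> \<open>At these conjugates \<open>f\<close> leaves \<open>M\<close>. The factor
    \<open>W\<close> below repairs them while staying outside \<open>M\<close> at \<open>r\<close>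
    and invariant under \<open>inertia\<close>.\<close>
  define bad where "bad = {\<tau> \<in> gal. f (r \<circ> \<tau>) \<notin> M}"
  have "\<exists>w\<in>polyfun \<int> n. w r \<notin> M \<and> w (r \<circ> \<tau>) \<in> M" if \<tau>: "\<tau> \<in> bad" for \<tau>
  proof -
    have \<tau>': "\<tau> \<in> gal" "f (r \<circ> \<tau>) \<notin> M" "inv' \<tau> \<in> gal" using \<tau> gal_inv by (auto simp: bad_def)
    obtain y where y: "y \<in> polyfun \<int> n" "f (r \<circ> \<tau>) * y r - 1 \<in> M"
      using M_maximal[OF rootring_perm[OF f(1) \<tau>'(1)] \<tau>'(2)] by (auto elim: rootringE)
    \<comment> \<open>\<open>y\<close> inverts \<open>f (r \<circ> \<tau>)\<close> modulo
      \<open>M\<close>. Transported back by \<open>inv' \<tau>\<close>, it puts \<open>w\<close>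
      into \<open>M\<close> at \<open>r \<circ> \<tau>\<close>, while at \<open>r\<close> the first
      term is in \<open>M\<close> and \<open>w\<close> is congruent to -1.\<close>
    define w where "w x = f x * y (x \<circ> inv' \<tau>) - 1" for x
    have y': "(\<lambda>x. y (x \<circ> inv' \<tau>)) \<in> polyfun \<int> n" by (rule gal_polyfun) (use y \<tau>' in auto)
    have "w \<in> polyfun \<int> n"
      unfolding w_def by (intro polyfun_diff polyfun.mult f y' polyfun.const) auto
    moreover have "w (r \<circ> \<tau>) \<in> M"
      using y(2) permutes_inv_o(1)[OF gal_permutes[OF \<tau>'(1)]] by (simp add: w_def o_assoc[symmetric])
    moreover have "w r \<notin> M"
    proof
      assume "w r \<in> M"
      moreover have "f r * y (r \<circ> inv' \<tau>) \<in> M"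
        by (intro M_mult2 f rootring_perm y \<tau>')
      ultimately have "f r * y (r \<circ> inv' \<tau>) - w r \<in> M" using M_diff by blast
      then show False using M_1 by (simp add: w_def)
    qed
    ultimately show ?thesis by blast
  qed
  then obtain w where w: "\<And>\<tau>. \<tau> \<in> bad \<Longrightarrow> w \<tau> \<in> polyfun \<int> n"
    "\<And>\<tau>. \<tau> \<in> bad \<Longrightarrow> w \<tau> r \<notin> M" "\<And>\<tau>. \<tau> \<in> bad \<Longrightarrow> w \<tau> (r \<circ> \<tau>) \<in> M" by metis
  have bad_gal: "\<tau> \<in> gal" if "\<tau> \<in> bad" for \<tau> using that by (simp add: bad_def)
  have fin_bad: "finite bad" using finite_gal by (simp add: bad_def)
  \<comment> \<open>The product over \<open>inertia\<close> makes \<open>W\<close> invariant; its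
    factors stay outside \<open>M\<close> at \<open>r\<close> because inertia does not change
    residues.\<close>
  define W where "W x = (\<Prod>\<tau>\<in>bad. \<Prod>\<iota>\<in>inertia. w \<tau> (x \<circ> \<iota>))" for x
  have W_poly: "W \<in> polyfun \<int> n"
    unfolding W_def using w(1) inertia_gal by (intro polyfun_prod gal_polyfun) auto
  have W_nin: "W r \<notin> M"
  proof
    assume "W r \<in> M"
    then obtain \<tau> \<iota> where *: "\<tau> \<in> bad" "\<iota> \<in> inertia" "w \<tau> (r \<circ> \<iota>) \<in> M"
      unfolding W_def using w(1) inertia_gal fin_bad finite_inertia
      by (fastforce dest!: M_prime_prod[rotated 2] intro!: rootring_prod rootring_perm)
    then show False using inertia_cong[of \<iota> "w \<tau>"] M_cong w by blast
  qed
  have W_fix: "W (r \<circ> \<iota>) = W r" if "\<iota> \<in> inertia" for \<iota>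
    unfolding W_def
    by (intro prod.cong refl prod.reindex_bij_witness[where j = "\<lambda>\<pi>. \<iota> \<circ> \<pi>" and i = "\<lambda>\<pi>. inv' \<iota> \<circ> \<pi>"])
       (use that gal_permutes[OF inertia_gal[OF that]] in
         \<open>auto intro: inertia_comp inertia_inv simp: o_assoc permutes_inv_o\<close>)
  have W_bad: "W (r \<circ> \<tau>) \<in> M" if "\<tau> \<in> bad" for \<tau>
  proof -
    have R: "w \<sigma> (r \<circ> \<tau> \<circ> \<iota>) \<in> rootring" if "\<sigma> \<in> bad" "\<iota> \<in> inertia" for \<sigma> \<iota>
      using rootring_perm[OF w(1)[OF that(1)] gal_comp[OF bad_gal[OF \<open>\<tau> \<in> bad\<close>] inertia_gal[OF that(2)]]]
      by (simp only: o_assoc)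
    have "(\<Prod>\<iota>\<in>inertia. w \<tau> (r \<circ> \<tau> \<circ> \<iota>)) \<in> M"
      using w(3)[OF that] R[OF that] by (intro M_prod[OF finite_inertia inertia_id]) simp_all
    then show ?thesis unfolding W_def
      using R by (intro M_prod[OF fin_bad that] rootring_prod)
  qed
  define U where "U = (\<lambda>x. f x * W x)"
  have U: "U \<in> polyfun \<int> n" unfolding U_def by (intro polyfun.mult f W_poly)
  have U_M: "U (r \<circ> \<tau>) \<in> M" if "\<tau> \<in> gal" for \<tau>
  proof (cases "\<tau> \<in> bad")
    case True
    then show ?thesis unfolding U_def using that by (intro M_mult rootring_perm f W_bad)
  next
    case False
    then have "f (r \<circ> \<tau>) \<in> M" using that by (simp add: bad_def)
    then show ?thesis unfolding U_def using that by (intro M_mult2 rootring_perm W_poly)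
  qed
  \<comment> \<open>\<open>v \<tau>\<close> will be an index whose root is moved to another residue
    class by \<open>\<tau>\<close>.\<close>
  have "\<forall>\<tau>\<in>gal - inertia. \<exists>i\<in>{1..n}. r (\<tau> i) - r i \<notin> M" by (auto simp: inertia_def)
  then obtain v where v: "\<And>\<tau>. \<tau> \<in> gal - inertia \<Longrightarrow> v \<tau> \<in> {1..n} \<and> r (\<tau> (v \<tau>)) - r (v \<tau>) \<notin> M"
    by metis
  \<comment> \<open>If all conjugates of \<open>g\<close> lie in \<open>M\<close>, its trace is an
    integer in \<open>M\<close>, hence a multiple of \<open>p\<close>. Expanding the product
    preserves this: the \<open>b \<tau>\<close> are constant in \<open>\<sigma>\<close>, and the
    root factors are absorbed into \<open>g\<close>, which is why \<open>g\<close> is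
    arbitrary.\<close>
  have expand: "\<exists>y\<in>rootring. (\<Sum>\<sigma>\<in>gal. g (r \<circ> \<sigma>) * (\<Prod>\<tau>\<in>T. b \<tau> - r (\<sigma> (v \<tau>)))) = of_int p * y"
    if "finite T" "g \<in> polyfun \<int> n" "\<And>\<sigma>. \<sigma> \<in> gal \<Longrightarrow> g (r \<circ> \<sigma>) \<in> M"
      "\<And>\<tau>. \<tau> \<in> T \<Longrightarrow> v \<tau> \<in> {1..n}" "\<And>\<tau>. \<tau> \<in> T \<Longrightarrow> b \<tau> \<in> rootring" for T g b
    using that
  proof (induction T arbitrary: g rule: finite_induct)
    case empty
    obtain k where k: "(\<Sum>\<sigma>\<in>gal. g (r \<circ> \<sigma>)) = of_int k"
      using trace_Ints[OF empty(1)] by (elim Ints_cases)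
    have "(\<Sum>\<sigma>\<in>gal. g (r \<circ> \<sigma>)) \<in> M" by (intro M_sum empty.prems(2))
    then have "p dvd k" by (simp add: k M_of_int)
    then obtain l where "k = p * l" by blast
    then show ?case using k by (intro bexI[of _ "of_int l"]) (simp_all add: o_def)
  next
    case (insert \<tau> T)
    have v\<tau>: "v \<tau> \<in> {1..n}" using insert.prems by blast
    have g': "(\<lambda>x. g x * x (v \<tau>)) \<in> polyfun \<int> n"
      by (intro polyfun.mult polyfun.var insert.prems v\<tau>)
    have "g (r \<circ> \<sigma>) * (r \<circ> \<sigma>) (v \<tau>) \<in> M" if "\<sigma> \<in> gal" for \<sigma>
      using M_mult2[OF rootring_root[OF gal_in[OF that v\<tau>]] insert.prems(2)[OF that]] by (simp add: o_def)
    from insert.IH[OF g' this] obtain y1 where y1: "y1 \<in> rootring"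
      "(\<Sum>\<sigma>\<in>gal. g (r \<circ> \<sigma>) * (r \<circ> \<sigma>) (v \<tau>) * (\<Prod>\<tau>\<in>T. b \<tau> - r (\<sigma> (v \<tau>)))) = of_int p * y1"
      using insert.prems by (auto simp: o_def)
    from insert.IH[OF insert.prems(1,2)] obtain y2 where y2: "y2 \<in> rootring"
      "(\<Sum>\<sigma>\<in>gal. g (r \<circ> \<sigma>) * (\<Prod>\<tau>\<in>T. b \<tau> - r (\<sigma> (v \<tau>)))) = of_int p * y2"
      using insert.prems by (auto simp: o_def)
    have "(\<Sum>\<sigma>\<in>gal. g (r \<circ> \<sigma>) * (\<Prod>\<tau>\<in>insert \<tau> T. b \<tau> - r (\<sigma> (v \<tau>)))) =
        b \<tau> * (\<Sum>\<sigma>\<in>gal. g (r \<circ> \<sigma>) * (\<Prod>\<tau>\<in>T. b \<tau> - r (\<sigma> (v \<tau>)))) -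
        (\<Sum>\<sigma>\<in>gal. g (r \<circ> \<sigma>) * (r \<circ> \<sigma>) (v \<tau>) * (\<Prod>\<tau>\<in>T. b \<tau> - r (\<sigma> (v \<tau>))))"
      using insert.hyps by (simp add: sum_distrib_left sum_subtractf[symmetric] algebra_simps o_def)
    also have "\<dots> = of_int p * (b \<tau> * y2 - y1)" unfolding y1 y2 by (simp add: algebra_simps)
    finally show ?case
      using y1(1) y2(1) insert.prems(4) by (intro bexI[of _ "b \<tau> * y2 - y1"]) (auto intro: rootring_intros simp: o_def)
  qed
  \<comment> \<open>An interpolation factor: the term with \<open>\<tau> = \<sigma>\<close> makes it
    vanish off \<open>inertia\<close>, while on \<open>inertia\<close> it is congruent to
    \<open>E id\<close>, which is outside \<open>M\<close>. It cuts the trace down to a sum over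
    \<open>inertia\<close>.\<close>
  define E where "E \<sigma> = (\<Prod>\<tau>\<in>gal - inertia. r (\<tau> (v \<tau>)) - r (\<sigma> (v \<tau>)))" for \<sigma>
  have E_R: "E \<sigma> \<in> rootring" if "\<sigma> \<in> gal" for \<sigma>
    unfolding E_def using v gal_in that by (intro rootring_prod rootring_diff rootring_root) auto
  have "\<exists>y\<in>rootring. (\<Sum>\<sigma>\<in>gal. U (r \<circ> \<sigma>) * E \<sigma>) = of_int p * y"
    unfolding E_def
  proof (rule expand)
    show "finite (gal - inertia)" using finite_gal by simp
    fix \<tau> assume "\<tau> \<in> gal - inertia"
    then show "v \<tau> \<in> {1..n}" "r (\<tau> (v \<tau>)) \<in> rootring"
      using v gal_in by auto
  qed (use U U_M in \<open>auto simp: o_def\<close>)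
  then obtain y where y: "y \<in> rootring" "(\<Sum>\<sigma>\<in>gal. U (r \<circ> \<sigma>) * E \<sigma>) = of_int p * y" by blast
  have "E \<sigma> = 0" if "\<sigma> \<in> gal - inertia" for \<sigma>
    unfolding E_def using that finite_gal by (intro prod_zero) auto
  then have "(\<Sum>\<sigma>\<in>gal. U (r \<circ> \<sigma>) * E \<sigma>) = (\<Sum>\<sigma>\<in>inertia. U (r \<circ> \<sigma>) * E \<sigma>)"
    using inertia_gal by (intro sum.mono_neutral_right finite_gal) auto
  also have "\<dots> = U r * (\<Sum>\<sigma>\<in>inertia. E \<sigma>)"
    using fixed W_fix by (simp add: U_def sum_distrib_left)
  finally have eq: "W r * (\<Sum>\<sigma>\<in>inertia. E \<sigma>) * f r = of_int p * y"
    using y(2) by (simp add: U_def mult_ac)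
  have E_id: "E id \<notin> M"
  proof
    assume "E id \<in> M"
    then have "\<exists>\<tau>\<in>gal - inertia. r (\<tau> (v \<tau>)) - r (v \<tau>) \<in> M"
      unfolding E_def using v gal_in finite_gal
      by (intro M_prime_prod) (auto intro!: rootring_diff)
    then show False using v by blast
  qed
  have E_cong: "E \<sigma> - E id \<in> M" if "\<sigma> \<in> inertia" for \<sigma>
  proof -
    have *: "(\<Prod>\<tau>\<in>T. r (\<tau> (v \<tau>)) - r (\<sigma> (v \<tau>))) - (\<Prod>\<tau>\<in>T. r (\<tau> (v \<tau>)) - r (v \<tau>)) \<in> M"
      if "finite T" "T \<subseteq> gal - inertia" for T
      using that
    proof (induction T rule: finite_induct)
      case (insert \<tau> T)
      have "v \<tau> \<in> {1..n}" "\<tau> \<in> gal" using v insert.prems by auto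
      then have "r (v \<tau>) - r (\<sigma> (v \<tau>)) \<in> M" using \<open>\<sigma> \<in> inertia\<close> M_swap by (auto simp: inertia_def)
      then have "(r (\<tau> (v \<tau>)) - r (\<sigma> (v \<tau>))) - (r (\<tau> (v \<tau>)) - r (v \<tau>)) \<in> M" by simp
      moreover have "(\<Prod>\<tau>\<in>T. r (\<tau> (v \<tau>)) - r (\<sigma> (v \<tau>))) \<in> rootring"
        using insert.prems v gal_in inertia_gal[OF \<open>\<sigma> \<in> inertia\<close>]
        by (intro rootring_prod rootring_diff rootring_root) auto
      ultimately show ?case
        using insert \<open>v \<tau> \<in> {1..n}\<close> \<open>\<tau> \<in> gal\<close> gal_in
        by (auto intro!: M_cong_mult rootring_diff)
    qed simp
    show ?thesis unfolding E_def using *[of "gal - inertia"] finite_gal by simp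
  qed
  \<comment> \<open>Modulo \<open>M\<close> the sum is the order of \<open>inertia\<close> times
    \<open>E id\<close>; here tameness enters.\<close>
  have "(\<Sum>\<sigma>\<in>inertia. E \<sigma>) \<notin> M"
  proof
    assume "(\<Sum>\<sigma>\<in>inertia. E \<sigma>) \<in> M"
    moreover have "(\<Sum>\<sigma>\<in>inertia. E \<sigma> - E id) \<in> M" using E_cong by (intro M_sum)
    ultimately have "(\<Sum>\<sigma>\<in>inertia. E \<sigma>) - (\<Sum>\<sigma>\<in>inertia. E \<sigma> - E id) \<in> M" by (rule M_diff)
    then have "of_int (int (card inertia)) * E id \<in> M" by (simp add: sum_subtractf)
    then show False using M_prime[of "of_int (int (card inertia))" "E id"] card E_id E_R[OF gal_id]
      M_of_int[of "int (card inertia)"] by auto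
  qed
  then have "W r * (\<Sum>\<sigma>\<in>inertia. E \<sigma>) \<notin> M"
    using M_prime[of "W r"] W_nin rootringI[OF W_poly] rootring_sum[of inertia E] E_R inertia_gal by blast
  moreover have "W r * (\<Sum>\<sigma>\<in>inertia. E \<sigma>) \<in> rootring"
    using E_R inertia_gal by (intro rootring_mult rootringI[OF W_poly] rootring_sum) auto
  ultimately show ?thesis using eq y(1) by blast
qed

end

lemma map_poly_of_int_add: "map_poly of_int (P + Q :: int poly) = (map_poly of_int P + map_poly of_int Q :: 'a :: comm_ring_1 poly)"
  by (intro poly_eqI) (simp add: coeff_map_poly)

lemma map_poly_of_int_diff: "map_poly of_int (P - Q :: int poly) = (map_poly of_int P - map_poly of_int Q :: 'a :: comm_ring_1 poly)"
  by (intro poly_eqI) (simp add: coeff_map_poly)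

lemma map_poly_of_int_mult: "map_poly of_int (P * Q :: int poly) = (map_poly of_int P * map_poly of_int Q :: 'a :: comm_ring_1 poly)"
  by (intro poly_eqI) (simp add: coeff_map_poly coeff_mult)

lemma map_poly_of_int_smult: "map_poly of_int (smult c P :: int poly) = (smult (of_int c) (map_poly of_int P) :: 'a :: comm_ring_1 poly)"
  by (intro poly_eqI) (simp add: coeff_map_poly)

lemma map_poly_of_int_pderiv: "map_poly of_int (pderiv P :: int poly) = (pderiv (map_poly of_int P) :: 'a :: idom poly)"
  by (intro poly_eqI) (simp add: coeff_map_poly coeff_pderiv)

lemma map_poly_of_int_pcompose_shift:
  "map_poly of_int (P \<circ>\<^sub>p [:a, 1:] :: int poly) = (map_poly of_int P \<circ>\<^sub>p [:of_int a, 1:] :: 'a :: comm_ring_1 poly)"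
proof (induction P)
  case 0
  then show ?case by simp
next
  case (pCons c P)
  have "map_poly of_int [:a, 1:] = ([:of_int a, 1:] :: 'a poly)" by (simp add: map_poly_pCons)
  then show ?case using pCons
    by (simp add: pcompose_pCons map_poly_of_int_add map_poly_of_int_mult map_poly_of_int_smult map_poly_pCons)
qed

lemma ipoly_of_int: "ipoly Q (of_int a) = of_int (poly Q a)"
  by (induction Q) (simp_all add: map_poly_pCons)

lemma ipoly_add: "ipoly (P + Q) x = ipoly P x + ipoly Q x"
  and ipoly_diff: "ipoly (P - Q) x = ipoly P x - ipoly Q x"
  and ipoly_mult: "ipoly (P * Q) x = ipoly P x * ipoly Q x"
  and ipoly_smult: "ipoly (smult c P) x = of_int c * ipoly P x"
  by (simp_all add: map_poly_of_int_add map_poly_of_int_diff map_poly_of_int_mult map_poly_of_int_smult)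

lemma ipoly_pCons: "ipoly (pCons a P) x = of_int a + x * ipoly P x" and ipoly_0: "ipoly 0 x = 0"
  and ipoly_1: "ipoly 1 x = 1"
  by (simp_all add: map_poly_pCons)

lemma ipoly_power: "ipoly (P ^ k) x = ipoly P x ^ k"
  by (induction k) (simp_all add: ipoly_mult)

lemma ipoly_monom: "ipoly (monom c k) x = of_int c * x ^ k"
  by (simp add: map_poly_monom poly_monom)

lemma ipoly_sum: "ipoly (sum f J) x = (\<Sum>i\<in>J. ipoly (f i) x)"
  by (induction J rule: infinite_finite_induct) (simp_all add: ipoly_add)

lemmas ipoly_simps = ipoly_add ipoly_diff ipoly_mult ipoly_smult ipoly_pCons ipoly_0 ipoly_1 ipoly_power
  ipoly_monom ipoly_sum

lemma orbit_image:
  assumes "finite H" "\<And>\<pi> \<rho>. \<pi> \<in> H \<Longrightarrow> \<rho> \<in> H \<Longrightarrow> \<pi> \<circ> \<rho> \<in> H" "\<pi> \<in> H" "inj \<pi>"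
  shows "\<pi> ` (\<lambda>\<rho>. \<rho> i) ` H = (\<lambda>\<rho>. \<rho> i) ` H"
proof (rule card_subset_eq)
  show "finite ((\<lambda>\<rho>. \<rho> i) ` H)" using assms by simp
  show "\<pi> ` (\<lambda>\<rho>. \<rho> i) ` H \<subseteq> (\<lambda>\<rho>. \<rho> i) ` H"
  proof (intro image_subsetI)
    fix x assume "x \<in> (\<lambda>\<rho>. \<rho> i) ` H"
    then obtain \<rho> where "\<rho> \<in> H" "x = \<rho> i" by blast
    then show "\<pi> x \<in> (\<lambda>\<rho>. \<rho> i) ` H"
      using assms(2)[OF assms(3)] by (intro image_eqI[of _ _ "\<pi> \<circ> \<rho>"]) auto
  qed
  show "card (\<pi> ` (\<lambda>\<rho>. \<rho> i) ` H) = card ((\<lambda>\<rho>. \<rho> i) ` H)"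
    using assms(4) by (intro card_image) (auto simp: inj_on_def inj_def)
qed

context root_enum
begin

lemma lead_coeff_F: "lead_coeff F = 1" and degree_F: "degree F = n"
proof -
  have "degree (map_poly of_int F :: complex poly) = n"
    unfolding F_eq by (subst degree_prod_eq_sum_degree) auto
  moreover have "degree (map_poly of_int F :: complex poly) = degree F"
    by (intro degree_map_poly) auto
  ultimately show "degree F = n" by simp
  have "lead_coeff (map_poly of_int F :: complex poly) = 1"
    unfolding F_eq by (simp add: lead_coeff_prod)
  then have "(of_int (lead_coeff F) :: complex) = 1"
    using \<open>degree F = n\<close> \<open>degree (map_poly of_int F :: complex poly) = n\<close> by (simp add: coeff_map_poly)
  then show "lead_coeff F = 1" by simp
qed

lemma poly_F_shift: "(\<Prod>i\<in>{1..n}. r i - of_int a) = of_int ((- 1) ^ n * poly F a)"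
proof -
  have "of_int (poly F a) = (\<Prod>i\<in>{1..n}. of_int a - r i)"
    using poly_F[of "of_int a"] by (simp add: ipoly_of_int)
  also have "\<dots> = (\<Prod>i\<in>{1..n}. (- 1) * (r i - of_int a))" by simp
  also have "\<dots> = (- 1) ^ n * (\<Prod>i\<in>{1..n}. r i - of_int a)"
    by (subst prod.distrib) simp
  finally show ?thesis by (simp add: mult.assoc[symmetric] power_mult_distrib[symmetric])
qed

lemma polyfun_prod_shift:
  "Q \<subseteq> {1..n} \<Longrightarrow> (\<lambda>x. \<Prod>k\<in>Q. x k - of_int a) \<in> polyfun \<int> n"
  by (intro polyfun_prod polyfun_diff polyfun.var polyfun.const) auto

lemma prod_shift_permute:
  assumes "\<pi> ` Q = Q" "inj \<pi>"
  shows "(\<Prod>k\<in>Q. (r \<circ> \<pi>) k - of_int a) = (\<Prod>k\<in>Q. r k - of_int a)"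
  using prod.reindex[of \<pi> Q "\<lambda>k. r k - of_int a"] assms by (simp add: inj_on_def inj_def)

lemma ipoly_pderiv_root:
  assumes "i \<in> {1..n}"
  shows "ipoly (pderiv F) (r i) = (\<Prod>k\<in>{1..n}-{i}. r i - r k)"
proof -
  have "ipoly (pderiv F) (r i) = (\<Sum>j\<in>{1..n}. \<Prod>k\<in>{1..n}-{j}. r i - r k)"
    by (simp add: map_poly_of_int_pderiv F_eq pderiv_prod poly_sum poly_prod pderiv_pCons)
  also have "\<dots> = (\<Sum>j\<in>{i}. \<Prod>k\<in>{1..n}-{j}. r i - r k)"
    using assms by (intro sum.mono_neutral_right) (auto intro!: prod_zero)
  finally show ?thesis by simp
qed

end

section \<open>Roots congruent to an integer modulo \<open>M\<close>\<close>

context prime_over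
begin

definition near :: "int \<Rightarrow> nat set" where
  "near a = {i\<in>{1..n}. r i - of_int a \<in> M}"

lemma near_sub: "near a \<subseteq> {1..n}" and finite_near [simp]: "finite (near a)"
  by (auto simp: near_def)

lemma inertia_near: "\<pi> \<in> inertia \<Longrightarrow> i \<in> near a \<Longrightarrow> \<pi> i \<in> near a"
proof -
  assume a: "\<pi> \<in> inertia" "i \<in> near a"
  then have "i \<in> {1..n}" "r (\<pi> i) - r i \<in> M" "r i - of_int a \<in> M"
    by (simp_all add: near_def inertia_def)
  then show ?thesis
    using M_trans[of "r (\<pi> i)" "r i" "of_int a"] gal_in[OF inertia_gal[OF a(1)]] unfolding near_def by blast
qed

lemma prime_sq_split:
  assumes "of_int (poly F a) * u = of_int (p ^ 2) * v" "u \<in> rootring" "v \<in> rootring" "u \<notin> M"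
    "p dvd poly F a"
  shows "p ^ 2 dvd poly F a"
proof -
  obtain c where c: "poly F a = p * c" using assms(5) by blast
  have "p \<noteq> 0" using prime_p by auto
  then have "of_int c * u = of_int p * v" using assms(1) by (simp add: c power2_eq_square mult.assoc)
  then have "of_int c * u \<in> M" using M_mult2[OF assms(3) M_p] by simp
  then have "p dvd c" using M_prime assms M_of_int by (metis rootring_of_int)
  then show ?thesis by (simp add: c power2_eq_square)
qed

text \<open>If \<open>near a\<close> had two inertia-stable pieces, the product of r_k - a over each
  would be an inertia-fixed element of \<open>M\<close>, hence a multiple of \<open>p\<close> up to
  a factor outside \<open>M\<close>; together they would give p^2 | F(a). This is Eisenstein's
  argument for the part of \<open>F\<close> near \<open>a\<close>.\<close>

lemma inertia_transitive:
  assumes F: "p dvd poly F a" "\<not> p ^ 2 dvd poly F a" and card: "\<not> p dvd int (card inertia)"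
    and ij: "i \<in> near a" "j \<in> near a"
  shows "\<exists>\<pi>\<in>inertia. \<pi> i = j"
proof (rule ccontr)
  assume neg: "\<not> ?thesis"
  define O1 where "O1 = (\<lambda>\<rho>. \<rho> i) ` inertia"
  define O2 where "O2 = near a - O1"
  have O1: "O1 \<subseteq> near a" "i \<in> O1"
    unfolding O1_def using inertia_near ij image_eqI[of i "\<lambda>\<rho>. \<rho> i" id, OF _ inertia_id] by auto
  have O2: "j \<in> O2" "O2 \<subseteq> near a" using neg ij by (auto simp: O2_def O1_def)
  have inj: "inj \<pi>" if "\<pi> \<in> inertia" for \<pi>
    using that inertia_gal gal_permutes permutes_inj by blast
  have im1: "\<pi> ` O1 = O1" if "\<pi> \<in> inertia" for \<pi>
    unfolding O1_def using that inj by (intro orbit_image finite_inertia inertia_comp)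
  have imS: "\<pi> ` near a = near a" if "\<pi> \<in> inertia" for \<pi>
    using that inj inertia_near by (intro endo_inj_surj) (auto simp: inj_on_def inj_def)
  have im2: "\<pi> ` O2 = O2" if "\<pi> \<in> inertia" for \<pi>
    unfolding O2_def using im1[OF that] imS[OF that] image_set_diff[OF inj[OF that]] by simp
  have *: "\<exists>w y. w \<in> rootring \<and> w \<notin> M \<and> y \<in> rootring \<and> w * (\<Prod>k\<in>Q. r k - of_int a) = of_int p * y"
    if Q: "Q \<subseteq> near a" "k \<in> Q" "\<And>\<pi>. \<pi> \<in> inertia \<Longrightarrow> \<pi> ` Q = Q" for Q k
  proof (rule inertia_fixed_divisible[OF polyfun_prod_shift])
    show "Q \<subseteq> {1..n}" using Q near_sub by blast
    show "(\<Prod>k\<in>Q. r k - of_int a) \<in> M"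
      using Q by (intro M_prod[of Q k] rootring_diff) (auto simp: near_def finite_subset[OF Q(1)])
    show "(\<Prod>k\<in>Q. (r \<circ> \<pi>) k - of_int a) = (\<Prod>k\<in>Q. r k - of_int a)" if "\<pi> \<in> inertia" for \<pi>
      using that Q(3) inj by (intro prod_shift_permute)
  qed (use card in simp)
  obtain w1 y1 where 1: "w1 \<in> rootring" "w1 \<notin> M" "y1 \<in> rootring" "w1 * (\<Prod>k\<in>O1. r k - of_int a) = of_int p * y1"
    using *[OF O1(1,2) im1] by blast
  obtain w2 y2 where 2: "w2 \<in> rootring" "w2 \<notin> M" "y2 \<in> rootring" "w2 * (\<Prod>k\<in>O2. r k - of_int a) = of_int p * y2"
    using *[OF O2(2,1) im2] by blast
  define R3 where "R3 = (\<Prod>k\<in>{1..n} - near a. r k - of_int a)"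
  have R3: "R3 \<in> rootring" unfolding R3_def by (intro rootring_prod rootring_diff) auto
  have "(\<Prod>i\<in>{1..n}. r i - of_int a) = (\<Prod>i\<in>near a. r i - of_int a) * R3"
    unfolding R3_def by (subst mult.commute) (intro prod.subset_diff near_sub, auto)
  also have "(\<Prod>i\<in>near a. r i - of_int a) = (\<Prod>k\<in>O2. r k - of_int a) * (\<Prod>k\<in>O1. r k - of_int a)"
    unfolding O2_def using O1(1) by (intro prod.subset_diff) auto
  finally have "of_int (poly F a) * ((- 1) ^ n * (w1 * w2)) =
      (w1 * (\<Prod>k\<in>O1. r k - of_int a)) * (w2 * (\<Prod>k\<in>O2. r k - of_int a)) * R3"
    by (simp add: poly_F_shift mult_ac)
  also have "\<dots> = of_int (p ^ 2) * (y1 * y2 * R3)" unfolding 1 2 by (simp add: power2_eq_square mult_ac)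
  finally have eq: "of_int (poly F a) * ((- 1) ^ n * (w1 * w2)) = of_int (p ^ 2) * (y1 * y2 * R3)" .
  have "w1 * w2 \<notin> M" using 1 2 M_prime by blast
  then have "(- 1) ^ n * (w1 * w2) \<notin> M" using M_uminus[of "- (w1 * w2)"] by (cases "even n") auto
  moreover have "(- 1) ^ n * (w1 * w2) \<in> rootring" "y1 * y2 * R3 \<in> rootring"
    using 1 2 R3 by (auto intro!: rootring_mult rootring_power rootring_uminus)
  ultimately show False using prime_sq_split[OF eq] F by blast
qed

lemma near_M_if_double:
  assumes "i \<in> {1..n}" "k \<in> {1..n}" "i \<noteq> k" "r i - r k \<in> M"
  shows "ipoly (pderiv F) (r i) \<in> M"
  unfolding ipoly_pderiv_root[OF assms(1)] using assms
  by (intro M_prod[of _ k] rootring_diff) auto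

text \<open>Moving \<open>i\<close> would produce a second root congruent to \<open>r i\<close>,
  hence a multiple root modulo \<open>M\<close>.\<close>

lemma inertia_fixes_simple:
  assumes "i \<in> {1..n}" "ipoly (pderiv F) (r i) \<notin> M" "\<pi> \<in> inertia"
  shows "\<pi> i = i"
proof (rule ccontr)
  assume "\<pi> i \<noteq> i"
  then show False
    using near_M_if_double[of i "\<pi> i"] assms gal_in[OF inertia_gal] M_swap by (auto simp: inertia_def)
qed

lemma gal_fixed_in_M_dvd:
  assumes "f \<in> polyfun \<int> n" "\<And>\<pi>. \<pi> \<in> gal \<Longrightarrow> f (r \<circ> \<pi>) = f r" "f r \<in> M"
  obtains k where "f r = of_int (p * k)"
proof -
  obtain l where l: "f r = of_int l" using Ints_cases[OF gal_fixed_Ints[OF assms(1,2)]] by blast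
  then have "p dvd l" using assms(3) M_of_int by simp
  then show ?thesis using that l by blast
qed

text \<open>If \<open>F(a)\<close> splits into two Galois-invariant factors in \<open>M\<close> then both are multiples of \<open>p\<close>.\<close>

lemma gal_invariant_split:
  assumes T: "T \<subseteq> {1..n}" and inv: "\<And>\<pi>. \<pi> \<in> gal \<Longrightarrow> (\<Prod>k\<in>T. r (\<pi> k) - of_int a) = (\<Prod>k\<in>T. r k - of_int a)"
    and nz: "poly F a \<noteq> 0" and ij: "i \<in> T" "i \<in> near a" "j \<in> near a" "j \<notin> T"
  shows "p ^ 2 dvd poly F a"
proof -
  define f where "f x = (\<Prod>k\<in>T. x k - of_int a)" for x :: "nat \<Rightarrow> complex"
  define g where "g x = (\<Prod>k\<in>{1..n}-T. x k - of_int a)" for x :: "nat \<Rightarrow> complex"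
  have f: "f \<in> polyfun \<int> n" unfolding f_def using T by (rule polyfun_prod_shift)
  have g: "g \<in> polyfun \<int> n" unfolding g_def by (rule polyfun_prod_shift) auto
  have f_inv: "f (r \<circ> \<pi>) = f r" if "\<pi> \<in> gal" for \<pi> using inv[OF that] by (simp add: f_def)
  have prod: "f x * g x = (\<Prod>k\<in>{1..n}. x k - of_int a)" for x
    unfolding f_def g_def using T by (subst mult.commute) (intro prod.subset_diff[symmetric], auto)
  have fr: "f r * g r = of_int ((- 1) ^ n * poly F a)" by (simp only: prod poly_F_shift)
  have fnz: "f r \<noteq> 0" using fr nz by auto
  \<comment> \<open>Only the product over \<open>T\<close> is known to be invariant, not the set
    \<open>T\<close> itself, so invariance of the complementary product is obtained by cancelling
    \<open>f r\<close>, which is nonzero because \<open>F(a)\<close> is.\<close>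
  have g_inv: "g (r \<circ> \<pi>) = g r" if "\<pi> \<in> gal" for \<pi>
  proof -
    have "f (r \<circ> \<pi>) * g (r \<circ> \<pi>) = (\<Prod>k\<in>{1..n}. r k - of_int a)"
      unfolding prod by (rule prod_shift_permute)
        (use gal_permutes[OF that] permutes_image permutes_inj in blast)+
    also have "\<dots> = f r * g r" by (simp only: prod)
    finally show ?thesis using f_inv[OF that] fnz by simp
  qed
  have "f r \<in> M" unfolding f_def using ij T finite_subset[OF T]
    by (intro M_prod[of _ i] rootring_diff) (auto simp: near_def)
  then obtain k where k: "f r = of_int (p * k)" using gal_fixed_in_M_dvd[OF f f_inv] by blast
  have "g r \<in> M" unfolding g_def using ij
    by (intro M_prod[of _ j] rootring_diff) (auto simp: near_def)
  then obtain l where l: "g r = of_int (p * l)" using gal_fixed_in_M_dvd[OF g g_inv] by blast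
  have "(of_int (p ^ 2 * (k * l)) :: complex) = of_int ((- 1) ^ n * poly F a)"
    using fr unfolding k l by (simp add: power2_eq_square mult_ac)
  then have "p ^ 2 * (k * l) = (- 1) ^ n * poly F a" by (simp only: of_int_eq_iff)
  then have "p ^ 2 dvd (- 1) ^ n * poly F a" by (metis dvd_triv_left)
  then show ?thesis by (cases "even n") auto
qed

text \<open>Otherwise the orbit of \<open>i\<close> is a proper invariant set, and since every root
  is near \<open>a\<close> the preceding splitting applies to it.\<close>

lemma eisenstein_transitive:
  assumes "near a = {1..n}" "\<not> p ^ 2 dvd poly F a" "i \<in> {1..n}" "j \<in> {1..n}"
  shows "\<exists>\<pi>\<in>gal. \<pi> i = j"
proof (rule ccontr)
  assume neg: "\<not> ?thesis"
  define T where "T = (\<lambda>\<rho>. \<rho> i) ` gal"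
  have "p ^ 2 dvd poly F a"
  proof (rule gal_invariant_split)
    show "T \<subseteq> {1..n}" unfolding T_def using gal_in assms by blast
    show "poly F a \<noteq> 0" using assms(2) by auto
    show "i \<in> T" unfolding T_def by (intro image_eqI[of _ _ id]) (auto simp: gal_id)
    show "j \<notin> T" using neg by (auto simp: T_def)
    fix \<pi> assume \<pi>: "\<pi> \<in> gal"
    have inj: "inj \<pi>" using gal_permutes[OF \<pi>] permutes_inj by blast
    have "\<pi> ` T = T" unfolding T_def using \<pi> inj by (intro orbit_image finite_gal gal_comp)
    from prod_shift_permute[OF this inj, of a]
    show "(\<Prod>k\<in>T. r (\<pi> k) - of_int a) = (\<Prod>k\<in>T. r k - of_int a)" by simp
  qed (use assms in auto)
  then show False using assms by blast
qed

text \<open>A multiple root reduces to \<open>a\<close>; the product of \<open>a - z\<close> over the distinct multiple roots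
  \<open>z\<close> is Galois-invariant, and so is the complementary product.\<close>

lemma distinct_roots:
  assumes simple: "\<And>i. i \<in> {1..n} \<Longrightarrow> ipoly (pderiv F) (r i) \<in> M \<Longrightarrow> i \<in> near a"
    and F: "\<not> p ^ 2 dvd poly F a"
  shows "inj_on r {1..n}"
proof (rule ccontr)
  assume "\<not> inj_on r {1..n}"
  then obtain i0 j0 where ij0: "i0 \<in> {1..n}" "j0 \<in> {1..n}" "i0 \<noteq> j0" "r i0 = r j0"
    by (auto simp: inj_on_def)
  define D where "D = {k\<in>{1..n}. \<exists>l\<in>{1..n}. l \<noteq> k \<and> r l = r k}"
  define rep where "rep k = (LEAST l. l \<in> {1..n} \<and> r l = r k)" for k
  have rep: "rep k \<in> {1..n} \<and> r (rep k) = r k" if "k \<in> {1..n}" for k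
    unfolding rep_def by (rule LeastI[of _ k]) (use that in auto)
  have rep_cong: "rep k = rep l" if "r k = r l" for k l using that by (simp add: rep_def)
  have D_near: "k \<in> near a" if "k \<in> D" for k
    using that near_M_if_double[of k] simple by (fastforce simp: D_def)
  \<comment> \<open>One index for each repeated value. \<open>T\<close> need not be stable under
    \<open>gal\<close>, but \<open>gal\<close> permutes \<open>D\<close> and respects equality of
    roots, so the values over \<open>T\<close> are permuted.\<close>
  define T where "T = {k \<in> D. rep k = k}"
  have repD: "rep k \<in> D" if "k \<in> D" for k
  proof (cases "rep k = k")
    case False
    then show ?thesis using that rep[of k] unfolding D_def by force
  qed (use that in simp)
  have repT: "rep k \<in> T" if "k \<in> D" for k
    using repD[OF that] rep_cong[of "rep k" k] rep[of k] that by (auto simp: T_def D_def)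
  have inj_T: "inj_on r T"
  proof (rule inj_onI)
    fix k l assume "k \<in> T" "l \<in> T" "r k = r l"
    then have "rep k = k" "rep l = l" "rep k = rep l" using rep_cong[of k l] unfolding T_def by blast+
    then show "k = l" by metis
  qed
  have rel: "r (\<pi> k) = r (\<pi> l) \<longleftrightarrow> r k = r l" if "\<pi> \<in> gal" "k \<in> {1..n}" "l \<in> {1..n}" for \<pi> k l
  proof -
    have *: "r (\<rho> k) = r (\<rho> l)" if "\<rho> \<in> gal" "r k = r l" "k \<in> {1..n}" "l \<in> {1..n}" for \<rho> k l
      using gal_relation[OF that(1) polyfun.var[OF that(3)] polyfun.var[OF that(4)]] that by simp
    have "r k = r l" if "r (\<pi> k) = r (\<pi> l)"
      using *[OF gal_inv[OF \<open>\<pi> \<in> gal\<close>] that] gal_in[OF \<open>\<pi> \<in> gal\<close>] \<open>k \<in> {1..n}\<close> \<open>l \<in> {1..n}\<close>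
        permutes_inverses(2)[OF gal_permutes[OF \<open>\<pi> \<in> gal\<close>]] by metis
    then show ?thesis using * that by blast
  qed
  have gal_D: "\<pi> ` D = D" if "\<pi> \<in> gal" for \<pi>
  proof (rule endo_inj_surj)
    show "finite D" by (simp add: D_def)
    show inj: "inj_on \<pi> D" using permutes_inj[OF gal_permutes[OF that]] by (auto simp: inj_on_def inj_def)
    show "\<pi> ` D \<subseteq> D"
    proof
      fix y assume "y \<in> \<pi> ` D"
      then obtain k where k: "k \<in> D" "y = \<pi> k" by blast
      then obtain l where l: "l \<in> {1..n}" "l \<noteq> k" "r l = r k" unfolding D_def by blast
      have "\<pi> l \<noteq> \<pi> k" using l permutes_inj[OF gal_permutes[OF that]] by (auto simp: inj_def)
      moreover have "r (\<pi> l) = r (\<pi> k)" using rel[OF that l(1), of k] l(3) k(1) unfolding D_def by blast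
      ultimately show "y \<in> D" using k l gal_in[OF that, of l] gal_in[OF that, of k] unfolding D_def by blast
    qed
  qed
  have T_prod: "(\<Prod>k\<in>T. r (\<pi> k) - of_int a) = (\<Prod>z\<in>r ` D. z - of_int a)" if "\<pi> \<in> gal" for \<pi>
  proof -
    have sub: "k \<in> {1..n}" if "k \<in> D" for k using that unfolding D_def by blast
    have "inj_on (\<lambda>k. r (\<pi> k)) T"
    proof (rule inj_onI)
      fix k l assume kl: "k \<in> T" "l \<in> T" "r (\<pi> k) = r (\<pi> l)"
      then have "k \<in> {1..n}" "l \<in> {1..n}" using sub unfolding T_def by blast+
      with rel[OF that] kl have "r k = r l" by blast
      with inj_T kl(1,2) show "k = l" by (simp add: inj_on_def)
    qed
    moreover have "(\<lambda>k. r (\<pi> k)) ` T = r ` D"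
    proof -
      have "(\<lambda>k. r (\<pi> k)) ` T = (\<lambda>k. r (\<pi> k)) ` D"
      proof
        show "(\<lambda>k. r (\<pi> k)) ` D \<subseteq> (\<lambda>k. r (\<pi> k)) ` T"
        proof
          fix y assume "y \<in> (\<lambda>k. r (\<pi> k)) ` D"
          then obtain k where k: "k \<in> D" "y = r (\<pi> k)" by blast
          then have "y = r (\<pi> (rep k))" using rel[OF that, of k "rep k"] rep[of k] sub by metis
          then show "y \<in> (\<lambda>k. r (\<pi> k)) ` T" using repT[OF k(1)] by blast
        qed
      qed (auto simp: T_def)
      also have "\<dots> = r ` \<pi> ` D" by (simp add: image_image)
      finally show ?thesis using gal_D[OF that] by simp
    qed
    ultimately show ?thesis using prod.reindex[of "\<lambda>k. r (\<pi> k)" T "\<lambda>z. z - of_int a"] by simp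
  qed
  have D0: "i0 \<in> D" "j0 \<in> D" using ij0 by (auto simp: D_def)
  \<comment> \<open>A second copy of a repeated root supplies the factor outside
    \<open>T\<close>.\<close>
  obtain j where j: "j \<in> D" "j \<notin> T"
    using D0 ij0(3) rep_cong[OF ij0(4)] unfolding T_def by (cases "rep i0 = i0") (metis (mono_tags) mem_Collect_eq)+
  have "p ^ 2 dvd poly F a"
  proof (rule gal_invariant_split)
    show "T \<subseteq> {1..n}" by (auto simp: T_def D_def)
    show "poly F a \<noteq> 0" using F by auto
    show "rep i0 \<in> T" using repT D0 by blast
    show "rep i0 \<in> near a" "j \<in> near a" using repD D0 D_near j by auto
    show "j \<notin> T" by fact
    show "(\<Prod>k\<in>T. r (\<pi> k) - of_int a) = (\<Prod>k\<in>T. r k - of_int a)" if "\<pi> \<in> gal" for \<pi>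
      using T_prod[OF that] T_prod[OF gal_id] by simp
  qed
  then show False using F by blast
qed

end

hide_const (open) Finite_Cartesian_Product.transpose
hide_fact (open) Finite_Cartesian_Product.transpose_def

context prime_over
begin

text \<open>Modulo \<open>M\<close>, F(X + a) is X^s times a polynomial with nonzero constant term:
  each root near \<open>a\<close> contributes X, the others do not vanish at 0. The predicate
  \<open>good m\<close> says that the order of vanishing at 0 modulo \<open>M\<close> is m.\<close>

lemma near_coeffs:
  fixes a :: int
  defines "s \<equiv> card (near a)" and "F' \<equiv> F \<circ>\<^sub>p [:a, 1:]"
  shows "k < s \<Longrightarrow> p dvd poly.coeff F' k" "\<not> p dvd poly.coeff F' s"
proof -
  define lin where "lin J = (\<Prod>i\<in>J. [:of_int a - r i, 1:])" for J
  define good where "good m Q \<longleftrightarrow> (\<forall>k. poly.coeff Q k \<in> rootring) \<and> (\<forall>k<m. poly.coeff Q k \<in> M) \<and> poly.coeff Q m \<notin> M"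
    for m and Q :: "complex poly"
  have R: "poly.coeff (lin J) k \<in> rootring" if "finite J" "J \<subseteq> {1..n}" for J k
    using that
  proof (induction J arbitrary: k rule: finite_induct)
    case empty
    then show ?case by (cases k) (simp_all add: lin_def)
  next
    case (insert i J)
    then have "(of_int a - r i) * poly.coeff (lin J) k \<in> rootring" for k
      by (intro rootring_mult rootring_diff) auto
    moreover have "lin (insert i J) = [:of_int a - r i, 1:] * lin J"
      using insert.hyps by (simp add: lin_def)
    ultimately show ?case
      using insert by (cases k) (auto intro: rootring_add)
  qed
  have base: "good 0 (lin ({1..n} - near a))"
  proof -
    have "poly.coeff (lin ({1..n} - near a)) 0 = (\<Prod>i\<in>{1..n} - near a. of_int a - r i)"
      by (simp add: lin_def poly_0_coeff_0[symmetric] poly_prod)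
    moreover have "(\<Prod>i\<in>{1..n} - near a. of_int a - r i) \<notin> M"
    proof
      assume "(\<Prod>i\<in>{1..n} - near a. of_int a - r i) \<in> M"
      then have "\<exists>i\<in>{1..n} - near a. of_int a - r i \<in> M"
        by (intro M_prime_prod) (auto intro!: rootring_diff)
      then show False using M_swap by (auto simp: near_def)
    qed
    ultimately show ?thesis using R[of "{1..n} - near a"] by (auto simp: good_def)
  qed
  have step: "good (card J) (lin J * lin ({1..n} - near a))" if "finite J" "J \<subseteq> near a" for J
    using that
  proof (induction J rule: finite_induct)
    case empty
    then show ?case using base by (simp add: lin_def)
  next
    case (insert i J)
    define Q where "Q = lin J * lin ({1..n} - near a)"
    have Q: "good (card J) Q" using insert by (simp add: Q_def)
    have i: "i \<in> {1..n}" "of_int a - r i \<in> M" using insert.prems M_swap by (auto simp: near_def)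
    have eq: "lin (insert i J) * lin ({1..n} - near a) = [:of_int a - r i, 1:] * Q"
      using insert.hyps by (simp add: lin_def Q_def mult.assoc del: mult_pCons_left)
    have c: "poly.coeff ([:of_int a - r i, 1:] * Q) (Suc k) = (of_int a - r i) * poly.coeff Q (Suc k) + poly.coeff Q k"
      "poly.coeff ([:of_int a - r i, 1:] * Q) 0 = (of_int a - r i) * poly.coeff Q 0" for k
      by simp_all
    have small: "(of_int a - r i) * poly.coeff Q k \<in> M" for k
      using Q i by (intro M_mult2) (auto simp: good_def)
    have "poly.coeff ([:of_int a - r i, 1:] * Q) k \<in> rootring" for k
      using Q small M_sub by (cases k) (auto simp del: mult_pCons_left simp: c good_def intro: rootring_add)
    moreover have "poly.coeff ([:of_int a - r i, 1:] * Q) k \<in> M" if "k < Suc (card J)" for k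
      using Q small that by (cases k) (auto simp del: mult_pCons_left simp: c good_def intro: M_add)
    moreover have "poly.coeff ([:of_int a - r i, 1:] * Q) (Suc (card J)) \<notin> M"
    proof
      assume "poly.coeff ([:of_int a - r i, 1:] * Q) (Suc (card J)) \<in> M"
      from M_diff[OF this[unfolded c] small[of "Suc (card J)"]] Q show False by (simp add: good_def)
    qed
    ultimately show ?case using insert.hyps unfolding eq good_def by simp
  qed
  have "map_poly of_int F' = (\<Prod>i\<in>{1..n}. [:- r i, 1:] \<circ>\<^sub>p [:of_int a, 1:])"
    by (simp add: F'_def map_poly_of_int_pcompose_shift F_eq pcompose_prod)
  also have "\<dots> = lin {1..n}"
    unfolding lin_def by (intro prod.cong) (auto simp: pcompose_pCons)
  also have "\<dots> = lin (near a) * lin ({1..n} - near a)"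
    unfolding lin_def by (subst mult.commute) (intro prod.subset_diff near_sub, auto)
  finally have eq: "map_poly of_int F' = lin (near a) * lin ({1..n} - near a)" .
  have "good s (map_poly of_int F')"
    unfolding eq s_def by (rule step) auto
  then show "k < s \<Longrightarrow> p dvd poly.coeff F' k" "\<not> p dvd poly.coeff F' s"
    by (auto simp: good_def coeff_map_poly M_of_int)
qed

text \<open>Compare orders of vanishing at \<open>a\<close> modulo \<open>p\<close>. If that of
  \<open>F\<close> is s, then 0 < s \<le> n < p, so that of F' is s - 1. As \<open>A\<close> does
  not vanish at \<open>a\<close> and B F has order at least s, the left side has order s - 1,
  whereas the right side has order \<open>j\<close>.\<close>

lemma card_near:
  assumes eq: "A * pderiv F + B * F = [:- a, 1:] ^ j * U + smult p E"
    and A: "\<not> p dvd poly A a" and U: "\<not> p dvd poly U a" and F: "p dvd poly F a" and pn: "p > int n"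
  shows "card (near a) = Suc j"
proof -
  define sh where "sh Q = Q \<circ>\<^sub>p [:a, 1:]" for Q :: "int poly"
  define s where "s = card (near a)"
  have low: "p dvd poly.coeff (sh F) k" if "k < s" for k using near_coeffs(1) that by (simp add: s_def sh_def)
  have high: "\<not> p dvd poly.coeff (sh F) s" using near_coeffs(2) by (simp add: s_def sh_def)
  have c0: "poly.coeff (sh Q) 0 = poly Q a" for Q
    by (simp add: sh_def poly_0_coeff_0[symmetric] poly_pcompose)
  have "s \<noteq> 0" using high F c0[of F] by (intro notI) simp
  then obtain t where t: "s = Suc t" using not0_implies_Suc by blast
  have "s \<le> n" unfolding s_def using card_mono[OF _ near_sub, of a] by simp
  then have ps: "\<not> p dvd int s" using pn t zdvd_imp_le[of p "int s"] by auto
  have "sh ([:- a, 1:] ^ j) = monom 1 j"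
  proof (induction j)
    case (Suc j)
    have "sh [:- a, 1:] = [:0, 1:]" by (simp add: sh_def pcompose_pCons)
    then show ?case using Suc by (simp only: sh_def power_Suc pcompose_mult) (simp add: monom_Suc)
  qed (simp add: sh_def pcompose_1)
  then have eq': "sh A * pderiv (sh F) + sh B * sh F = monom 1 j * sh U + smult p (sh E)"
    using arg_cong[OF eq, of sh] by (simp add: sh_def pcompose_add pcompose_mult pcompose_smult pderiv_pcompose pderiv_pCons)
  have coeff: "(\<Sum>i\<le>k. poly.coeff (sh A) i * poly.coeff (pderiv (sh F)) (k - i)) +
      (\<Sum>i\<le>k. poly.coeff (sh B) i * poly.coeff (sh F) (k - i)) =
      (if k < j then 0 else poly.coeff (sh U) (k - j)) + p * poly.coeff (sh E) k" for k
  proof -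
    have *: "poly.coeff (monom 1 j * sh U) k = (if k < j then 0 else poly.coeff (sh U) (k - j))"
      by (simp add: coeff_monom_mult)
    from arg_cong[OF eq', of "\<lambda>Q. poly.coeff Q k"]
    have "poly.coeff (sh A * pderiv (sh F)) k + poly.coeff (sh B * sh F) k =
        poly.coeff (monom 1 j * sh U) k + p * poly.coeff (sh E) k"
      by (simp only: coeff_add coeff_smult)
    then show ?thesis unfolding * by (simp only: coeff_mult)
  qed
  have B: "p dvd (\<Sum>i\<le>k. poly.coeff (sh B) i * poly.coeff (sh F) (k - i))" if "k < s" for k
    using that by (intro dvd_sum dvd_mult low) auto
  have pd: "p dvd poly.coeff (pderiv (sh F)) k" if "k < t" for k
    using low[of "Suc k"] that t by (simp add: coeff_pderiv)
  have "\<not> j < t"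
  proof
    assume "j < t"
    then have d1: "p dvd (\<Sum>i\<le>j. poly.coeff (sh A) i * poly.coeff (pderiv (sh F)) (j - i))"
      by (intro dvd_sum dvd_mult pd) auto
    have d2: "p dvd (\<Sum>i\<le>j. poly.coeff (sh B) i * poly.coeff (sh F) (j - i))"
      using \<open>j < t\<close> t by (intro B) simp
    have "p dvd poly.coeff (sh U) 0 + p * poly.coeff (sh E) j"
      using dvd_add[OF d1 d2] coeff[of j] by simp
    then show False using U c0[of U] by (simp add: dvd_add_left_iff)
  qed
  moreover have "\<not> t < j"
  proof
    assume "t < j"
    then have "p dvd (\<Sum>i\<le>t. poly.coeff (sh A) i * poly.coeff (pderiv (sh F)) (t - i)) +
      (\<Sum>i\<le>t. poly.coeff (sh B) i * poly.coeff (sh F) (t - i))"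
      using coeff[of t] by simp
    then have "p dvd (\<Sum>i\<le>t. poly.coeff (sh A) i * poly.coeff (pderiv (sh F)) (t - i))"
      using B[of t] t by (simp add: dvd_add_left_iff)
    also have "(\<Sum>i\<le>t. poly.coeff (sh A) i * poly.coeff (pderiv (sh F)) (t - i)) =
      poly.coeff (sh A) 0 * poly.coeff (pderiv (sh F)) t +
      (\<Sum>i\<in>{..t}-{0}. poly.coeff (sh A) i * poly.coeff (pderiv (sh F)) (t - i))"
      by (subst sum.remove[of _ 0]) auto
    finally have "p dvd poly.coeff (sh A) 0 * poly.coeff (pderiv (sh F)) t"
    proof (subst (asm) dvd_add_left_iff)
      show "p dvd (\<Sum>i\<in>{..t}-{0}. poly.coeff (sh A) i * poly.coeff (pderiv (sh F)) (t - i))"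
        by (intro dvd_sum dvd_mult pd) auto
    qed
    then have "p dvd poly A a * (int s * poly.coeff (sh F) s)"
      by (simp add: c0 coeff_pderiv t)
    then show False using A ps high prime_p by (simp add: prime_dvd_mult_iff)
  qed
  ultimately show ?thesis using t by (simp add: s_def)
qed

end

section \<open>The discriminant and even permutations\<close>

definition index_pairs :: "nat \<Rightarrow> (nat \<times> nat) set" where
  "index_pairs n = {(i, j). 1 \<le> i \<and> i < j \<and> j \<le> n}"

lemma finite_index_pairs: "finite (index_pairs n)"
  by (rule finite_subset[of _ "{1..n} \<times> {1..n}"]) (auto simp: index_pairs_def)

definition vandermonde :: "nat \<Rightarrow> (nat \<Rightarrow> complex) \<Rightarrow> complex" where
  "vandermonde n x = (\<Prod>(i, j)\<in>index_pairs n. x i - x j)"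

lemma polyfun_vandermonde: "vandermonde n \<in> polyfun \<rat> n"
  unfolding vandermonde_def[abs_def] case_prod_beta
  by (intro polyfun_prod polyfun_diff polyfun.var) (auto simp: index_pairs_def)

lemma vandermonde_adjacent:
  assumes "1 \<le> c" "Suc c \<le> n"
  shows "vandermonde n (x \<circ> transpose c (Suc c)) = - vandermonde n x"
proof -
  let ?t = "transpose c (Suc c)"
  have mem: "(c, Suc c) \<in> index_pairs n" using assms by (auto simp: index_pairs_def)
  have "(\<Prod>(i, j)\<in>index_pairs n - {(c, Suc c)}. x (?t i) - x (?t j)) =
      (\<Prod>(i, j)\<in>index_pairs n - {(c, Suc c)}. x i - x j)"
    by (rule prod.reindex_bij_witness[where i = "\<lambda>(i, j). (?t i, ?t j)" and j = "\<lambda>(i, j). (?t i, ?t j)"])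
       (use assms in \<open>auto simp: index_pairs_def transpose_def split: if_splits\<close>)
  then show ?thesis
    unfolding vandermonde_def prod.remove[OF finite_index_pairs mem] by (simp add: algebra_simps)
qed

text \<open>Induction on the distance: (a b) is the conjugate of (a c) by the adjacent transposition
  of c and b = c + 1, so the sign changes three times.\<close>

lemma vandermonde_transpose:
  assumes "1 \<le> a" "a < b" "b \<le> n"
  shows "vandermonde n (x \<circ> transpose a b) = - vandermonde n x"
  using assms(2,3)
proof (induction b arbitrary: x rule: less_induct)
  case (less b)
  show ?case
  proof (cases "b = Suc a")
    case True
    then show ?thesis using vandermonde_adjacent[of a n x] assms(1) less.prems by (simp add: o_def)
  next
    case False
    then obtain c where c: "b = Suc c" "a < c" using less.prems by (cases b) auto
    have eq: "x \<circ> transpose a b = x \<circ> transpose c (Suc c) \<circ> transpose a c \<circ> transpose c (Suc c)"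
      using c by (auto simp: fun_eq_iff transpose_def)
    have "vandermonde n (x \<circ> transpose a b) = - vandermonde n (x \<circ> transpose c (Suc c) \<circ> transpose a c)"
      unfolding eq by (rule vandermonde_adjacent) (use c less.prems assms(1) in auto)
    also have "\<dots> = vandermonde n (x \<circ> transpose c (Suc c))"
      using less.IH[of c "x \<circ> transpose c (Suc c)"] c less.prems by (simp add: o_def)
    also have "\<dots> = - vandermonde n x"
      by (rule vandermonde_adjacent) (use c less.prems assms(1) in auto)
    finally show ?thesis .
  qed
qed

lemma vandermonde_permute:
  assumes "\<pi> permutes {1..n}"
  shows "vandermonde n (x \<circ> \<pi>) = of_int (sign \<pi>) * vandermonde n x"
  using assms finite_atLeastAtMost
proof (induction arbitrary: x rule: permutes_induct)
  case id
  then show ?case by (simp add: sign_id)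
next
  case (swap a b q)
  have "vandermonde n (x \<circ> transpose a b) = - vandermonde n x"
    using vandermonde_transpose[of a b n x] vandermonde_transpose[of b a n x] swap
    by (cases "a < b") (auto simp: transpose_commute)
  moreover have "sign (transpose a b \<circ> q) = - sign q"
    using swap permutation_permutes[of q] by (subst sign_compose) (auto simp: sign_swap_id permutation_swap_id)
  ultimately show ?case
    using swap.IH[of "x \<circ> transpose a b"] by (simp add: o_def)
qed

lemma card_index_pairs: "2 * card (index_pairs n) = n * (n - 1)"
proof -
  have "{(i, j). i \<in> {1..n} \<and> j \<in> {1..n} - {i}} = index_pairs n \<union> prod.swap ` index_pairs n"
    by (force simp: index_pairs_def image_iff)
  moreover have "card (index_pairs n \<union> prod.swap ` index_pairs n) = 2 * card (index_pairs n)"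
    using finite_index_pairs by (subst card_Un_disjoint) (auto simp: index_pairs_def card_image)
  moreover have "{(i, j). i \<in> {1..n} \<and> j \<in> {1..n} - {i}} = (SIGMA i:{1..n}. {1..n} - {i})" by auto
  ultimately show ?thesis by (simp add: card_SigmaI)
qed

context root_enum
begin

lemma prod_pderiv_roots:
  "(\<Prod>i\<in>{1..n}. ipoly (pderiv F) (r i)) = (- 1) ^ (n * (n - 1) div 2) * vandermonde n r ^ 2"
proof -
  have "(\<Prod>i\<in>{1..n}. ipoly (pderiv F) (r i)) = (\<Prod>i\<in>{1..n}. \<Prod>k\<in>{1..n}-{i}. r i - r k)"
    by (intro prod.cong) (auto simp: ipoly_pderiv_root)
  also have "\<dots> = (\<Prod>(i, k)\<in>(SIGMA i:{1..n}. {1..n} - {i}). r i - r k)"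
    by (subst prod.Sigma) auto
  also have "(SIGMA i:{1..n}. {1..n} - {i}) = index_pairs n \<union> prod.swap ` index_pairs n"
    by (force simp: index_pairs_def image_iff)
  also have "(\<Prod>(i, k)\<in>\<dots>. r i - r k) = vandermonde n r * (\<Prod>(i, k)\<in>prod.swap ` index_pairs n. r i - r k)"
    unfolding vandermonde_def using finite_index_pairs
    by (subst prod.union_disjoint) (auto simp: index_pairs_def)
  also have "(\<Prod>(i, k)\<in>prod.swap ` index_pairs n. r i - r k) = (\<Prod>(i, k)\<in>index_pairs n. (- 1) * (r i - r k))"
    by (subst prod.reindex) (auto simp: case_prod_beta)
  also have "\<dots> = (- 1) ^ card (index_pairs n) * vandermonde n r"
    unfolding case_prod_beta vandermonde_def prod.distrib by simp
  also have "card (index_pairs n) = n * (n - 1) div 2"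
    using card_index_pairs[of n] by simp
  finally show ?thesis by (simp add: power2_eq_square mult_ac)
qed

text \<open>That the Vandermonde product equals \<open>Q r\<close> or \<open>- Q r\<close> is itself
  a rational relation, which \<open>gal\<close> preserves. As \<open>Q r\<close> is fixed and the
  product is nonzero, the sign must be 1.\<close>

lemma gal_even:
  assumes inj: "inj_on r {1..n}" and Q: "Q \<in> polyfun \<rat> n" "\<And>\<pi>. \<pi> \<in> gal \<Longrightarrow> Q (r \<circ> \<pi>) = Q r"
    and sq: "vandermonde n r ^ 2 = Q r ^ 2"
    and \<pi>: "\<pi> \<in> gal"
  shows "evenperm \<pi>"
proof -
  have nz: "vandermonde n r \<noteq> 0"
  proof -
    have "r i \<noteq> r j" if "(i, j) \<in> index_pairs n" for i j
      using that inj_onD[OF inj, of i j] by (auto simp: index_pairs_def)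
    then show ?thesis unfolding vandermonde_def using finite_index_pairs by (auto simp: prod_zero_iff)
  qed
  consider "vandermonde n r = Q r" | "vandermonde n r = - Q r" using sq by (auto simp: power2_eq_iff)
  then have "vandermonde n (r \<circ> \<pi>) = vandermonde n r"
  proof cases
    case 1
    then show ?thesis using gal_relation[OF \<pi> polyfun_vandermonde Q(1)] Q(2)[OF \<pi>] by simp
  next
    case 2
    then show ?thesis
      using gal_relation[OF \<pi> polyfun_vandermonde polyfun_uminus[OF _ Q(1)]] Q(2)[OF \<pi>] by simp
  qed
  then have "(of_int (sign \<pi>) :: complex) = 1"
    using vandermonde_permute[OF gal_permutes[OF \<pi>], of r] nz by simp
  then show ?thesis by (simp add: sign_def split: if_splits)
qed

end

text \<open>A replacement for Jordan's theorem on primitive groups. Lying in a common 3-cycle of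
  \<open>G\<close> is an equivalence relation. Since \<open>H\<close> is transitive on all but at
  most two points and fixes those, counting forces a single class, and then every 3-cycle is reached
  by conjugation.\<close>

lemma alt_group_subset_if_three_cycle:
  fixes G H :: "(nat \<Rightarrow> nat) set"
  assumes perm: "\<And>\<pi>. \<pi> \<in> G \<Longrightarrow> \<pi> permutes {1..n}"
    and id: "id \<in> G" and comp: "\<And>\<pi> \<rho>. \<pi> \<in> G \<Longrightarrow> \<rho> \<in> G \<Longrightarrow> \<pi> \<circ> \<rho> \<in> G"
    and inv: "\<And>\<pi>. \<pi> \<in> G \<Longrightarrow> inv' \<pi> \<in> G"
    and trans: "\<And>i j. i \<in> {1..n} \<Longrightarrow> j \<in> {1..n} \<Longrightarrow> \<exists>\<pi>\<in>G. \<pi> i = j"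
    and three: "distinct [a, b, c]" "{a, b, c} \<subseteq> {1..n}" "cycle_of_list [a, b, c] \<in> G"
    and H: "H \<subseteq> G" "S \<subset> {1..n}" "card ({1..n} - S) \<le> 2"
      "\<And>\<pi> i. \<pi> \<in> H \<Longrightarrow> i \<in> {1..n} - S \<Longrightarrow> \<pi> i = i"
      "\<And>i j. i \<in> S \<Longrightarrow> j \<in> S \<Longrightarrow> \<exists>\<pi>\<in>H. \<pi> i = j"
  shows "carrier (alt_group n) \<subseteq> G"
proof -
  \<comment> \<open>\<open>C\<close> is stable under conjugation by \<open>G\<close>, under rotation
    and, as the square of a 3-cycle is its inverse, under reversal; so the order of its arguments
    does not matter.\<close>
  define C where "C a b c \<longleftrightarrow> distinct [a, b, c] \<and> cycle_of_list [a, b, c] \<in> G" for a b c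
  have C_conj: "C (\<pi> a) (\<pi> b) (\<pi> c)" if "C a b c" "\<pi> \<in> G" for \<pi> a b c
  proof -
    have bij: "bij \<pi>" using perm[OF that(2)] permutes_bij by blast
    have "\<pi> \<circ> cycle_of_list [a, b, c] \<circ> inv' \<pi> = cycle_of_list (map \<pi> [a, b, c])"
      using that bij by (intro conjugation_of_cycle) (auto simp: C_def)
    moreover have "\<pi> \<circ> cycle_of_list [a, b, c] \<circ> inv' \<pi> \<in> G"
      using that by (intro comp inv) (auto simp: C_def)
    ultimately show ?thesis using that bij_is_inj[OF bij] by (auto simp: C_def inj_def)
  qed
  have C_rot: "C b c a" if "C a b c" for a b c
  proof -
    have "cycle_of_list [b, c, a] = cycle_of_list [a, b, c]"
      using that by (auto simp: C_def fun_eq_iff transpose_def)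
    then show ?thesis using that by (auto simp: C_def)
  qed
  have C_sq: "C b a c" if "C a b c" for a b c
  proof -
    have "cycle_of_list [b, a, c] = cycle_of_list [a, b, c] \<circ> cycle_of_list [a, b, c]"
      using that by (auto simp: C_def fun_eq_iff transpose_def)
    then show ?thesis using that comp by (auto simp: C_def)
  qed
  have C_rots: "C b c a" "C c a b" "C b a c" "C a c b" "C c b a" if "C a b c" for a b c
    using C_rot C_sq that by blast+
  have C_act: "C (cycle_of_list [x, y, z] a) (cycle_of_list [x, y, z] b) (cycle_of_list [x, y, z] c)"
    if "C a b c" "C x y z" for a b c x y z
    using C_conj[OF that(1)] that(2) unfolding C_def by blast
  define rel where "rel a b \<longleftrightarrow> a = b \<or> (\<exists>c. C a b c)" for a b
  have rel_sym: "rel b a" if "rel a b" for a b using that C_sq by (auto simp: rel_def)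
  have rel_trans: "rel a c" if ab: "rel a b" and bc: "rel b c" for a b c
  proof (cases "a = b \<or> b = c \<or> a = c")
    case True
    then show ?thesis using that by (auto simp: rel_def)
  next
    case False
    then obtain x y where x: "C a b x" and y: "C b c y" using ab bc by (auto simp: rel_def)
    show ?thesis
    proof (cases "x = c \<or> y = a")
      case True
      then have "C a b c" using x C_rots(2)[OF y] by blast
      then show ?thesis using C_rots(4) unfolding rel_def by blast
    next
      case xy: False
      \<comment> \<open>Conjugating (a b x) by (b c y) fixes a and sends b to c, so a and c share a
        3-cycle.\<close>
      have "cycle_of_list [b, c, y] a = a" "cycle_of_list [b, c, y] b = c"
        using False xy x y by (auto simp: transpose_def C_def)
      then show ?thesis using C_act[OF x y] by (auto simp: rel_def simp del: cycle_of_list.simps)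
    qed
  qed
  have rel_conj: "rel (\<pi> a) (\<pi> b)" if "rel a b" "\<pi> \<in> G" for a b \<pi>
    using that C_conj unfolding rel_def by blast
  have abc: "C a b c" using three by (simp add: C_def)
  \<comment> \<open>A 3-cycle through x has three points, and at most two points lie outside
    \<open>S\<close>.\<close>
  have big: "\<exists>y\<in>S. rel x y" if x: "x \<in> {1..n} - S" for x
  proof (rule ccontr)
    assume neg: "\<not> ?thesis"
    have "\<exists>\<pi>\<in>G. \<pi> a = x" using trans[of a x] three x by auto
    then obtain \<pi> where \<pi>: "\<pi> \<in> G" "\<pi> a = x" by blast
    have C': "C x (\<pi> b) (\<pi> c)" using C_conj[OF abc \<pi>(1)] \<pi>(2) by simp
    then have "rel x (\<pi> b)" "rel x (\<pi> c)" using C_rots[OF C'] by (auto simp: rel_def)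
    moreover have "\<pi> b \<in> {1..n}" "\<pi> c \<in> {1..n}"
      using permutes_in_image[OF perm[OF \<pi>(1)]] three by auto
    ultimately have "{x, \<pi> b, \<pi> c} \<subseteq> {1..n} - S" using neg x by blast
    then have "card {x, \<pi> b, \<pi> c} \<le> 2" using H(3) card_mono[of "{1..n} - S"] by (meson finite_Diff finite_atLeastAtMost le_trans)
    moreover have "card {x, \<pi> b, \<pi> c} = 3" using C' by (auto simp: C_def card_insert_if)
    ultimately show False by simp
  qed
  obtain x0 where x0: "x0 \<in> {1..n} - S" using H(2) by blast
  \<comment> \<open>\<open>H\<close> fixes x and carries one related point of \<open>S\<close> to
    any other.\<close>
  have rel_S: "rel x y" if xy: "x \<in> {1..n} - S" "y \<in> S" for x y
  proof -
    obtain z where z: "z \<in> S" "rel x z" using big \<open>x \<in> {1..n} - S\<close> by blast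
    obtain \<pi> where \<pi>: "\<pi> \<in> H" "\<pi> z = y" using H(5) z xy by blast
    have "rel (\<pi> x) (\<pi> z)" using rel_conj[OF z(2)] H(1) \<pi>(1) by blast
    then show ?thesis using H(4)[OF \<pi>(1) xy(1)] \<pi>(2) by simp
  qed
  have rel_all: "rel x y" if xy: "x \<in> {1..n}" "y \<in> {1..n}" for x y
  proof -
    have "rel x0 z" if z: "z \<in> {1..n}" for z
    proof (cases "z \<in> S")
      case False
      obtain w where "w \<in> S" "rel z w" using big False z by blast
      then show ?thesis using rel_trans[OF rel_S[OF x0] rel_sym] by blast
    qed (use rel_S[OF x0] in blast)
    then show ?thesis using rel_trans[OF rel_sym] xy by blast
  qed
  \<comment> \<open>Start from a 3-cycle (x y u); conjugation by one through u and z replaces u by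
    z. If the third point of the latter is x or y, its inverse is used instead and yields x, y, z in
    another order.\<close>
  have C_all: "C x y z" if xyz: "distinct [x, y, z]" "{x, y, z} \<subseteq> {1..n}" for x y z
  proof -
    obtain u where u: "C x y u" using rel_all[of x y] xyz by (auto simp: rel_def)
    show ?thesis
    proof (cases "u = z")
      case False
      have "u \<in> {1..n}"
      proof (rule ccontr)
        assume "u \<notin> {1..n}"
        then have "cycle_of_list [x, y, u] u = u"
          using permutes_not_in[OF perm] u by (simp add: C_def del: cycle_of_list.simps)
        then show False using u by (auto simp: C_def transpose_def split: if_splits)
      qed
      then obtain w where w: "C u z w" using rel_all[of u z] xyz False by (auto simp: rel_def)
      consider "w = x" | "w = y" | "w \<noteq> x" "w \<noteq> y" by blast
      then show ?thesis
      proof cases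
        case 1
        have w': "C z u w" by (rule C_sq[OF w])
        have "cycle_of_list [z, u, w] x = z" "cycle_of_list [z, u, w] y = y" "cycle_of_list [z, u, w] u = x"
          using False xyz u w 1 by (auto simp: transpose_def C_def)
        then have "C z y x" using C_act[OF u w'] by (simp del: cycle_of_list.simps)
        then show ?thesis using C_rots(5) by blast
      next
        case 2
        have w': "C z u w" by (rule C_sq[OF w])
        have "cycle_of_list [z, u, w] x = x" "cycle_of_list [z, u, w] y = z" "cycle_of_list [z, u, w] u = y"
          using False xyz u w 2 by (auto simp: transpose_def C_def)
        then have "C x z y" using C_act[OF u w'] by (simp del: cycle_of_list.simps)
        then show ?thesis using C_rots(4) by blast
      next
        case 3
        have "cycle_of_list [u, z, w] x = x" "cycle_of_list [u, z, w] y = y" "cycle_of_list [u, z, w] u = z"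
          using False xyz u w 3 by (auto simp: transpose_def C_def)
        then show ?thesis using C_act[OF u w] by (simp del: cycle_of_list.simps)
      qed
    qed (use u in simp)
  qed
  have cyc: "three_cycles n \<subseteq> G"
  proof
    fix p assume "p \<in> three_cycles n"
    then obtain cs where cs: "p = cycle_of_list cs" "cycle cs" "length cs = 3" "set cs \<subseteq> {1..n}" by auto
    obtain x y z where "cs = [x, y, z]" using stupid_lemma[OF cs(3)] by auto
    then show "p \<in> G" using C_all[of x y z] cs by (simp add: C_def del: cycle_of_list.simps)
  qed
  show ?thesis
  proof
    fix \<pi> assume "\<pi> \<in> carrier (alt_group n)"
    then have "\<pi> \<in> generate (alt_group n) (three_cycles n)"
      by (simp only: alt_group_carrier_as_three_cycles)
    then show "\<pi> \<in> G"
    proof (induction rule: generate.induct)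
      case one
      then show ?case using id by (simp add: alt_group_one id_def)
    next
      case (incl h)
      then show ?case using cyc by blast
    next
      case (inv h)
      then have "h \<in> carrier (alt_group n)" using three_cycles_incl by blast
      then show ?case using inv cyc assms(4) by (simp add: alt_group_inv_equality subset_iff)
    next
      case (eng h1 h2)
      then show ?case unfolding alt_group_mult by (intro comp)
    qed
  qed
qed

section \<open>The Galois group as a group of automorphisms\<close>

lemma ring_of_type_algebra_simps:
  "carrier (ring_of_type_algebra :: complex ring) = UNIV"
  "x \<otimes>\<^bsub>ring_of_type_algebra\<^esub> y = x * (y :: complex)"
  "x \<oplus>\<^bsub>ring_of_type_algebra\<^esub> y = x + (y :: complex)"
  "\<one>\<^bsub>ring_of_type_algebra\<^esub> = (1 :: complex)"
  "\<zero>\<^bsub>ring_of_type_algebra\<^esub> = (0 :: complex)"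
  by (simp_all add: ring_of_type_algebra_def)

lemma ring_of_type_algebra_inverse:
  "\<ominus>\<^bsub>ring_of_type_algebra\<^esub> x = - (x :: complex)"
  "x \<noteq> 0 \<Longrightarrow> inv\<^bsub>ring_of_type_algebra\<^esub> x = inverse (x :: complex)"
proof -
  interpret R: field "ring_of_type_algebra :: complex ring" by (rule field_from_type_algebra)
  show "\<ominus>\<^bsub>ring_of_type_algebra\<^esub> x = - x"
    by (rule R.minus_equality) (simp_all add: ring_of_type_algebra_simps)
  show "inv\<^bsub>ring_of_type_algebra\<^esub> x = inverse x" if "x \<noteq> 0"
    by (rule R.comm_inv_char) (use that in \<open>simp_all add: ring_of_type_algebra_simps\<close>)
qed

lemma polyfun_cong:
  "f \<in> polyfun A n \<Longrightarrow> (\<And>i. i \<in> {1..n} \<Longrightarrow> x i = y i) \<Longrightarrow> f x = f y"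
  by (induction rule: polyfun.induct) auto

lemma complex_poly_of_int: "complex_poly (map_poly of_int F) = map_poly of_int F"
  by (intro poly_eqI) (simp add: coeff_map_poly)

context root_enum
begin

lemma complex_roots_F: "complex_roots (map_poly of_int F) = r ` {1..n}"
  by (auto simp: complex_roots_def complex_poly_of_int poly_F prod_zero_iff)

definition root_field :: "complex set" where
  "root_field = (\<lambda>f. f r) ` polyfun \<rat> n"

lemma root_fieldI: "f \<in> polyfun \<rat> n \<Longrightarrow> f r \<in> root_field"
  by (simp add: root_field_def)

text \<open>\<open>E\<close> kills every nonzero \<open>z\<close>, so its nonzero constant term e
  equals -z E1(z). Dividing expresses the inverse of \<open>z\<close> as a polynomial in
  \<open>z\<close>.\<close>

lemma root_field_inverse:
  assumes "z \<in> root_field" "z \<noteq> 0"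
  shows "inverse z \<in> root_field"
proof -
  obtain f where f: "f \<in> polyfun \<rat> n" "z = f r" using assms(1) by (auto simp: root_field_def)
  obtain E k where E: "conj_poly f = monom 1 k * E" "poly E 0 \<noteq> 0" "\<forall>i. poly.coeff E i \<in> \<rat>" "poly E 0 \<in> \<rat>"
    by (rule conj_poly_decomp[OF f(1)])
  obtain e E1 where E1: "E = pCons e E1" by (cases E) auto
  have "z ^ k * poly E z = 0"
    using poly_conj_poly[OF permutes_id, of f] by (simp add: E(1) poly_monom f(2))
  then have z: "e + z * poly E1 z = 0" using assms(2) by (simp add: E1)
  have "e \<noteq> 0" using E(2) by (simp add: E1)
  then have "inverse z = poly (smult (- inverse e) E1) z"
    using z assms(2) by (simp add: field_simps eq_neg_iff_add_eq_0)
  also have "\<dots> \<in> root_field"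
    unfolding f(2)
  proof (rule root_fieldI, rule polyfun_poly)
    fix i
    have "poly.coeff E1 i \<in> \<rat>" using spec[OF E(3), of "Suc i"] by (simp add: E1)
    moreover have "e \<in> \<rat>" using E(4) by (simp add: E1)
    ultimately show "poly.coeff (smult (- inverse e) E1) i \<in> \<rat>" by simp
  qed (use f in auto)
  finally show ?thesis .
qed

lemma carrier_splitting_field: "carrier (splitting_field (map_poly of_int F)) = root_field"
proof -
  let ?R = "ring_of_type_algebra :: complex ring"
  have "generate_field ?R (\<rat> \<union> r ` {1..n}) \<subseteq> root_field"
  proof
    fix z assume "z \<in> generate_field ?R (\<rat> \<union> r ` {1..n})"
    then show "z \<in> root_field"
    proof (induction rule: generate_field.induct)
      case one
      then show ?case using root_fieldI[OF polyfun.const[of 1]] by (simp add: ring_of_type_algebra_simps)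
    next
      case (incl h)
      then show ?case
        using root_fieldI[OF polyfun.const[of h]] root_fieldI[OF polyfun.var] by auto
    next
      case (a_inv h)
      then show ?case
        by (auto simp: ring_of_type_algebra_inverse root_field_def intro!: image_eqI[OF _ polyfun_uminus])
    next
      case (m_inv h)
      then show ?case
        by (auto simp: ring_of_type_algebra_inverse ring_of_type_algebra_simps intro: root_field_inverse)
    next
      case (eng_add h1 h2)
      then show ?case
        by (auto simp: ring_of_type_algebra_simps root_field_def intro!: image_eqI[OF _ polyfun.add])
    next
      case (eng_mult h1 h2)
      then show ?case
        by (auto simp: ring_of_type_algebra_simps root_field_def intro!: image_eqI[OF _ polyfun.mult])
    qed
  qed
  moreover have "f r \<in> generate_field ?R (\<rat> \<union> r ` {1..n})" if "f \<in> polyfun \<rat> n" for f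
    using that
  proof (induction rule: polyfun.induct)
    case (add f g)
    then show ?case using generate_field.eng_add[OF add.IH] by (simp add: ring_of_type_algebra_simps)
  next
    case (mult f g)
    then show ?case using generate_field.eng_mult[OF mult.IH] by (simp add: ring_of_type_algebra_simps)
  qed (auto intro: generate_field.incl)
  ultimately show ?thesis
    unfolding splitting_field_def complex_roots_F by (auto simp: root_field_def)
qed

lemma splitting_field_simps:
  "x \<otimes>\<^bsub>splitting_field Q\<^esub> y = x * y" "x \<oplus>\<^bsub>splitting_field Q\<^esub> y = x + y"
  "\<one>\<^bsub>splitting_field Q\<^esub> = 1"
  by (simp_all add: splitting_field_def ring_of_type_algebra_def)

lemma galois_automorphism_polyfun:
  assumes "\<sigma> \<in> galois_automorphisms (map_poly of_int F)" "f \<in> polyfun \<rat> n"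
  shows "\<sigma> (f r) = f (\<sigma> \<circ> r)"
  using assms(2)
proof (induction rule: polyfun.induct)
  case (const c)
  then show ?case using assms(1) by (simp add: galois_automorphisms_def)
next
  case (add f g)
  have "\<sigma> \<in> ring_hom (splitting_field (map_poly of_int F)) (splitting_field (map_poly of_int F))"
    using assms(1) by (simp add: galois_automorphisms_def ring_iso_def)
  from ring_hom_add[OF this, unfolded carrier_splitting_field, OF root_fieldI[OF add.hyps(1)] root_fieldI[OF add.hyps(2)]]
  show ?case using add.IH by (simp add: splitting_field_simps)
next
  case (mult f g)
  have "\<sigma> \<in> ring_hom (splitting_field (map_poly of_int F)) (splitting_field (map_poly of_int F))"
    using assms(1) by (simp add: galois_automorphisms_def ring_iso_def)
  from ring_hom_mult[OF this, unfolded carrier_splitting_field, OF root_fieldI[OF mult.hyps(1)] root_fieldI[OF mult.hyps(2)]]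
  show ?case using mult.IH by (simp add: splitting_field_simps)
qed simp

lemma perm_of_automorphism_gal:
  assumes inj: "inj_on r {1..n}" and \<sigma>: "\<sigma> \<in> galois_automorphisms (map_poly of_int F)"
  shows "perm_of_automorphism n r \<sigma> \<in> gal"
proof -
  define \<pi> where "\<pi> = perm_of_automorphism n r \<sigma>"
  have iso: "\<sigma> \<in> ring_iso (splitting_field (map_poly of_int F)) (splitting_field (map_poly of_int F))"
    using \<sigma> by (simp add: galois_automorphisms_def)
  have fix_Rats: "\<sigma> q = q" if "q \<in> \<rat>" for q using \<sigma> that by (simp add: galois_automorphisms_def)
  have \<sigma>r: "\<sigma> (r i) \<in> r ` {1..n}" if i: "i \<in> {1..n}" for i
  proof -
    have "(\<lambda>x. ipoly F (x i)) \<in> polyfun \<rat> n"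
      by (rule polyfun_poly) (use polyfun.var[OF i] in \<open>auto simp: coeff_map_poly\<close>)
    from galois_automorphism_polyfun[OF \<sigma> this] have "ipoly F (\<sigma> (r i)) = 0"
      using ipoly_root[OF i] fix_Rats[of 0] by simp
    then show ?thesis unfolding poly_F by (auto simp: prod_zero_iff)
  qed
  have r\<pi>: "r (\<pi> i) = \<sigma> (r i)" if i: "i \<in> {1..n}" for i
    unfolding \<pi>_def perm_of_automorphism_def using \<sigma>r[OF i] i by (simp add: f_inv_into_f)
  have in\<pi>: "\<pi> i \<in> {1..n}" if i: "i \<in> {1..n}" for i
    unfolding \<pi>_def perm_of_automorphism_def using inv_into_into[OF \<sigma>r[OF i]] i by simp
  have "inj_on \<pi> {1..n}"
  proof (rule inj_onI)
    fix i j assume ij: "i \<in> {1..n}" "j \<in> {1..n}" "\<pi> i = \<pi> j"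
    then have "\<sigma> (r i) = \<sigma> (r j)" using r\<pi> by metis
    moreover have "inj_on \<sigma> root_field"
      using iso by (simp add: ring_iso_def bij_betw_def carrier_splitting_field)
    moreover have "r i \<in> root_field" "r j \<in> root_field"
      using root_fieldI[OF polyfun.var] ij by auto
    ultimately have "r i = r j" by (auto dest: inj_onD)
    then show "i = j" using inj ij by (auto dest: inj_onD)
  qed
  then have "bij_betw \<pi> {1..n} {1..n}"
    unfolding bij_betw_def using in\<pi> by (intro conjI endo_inj_surj) auto
  then have perm: "\<pi> permutes {1..n}"
    by (rule bij_imp_permutes) (auto simp: \<pi>_def perm_of_automorphism_def)
  have "f (r \<circ> \<pi>) = 0" if f: "f \<in> polyfun \<rat> n" "f r = 0" for f
  proof -
    have "f (r \<circ> \<pi>) = f (\<sigma> \<circ> r)" by (rule polyfun_cong[OF f(1)]) (simp add: r\<pi>)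
    also have "\<dots> = \<sigma> (f r)" by (rule galois_automorphism_polyfun[OF \<sigma> f(1), symmetric])
    finally show ?thesis using f fix_Rats[of 0] by simp
  qed
  then show ?thesis using perm by (simp add: gal_def \<pi>_def)
qed

text \<open>The automorphism sends \<open>f r\<close> to \<open>f (r \<circ> \<pi>)\<close>. That
  elements of \<open>gal\<close> preserve relations is exactly independence of the chosen
  \<open>f\<close>, and the inverse permutation gives bijectivity.\<close>

lemma gal_automorphism:
  assumes inj: "inj_on r {1..n}" and \<pi>: "\<pi> \<in> gal"
  shows "\<exists>\<sigma>\<in>galois_automorphisms (map_poly of_int F). perm_of_automorphism n r \<sigma> = \<pi>"
proof -
  define ev where "ev z = (SOME f. f \<in> polyfun \<rat> n \<and> f r = z)" for z
  have ev: "ev z \<in> polyfun \<rat> n \<and> ev z r = z" if "z \<in> root_field" for z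
  proof -
    have "\<exists>f. f \<in> polyfun \<rat> n \<and> f r = z" using that by (auto simp: root_field_def)
    then show ?thesis unfolding ev_def by (rule someI_ex)
  qed
  define \<sigma> where "\<sigma> z = (if z \<in> root_field then ev z (r \<circ> \<pi>) else undefined)" for z
  have \<sigma>: "\<sigma> (f r) = f (r \<circ> \<pi>)" if f: "f \<in> polyfun \<rat> n" for f
    using gal_relation[OF \<pi>, of "ev (f r)" f] ev[OF root_fieldI[OF f]] f by (simp add: \<sigma>_def root_fieldI)
  have in_field: "f (r \<circ> \<pi>) \<in> root_field" if "f \<in> polyfun \<rat> n" for f
    using root_fieldI[OF gal_polyfun[OF _ \<pi> that]] by simp
  have r_inv: "r \<circ> inv' \<pi> \<circ> \<pi> = r" "r \<circ> \<pi> \<circ> inv' \<pi> = r"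
    using permutes_inverses[OF gal_permutes[OF \<pi>]] by (simp_all add: fun_eq_iff)
  have bij: "bij_betw \<sigma> root_field root_field"
    unfolding bij_betw_def
  proof
    show "inj_on \<sigma> root_field"
    proof (rule inj_onI)
      fix y z assume "y \<in> root_field" "z \<in> root_field" "\<sigma> y = \<sigma> z"
      then obtain f g where fg: "f \<in> polyfun \<rat> n" "g \<in> polyfun \<rat> n" "y = f r" "z = g r" "\<sigma> (f r) = \<sigma> (g r)"
        unfolding root_field_def by blast
      note fg = fg(1-4) fg(5)[unfolded \<sigma>[OF fg(1)] \<sigma>[OF fg(2)]]
      have "(\<lambda>x. f (x \<circ> \<pi>)) (r \<circ> inv' \<pi>) = (\<lambda>x. g (x \<circ> \<pi>)) (r \<circ> inv' \<pi>)"
        by (rule gal_relation[OF gal_inv[OF \<pi>]]; (rule gal_polyfun[OF disjI2[OF refl] \<pi>])?; fact fg)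
      then show "y = z" unfolding fg(3,4) r_inv(1) .
    qed
    show "\<sigma> ` root_field = root_field"
    proof
      show "\<sigma> ` root_field \<subseteq> root_field" using \<sigma> in_field by (auto simp: root_field_def)
      show "root_field \<subseteq> \<sigma> ` root_field"
      proof
        fix z assume "z \<in> root_field"
        then obtain f where f: "f \<in> polyfun \<rat> n" "z = f r" by (auto simp: root_field_def)
        have g: "(\<lambda>x. f (x \<circ> inv' \<pi>)) \<in> polyfun \<rat> n" by (rule gal_polyfun[OF _ gal_inv[OF \<pi>] f(1)]) simp
        have "\<sigma> (f (r \<circ> inv' \<pi>)) = f (r \<circ> \<pi> \<circ> inv' \<pi>)" using \<sigma>[OF g] .
        also have "\<dots> = z" unfolding f(2) r_inv(2) ..
        finally show "z \<in> \<sigma> ` root_field" using root_fieldI[OF g] by force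
      qed
    qed
  qed
  have "\<sigma> \<in> ring_hom (splitting_field (map_poly of_int F)) (splitting_field (map_poly of_int F))"
  proof (rule ring_hom_memI, unfold carrier_splitting_field splitting_field_simps)
    fix x y assume "x \<in> root_field" "y \<in> root_field"
    then obtain f g where fg: "f \<in> polyfun \<rat> n" "g \<in> polyfun \<rat> n" "x = f r" "y = g r"
      by (auto simp: root_field_def)
    show "\<sigma> (x * y) = \<sigma> x * \<sigma> y" using \<sigma>[OF polyfun.mult[OF fg(1,2)]] \<sigma> fg by simp
    show "\<sigma> (x + y) = \<sigma> x + \<sigma> y" using \<sigma>[OF polyfun.add[OF fg(1,2)]] \<sigma> fg by simp
  next
    fix x assume "x \<in> root_field"
    then show "\<sigma> x \<in> root_field" using bij by (auto simp: bij_betw_def)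
  next
    show "\<sigma> 1 = 1" using \<sigma>[OF polyfun.const[of 1]] by simp
  qed
  then have "\<sigma> \<in> galois_automorphisms (map_poly of_int F)"
    using bij \<sigma>[OF polyfun.const]
    by (auto simp: galois_automorphisms_def ring_iso_def carrier_splitting_field extensional_def \<sigma>_def)
  moreover have "perm_of_automorphism n r \<sigma> = \<pi>"
  proof
    fix i
    show "perm_of_automorphism n r \<sigma> i = \<pi> i"
    proof (cases "i \<in> {1..n}")
      case True
      have "\<sigma> (r i) = r (\<pi> i)" using \<sigma>[OF polyfun.var[OF True]] by simp
      then show ?thesis using True gal_in[OF \<pi>] inj by (simp add: perm_of_automorphism_def inv_into_f_f)
    next
      case False
      then show ?thesis using permutes_not_in[OF gal_permutes[OF \<pi>]] by (auto simp: perm_of_automorphism_def)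
    qed
  qed
  ultimately show ?thesis by blast
qed

lemma galois_group_eq_gal:
  assumes inj: "inj_on r {1..n}"
  shows "galois_group_eq (map_poly of_int F) gal"
proof -
  have deg: "degree (map_poly of_int F :: rat poly) = n"
    using degree_F by (subst degree_map_poly) auto
  have "separable (map_poly of_int F)"
    unfolding separable_def complex_poly_of_int rsquarefree_roots
  proof (intro allI notI)
    fix a assume a: "ipoly F a = 0 \<and> poly (pderiv (map_poly of_int F)) a = 0"
    then obtain i where i: "i \<in> {1..n}" "a = r i" unfolding poly_F by (auto simp: prod_zero_iff)
    then have "(\<Prod>k\<in>{1..n}-{i}. r i - r k) = 0"
      using a ipoly_pderiv_root[OF i(1)] by (simp add: map_poly_of_int_pderiv)
    then have "\<exists>k\<in>{1..n}-{i}. r i - r k = 0" by (simp add: prod_zero_iff)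
    then obtain k where k: "k \<in> {1..n} - {i}" "r i - r k = 0" by blast
    then have "i = k" using i(1) by (intro inj_onD[OF inj]) auto
    then show False using k by blast
  qed
  moreover have "bij_betw r {1..n} (complex_roots (map_poly of_int F))"
    using inj by (simp add: bij_betw_def complex_roots_F)
  moreover have "perm_of_automorphism n r ` galois_automorphisms (map_poly of_int F) = gal"
    using perm_of_automorphism_gal[OF inj] gal_automorphism[OF inj] by blast
  ultimately show ?thesis unfolding galois_group_eq_def deg by blast
qed

end

lemma ex_root_enum:
  fixes F :: "int poly"
  assumes "lead_coeff F = 1" "degree F = n"
  obtains r where "root_enum n r F"
proof -
  define P where "P = (map_poly of_int F :: complex poly)"
  have deg: "degree P = n" unfolding P_def using assms(2) by (subst degree_map_poly) auto
  have lead: "lead_coeff P = 1" using assms deg by (simp add: P_def coeff_map_poly)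
  have "\<exists>A. size A = degree P \<and> P = smult (lead_coeff P) (\<Prod>x\<in>#A. [:- x, 1:])"
    by (rule alg_closed_imp_factorization) (use lead in auto)
  then obtain A where A: "size A = n" "P = (\<Prod>x\<in>#A. [:- x, 1:])" using deg lead by auto
  obtain xs where xs: "mset xs = A" using ex_mset by blast
  have len: "length xs = n" using A(1) xs by auto
  have "P = prod_list (map (\<lambda>x. [:- x, 1:]) xs)"
    unfolding A(2) xs[symmetric] by (simp only: mset_map[symmetric] prod_mset_prod_list)
  also have "\<dots> = (\<Prod>i\<in>{0..<n}. [:- (xs ! i), 1:])"
    by (simp add: prod.list_conv_set_nth len)
  also have "\<dots> = (\<Prod>i\<in>{1..n}. [:- (xs ! (i - 1)), 1:])"
    by (rule prod.reindex_bij_witness[where i = "\<lambda>i. i - 1" and j = Suc]) auto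
  finally have "root_enum n (\<lambda>i. xs ! (i - 1)) F" unfolding P_def by unfold_locales
  then show ?thesis using that by blast
qed

section \<open>Criteria for the alternating group\<close>

context root_enum
begin

lemma ex_prime_over: "prime p \<Longrightarrow> \<exists>M. prime_over n r F M p"
  using ex_maximal_ideal[of p] by (auto simp: prime_over_def prime_over_axioms_def root_enum_axioms)

text \<open>The name refers to the part of \<open>F\<close> near \<open>a\<close>: translated by
  \<open>a\<close>, it behaves like an Eisenstein polynomial of degree \<open>j\<close>. One ideal
  over \<open>p\<close> suffices, as a single inertia group is used.\<close>

definition totally_ramified_at :: "int \<Rightarrow> int \<Rightarrow> nat \<Rightarrow> bool" where
  "totally_ramified_at p a j \<longleftrightarrow> (\<exists>M. prime_over n r F M p \<and> int n < p \<and> p dvd poly F a \<and> \<not> p ^ 2 dvd poly F a \<and>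
     card (prime_over.near n r M a) = j \<and>
     (\<forall>i\<in>{1..n}. ipoly (pderiv F) (r i) \<in> M \<longrightarrow> i \<in> prime_over.near n r M a))"

text \<open>At a multiple root modulo \<open>M\<close> the left side lies in \<open>M\<close>; since
  \<open>U\<close> does not, the root is congruent to \<open>a\<close>. The term B F vanishes at all
  roots and gives the freedom used in odd degree, where \<open>A = [:- d, 0, 1:]\<close> and
  \<open>B = - [:0, 2:]\<close>.\<close>

lemma totally_ramified_atI:
  assumes p: "prime p" "p > int n" and F: "p dvd poly F a" "\<not> p ^ 2 dvd poly F a"
    and eq: "A * pderiv F + B * F = [:- a, 1:] ^ j * U + smult p E" and j: "j > 0"
    and A: "\<not> p dvd poly A a" and U: "\<not> p dvd poly U a"
    and U_roots: "\<And>M i. prime_over n r F M p \<Longrightarrow> i \<in> {1..n} \<Longrightarrow> ipoly U (r i) \<notin> M"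
  shows "totally_ramified_at p a (Suc j)"
proof -
  obtain M where "prime_over n r F M p" using ex_prime_over p by blast
  then interpret prime_over n r F M p .
  have "card (near a) = Suc j" by (rule card_near[OF eq A U F(1) p(2)])
  moreover have "i \<in> near a" if i: "i \<in> {1..n}" "ipoly (pderiv F) (r i) \<in> M" for i
  proof -
    have "ipoly (A * pderiv F + B * F) (r i) \<in> M"
      using i by (auto simp: ipoly_simps ipoly_root intro!: M_mult rootring_ipoly)
    moreover have "ipoly (A * pderiv F + B * F) (r i) =
        (r i - of_int a) ^ j * ipoly U (r i) + of_int p * ipoly E (r i)"
      unfolding eq by (simp add: ipoly_simps)
    moreover have "of_int p * ipoly E (r i) \<in> M"
      using i by (intro M_mult2 M_p rootring_ipoly) auto
    ultimately have "(r i - of_int a) ^ j * ipoly U (r i) \<in> M"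
      using M_diff by (metis add_diff_cancel_right')
    then have "(r i - of_int a) ^ j \<in> M"
      using M_prime U_roots[OF prime_over_axioms i(1)] i
      by (meson rootring_diff rootring_ipoly rootring_of_int rootring_power rootring_root)
    then have "r i - of_int a \<in> M"
      by (rule M_prime_power) (use i in \<open>auto intro: rootring_diff\<close>)
    then show ?thesis using i by (simp add: near_def)
  qed
  ultimately show ?thesis
    unfolding totally_ramified_at_def using prime_over_axioms p(2) F by blast
qed

lemma totally_ramified_at_subgroup:
  assumes "totally_ramified_at p a j"
  obtains H S where "H \<subseteq> gal" "S \<subseteq> {1..n}" "card S = j"
    "\<forall>\<pi>\<in>H. \<forall>i\<in>{1..n} - S. \<pi> i = i" "\<forall>i\<in>S. \<forall>j\<in>S. \<exists>\<pi>\<in>H. \<pi> i = j"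
proof -
  obtain M where K: "prime_over n r F M p" "int n < p" "p dvd poly F a" "\<not> p ^ 2 dvd poly F a"
     "card (prime_over.near n r M a) = j"
     "\<forall>i\<in>{1..n}. ipoly (pderiv F) (r i) \<in> M \<longrightarrow> i \<in> prime_over.near n r M a"
    using assms by (auto simp: totally_ramified_at_def)
  interpret prime_over n r F M p by (rule K(1))
  show ?thesis
  proof (rule that[of inertia "near a"])
    show "inertia \<subseteq> gal" using inertia_gal by blast
    show "\<forall>\<pi>\<in>inertia. \<forall>i\<in>{1..n} - near a. \<pi> i = i"
      using inertia_fixes_simple K(6) by blast
    show "\<forall>i\<in>near a. \<forall>j\<in>near a. \<exists>\<pi>\<in>inertia. \<pi> i = j"
      using inertia_transitive[OF K(3,4) card_inertia[OF K(2)]] by blast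
  qed (use near_sub K(5) in auto)
qed

lemma totally_ramified_at_inj:
  assumes "totally_ramified_at p a j"
  shows "inj_on r {1..n}"
proof -
  obtain M where K: "prime_over n r F M p" "\<not> p ^ 2 dvd poly F a"
     "\<forall>i\<in>{1..n}. ipoly (pderiv F) (r i) \<in> M \<longrightarrow> i \<in> prime_over.near n r M a"
    using assms by (auto simp: totally_ramified_at_def)
  interpret prime_over n r F M p by (rule K(1))
  show ?thesis by (rule distinct_roots[of a]) (use K in auto)
qed

theorem galois_group_eq_alt:
  assumes three: "totally_ramified_at p2 a2 3"
    and big: "totally_ramified_at p1 a1 j" "j < n" "n - j \<le> 2"
    and trans: "\<And>i j. i \<in> {1..n} \<Longrightarrow> j \<in> {1..n} \<Longrightarrow> \<exists>\<pi>\<in>gal. \<pi> i = j"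
    and Q: "Q \<in> polyfun \<rat> n" "\<And>\<pi>. \<pi> \<in> gal \<Longrightarrow> Q (r \<circ> \<pi>) = Q r" "vandermonde n r ^ 2 = Q r ^ 2"
  shows "galois_group_eq (map_poly of_int F) (carrier (alt_group n))"
proof -
  have inj: "inj_on r {1..n}" by (rule totally_ramified_at_inj[OF three])
  have even: "evenperm \<pi>" if "\<pi> \<in> gal" for \<pi> by (rule gal_even[OF inj Q that])
  have "gal \<subseteq> carrier (alt_group n)"
    using even gal_permutes by (auto simp: alt_group_carrier)
  moreover have "carrier (alt_group n) \<subseteq> gal"
  proof -
    obtain H S where H: "H \<subseteq> gal" "S \<subseteq> {1..n}" "card S = 3"
      "\<forall>\<pi>\<in>H. \<forall>i\<in>{1..n} - S. \<pi> i = i" "\<forall>i\<in>S. \<forall>j\<in>S. \<exists>\<pi>\<in>H. \<pi> i = j"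
      by (rule totally_ramified_at_subgroup[OF three])
    obtain x y z where S: "S = {x, y, z}" "distinct [x, y, z]"
      using H(3) by (auto simp: card_3_iff)
    obtain \<pi> where \<pi>: "\<pi> \<in> H" "\<pi> x = y" using H(5) S by auto
    have \<pi>g: "\<pi> \<in> gal" using \<pi> H by blast
    have perm: "\<pi> permutes {1..n}" by (rule gal_permutes[OF \<pi>g])
    have out: "\<pi> i = i" if "i \<notin> S" for i
      using H(4) \<pi>(1) permutes_not_in[OF perm, of i] that by (cases "i \<in> {1..n}") auto
    have inj\<pi>: "\<pi> i = \<pi> k \<longleftrightarrow> i = k" for i k using permutes_inj[OF perm] by (auto simp: inj_def)
    have in\<pi>: "\<pi> i \<in> S" if "i \<in> S" for i using out[of "\<pi> i"] inj\<pi>[of "\<pi> i" i] that by auto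
    \<comment> \<open>An even permutation is not a transposition, so an element moving x to y within
      three points is a 3-cycle.\<close>
    have "\<pi> y \<noteq> x"
    proof
      assume yx: "\<pi> y = x"
      then have "\<pi> z = z" using in\<pi>[of z] inj\<pi>[of z x] inj\<pi>[of z y] \<pi> S by auto
      then have "\<pi> = transpose x y"
        using out yx \<pi> S by (auto simp: fun_eq_iff transpose_def)
      then have "\<not> evenperm \<pi>" using S by (simp add: evenperm_swap)
      then show False using even[OF \<pi>g] by simp
    qed
    then have yz: "\<pi> y = z" using in\<pi>[of y] inj\<pi>[of x y] \<pi> S by auto
    then have zx: "\<pi> z = x" using in\<pi>[of z] inj\<pi>[of z x] inj\<pi>[of z y] \<pi> S by auto
    have cyc: "\<pi> = cycle_of_list [x, y, z]"
      using out yz zx \<pi> S by (auto simp: fun_eq_iff transpose_def)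
    obtain H' S' where H': "H' \<subseteq> gal" "S' \<subseteq> {1..n}" "card S' = j"
      "\<forall>\<pi>\<in>H'. \<forall>i\<in>{1..n} - S'. \<pi> i = i" "\<forall>i\<in>S'. \<forall>j\<in>S'. \<exists>\<pi>\<in>H'. \<pi> i = j"
      by (rule totally_ramified_at_subgroup[OF big(1)])
    show ?thesis
    proof (rule alt_group_subset_if_three_cycle[of gal n x y z H' S'])
      show "S' \<subset> {1..n}" using H'(2,3) big(2) by auto
      show "card ({1..n} - S') \<le> 2"
        using H'(2,3) big(3) by (subst card_Diff_subset) (auto dest: finite_subset)
      show "{x, y, z} \<subseteq> {1..n}" using H(2) S by simp
      show "cycle_of_list [x, y, z] \<in> gal" using \<pi>g cyc by simp
      show "\<And>\<pi> i. \<pi> \<in> H' \<Longrightarrow> i \<in> {1..n} - S' \<Longrightarrow> \<pi> i = i" using H'(4) by blast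
      show "\<And>i j. i \<in> S' \<Longrightarrow> j \<in> S' \<Longrightarrow> \<exists>\<pi>\<in>H'. \<pi> i = j" using H'(5) by blast
    qed (rule gal_permutes gal_id gal_comp gal_inv trans S(2) H'(1); assumption)+
  qed
  ultimately have "gal = carrier (alt_group n)" by blast
  then show ?thesis using galois_group_eq_gal[OF inj] by simp
qed

text \<open>Inertia is already transitive on n - 1 points. If \<open>gal\<close> fixed the remaining
  one, its root would be rational and hence an integer.\<close>

lemma trans_if_no_int_root:
  assumes big: "totally_ramified_at p a (n - 1)" and n: "n \<ge> 2"
    and no_root: "\<And>k. poly F k \<noteq> 0" and ij: "i \<in> {1..n}" "j \<in> {1..n}"
  shows "\<exists>\<pi>\<in>gal. \<pi> i = j"
proof -
  obtain H S where H: "H \<subseteq> gal" "S \<subseteq> {1..n}" "card S = n - 1"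
      "\<forall>\<pi>\<in>H. \<forall>i\<in>{1..n} - S. \<pi> i = i" "\<forall>i\<in>S. \<forall>j\<in>S. \<exists>\<pi>\<in>H. \<pi> i = j"
    by (rule totally_ramified_at_subgroup[OF big])
  have "card ({1..n} - S) = 1"
    using H(2,3) n by (subst card_Diff_subset) (auto dest: finite_subset)
  then obtain b where b: "{1..n} - S = {b}" by (rule card_1_singletonE)
  then have b': "b \<in> {1..n}" "b \<notin> S" by blast+
  have b'': "k \<in> S" if "k \<in> {1..n}" "k \<noteq> b" for k using b that by blast
  have "\<exists>\<pi>\<in>gal. \<pi> b \<noteq> b"
  proof (rule ccontr)
    assume "\<not> ?thesis"
    then have "r (\<pi> b) = r b" if "\<pi> \<in> gal" for \<pi> using that by metis
    then have "r b \<in> \<int>"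
      by (intro gal_fixed_Ints[of "\<lambda>x. x b"] polyfun.var b') simp
    then obtain k where "r b = of_int k" by (elim Ints_cases)
    then have "(of_int (poly F k) :: complex) = 0" using ipoly_root[OF b'(1)] by (simp add: ipoly_of_int)
    then show False using no_root by simp
  qed
  then obtain \<pi>0 where \<pi>0: "\<pi>0 \<in> gal" "\<pi>0 b \<noteq> b" by blast
  then have s: "\<pi>0 b \<in> S" using b'' gal_in[OF _ b'(1)] by blast
  have from_b: "\<exists>\<pi>\<in>gal. \<pi> b = k" if "k \<in> {1..n}" for k
  proof (cases "k = b")
    case False
    then obtain \<rho> where "\<rho> \<in> H" "\<rho> (\<pi>0 b) = k" using H(5) s b''[OF \<open>k \<in> {1..n}\<close>] by blast
    then show ?thesis using gal_comp[of \<rho> \<pi>0] \<pi>0 H(1) by (intro bexI[of _ "\<rho> \<circ> \<pi>0"]) auto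
  qed (intro bexI[of _ id], simp_all add: gal_id)
  obtain \<pi> \<rho> where pr: "\<pi> \<in> gal" "\<pi> b = i" "\<rho> \<in> gal" "\<rho> b = j" using from_b ij by blast
  have "(\<rho> \<circ> inv' \<pi>) i = j"
    using pr permutes_inverses(2)[OF gal_permutes[OF pr(1)], of b] by auto
  then show ?thesis using gal_comp[OF pr(3) gal_inv[OF pr(1)]] by blast
qed

text \<open>Modulo \<open>p\<close> the polynomial is X^n, so all roots lie in \<open>M\<close> and
  are near 0.\<close>

lemma trans_if_eisenstein:
  assumes p: "prime p" and F: "F = monom 1 n + smult p E" "\<not> p ^ 2 dvd poly F 0"
    and ij: "i \<in> {1..n}" "j \<in> {1..n}"
  shows "\<exists>\<pi>\<in>gal. \<pi> i = j"
proof -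
  obtain M where "prime_over n r F M p" using ex_prime_over p by blast
  then interpret prime_over n r F M p .
  have "r i \<in> M" if "i \<in> {1..n}" for i
  proof -
    have "r i ^ n + of_int p * ipoly E (r i) = 0"
      using ipoly_root[OF that] by (subst (asm) F(1)) (simp add: ipoly_simps)
    then have "r i ^ n = - (of_int p * ipoly E (r i))" by (simp add: eq_neg_iff_add_eq_0)
    also have "\<dots> \<in> M" using that by (intro M_uminus M_mult2 M_p rootring_ipoly) auto
    finally show ?thesis by (rule M_prime_power) (use that in auto)
  qed
  then have "near 0 = {1..n}" by (auto simp: near_def)
  then show ?thesis using eisenstein_transitive[of 0] F(2) ij by simp
qed

section \<open>Square discriminant and ramification conditions in even degree\<close>

lemma prod_permute_roots:
  assumes "\<pi> \<in> gal"
  shows "(\<Prod>i\<in>{1..n}. G (r (\<pi> i))) = (\<Prod>i\<in>{1..n}. G (r i))"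
  using prod.permute[OF gal_permutes[OF assms], of "\<lambda>i. G (r i)"] by (simp add: o_def)

lemma prod_roots: "(\<Prod>i\<in>{1..n}. r i) = of_int ((- 1) ^ n * poly F 0)"
  using poly_F_shift[of 0] by simp

end

text \<open>Integration modulo p^k: i times the i-th coefficient of \<open>T\<close> is divisible,
  and i \<le> n < p can be cancelled. The constant term is covered by its own hypothesis.\<close>

lemma dvd_poly_if_dvd_pderiv:
  fixes T W :: "int poly"
  assumes "prime p" "p > int n" "degree T \<le> n" "pderiv T = smult (p ^ k) W" "p ^ k dvd poly T 0"
  shows "p ^ k dvd poly T a"
proof -
  have "p ^ k dvd poly.coeff T i" if "i \<le> n" for i
  proof (cases i)
    case 0
    then show ?thesis using assms(5) by (simp add: poly_0_coeff_0)
  next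
    case (Suc i')
    have "int i * poly.coeff T i = p ^ k * poly.coeff W i'"
      using arg_cong[OF assms(4), of "\<lambda>Q. poly.coeff Q i'"] Suc by (simp add: coeff_pderiv)
    then have "p ^ k dvd int i * poly.coeff T i" by simp
    moreover have "\<not> p dvd int i" using that Suc assms(2) zdvd_imp_le[of p "int i"] by auto
    then have "coprime (p ^ k) (int i)" using assms(1) by (simp add: prime_imp_coprime coprime_power_left_iff)
    ultimately show ?thesis by (simp add: coprime_dvd_mult_right_iff)
  qed
  then show ?thesis unfolding poly_altdef using assms(3) by (intro dvd_sum dvd_mult2) auto
qed

lemma power2_add_smult:
  fixes G E :: "int poly"
  assumes "g = G + smult c E"
  shows "g ^ 2 = G ^ 2 + smult c (2 * G * E + smult c (E ^ 2))"
  unfolding assms by (simp add: power2_eq_square algebra_simps smult_add_right)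

lemma dvd_cong_if_dvd_diff:
  fixes x y :: int
  shows "c dvd x - y \<Longrightarrow> c dvd x \<longleftrightarrow> c dvd y"
  by (metis dvd_add_right_iff diff_add_cancel)

context root_enum
begin

lemma root_notin_if_not_dvd:
  assumes "prime_over n r F M p" "i \<in> {1..n}" "\<not> p dvd poly F 0"
  shows "r i \<notin> M"
proof
  interpret prime_over n r F M p by (rule assms(1))
  assume "r i \<in> M"
  then have "ipoly F (r i) - ipoly F 0 \<in> M"
    using assms(2) by (intro M_cong_ipoly) auto
  then have "- of_int (poly F 0) \<in> M" using ipoly_root[OF assms(2)] ipoly_of_int[of F 0] by simp
  then show False using M_uminus M_of_int assms(3) by fastforce
qed

text \<open>Modulo p^2 the equation reads F' = n X (X - 1)^(n - 2), so (n - 1) F is (n - 1)(X - 1)^n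
  + n (X - 1)^(n - 1) plus a constant. Comparing the values at 0 and 1 gives (n - 1) F(1) = (n - 1)
  F(0) + 1. The modulus is p^2 in order to see that \<open>p\<close> divides F(1) exactly
  once.\<close>

lemma even_case_power:
  assumes n: "n = 2 * (h + 1)" "h \<ge> 1"
    and F': "pderiv F = [:0, int n:] * g ^ 2"
    and p: "prime p" "p > int n" "g = [:-1, 1:] ^ h + smult (p ^ 2) E"
    and k: "p dvd (int n - 1) * poly F 0 + 1" "\<not> p ^ 2 dvd (int n - 1) * poly F 0 + 1"
  shows "totally_ramified_at p 1 (n - 1)"
proof -
  define N where "N = int n"
  define k where "k = (N - 1) * poly F 0 + 1"
  define L where "L = ([:-1, 1:] :: int poly)"
  define Y where "Y = L ^ (n - 2)"
  obtain W where W: "g ^ 2 = (L ^ h) ^ 2 + smult (p ^ 2) W"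
    using power2_add_smult[OF p(3)] by (auto simp: L_def)
  have Y: "g ^ 2 = Y + smult (p ^ 2) W"
    using n by (simp add: W Y_def power_mult[symmetric] mult.commute)
  have X: "[:0, int n:] = smult N (L + 1)" by (simp add: L_def N_def one_pCons)
  have L1: "L ^ (n - 1) = L * Y" using n by (simp add: Y_def flip: power_Suc)
  define T where "T = smult (N - 1) F - (smult (N - 1) (L ^ n) + smult N (L ^ (n - 1)) + [:k:])"
  have dL: "pderiv L = 1" by (simp add: L_def pderiv_pCons)
  have "int (n - 1) = N - 1" "n - 1 - 1 = n - 2" using n by (auto simp: N_def)
  then have d2: "pderiv (L ^ (n - 1)) = smult (N - 1) Y"
    by (simp only: pderiv_power dL mult_1_right) (simp add: N_def Y_def)
  have d1: "pderiv (L ^ n) = smult N (L * Y)"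
    by (simp only: pderiv_power dL mult_1_right L1) (simp add: N_def)
  have "pderiv T = smult (N - 1) (smult N (L + 1) * (Y + smult (p ^ 2) W)) -
      (smult (N - 1) (smult N (L * Y)) + smult N (smult (N - 1) Y))"
    by (simp only: T_def pderiv_diff pderiv_add pderiv_smult d1 d2 F' X Y) (simp add: pderiv_pCons)
  also have "\<dots> = smult (p ^ 2) (smult ((N - 1) * N) ((L + 1) * W))"
    by (simp add: algebra_simps smult_add_right)
  finally have dT: "pderiv T = smult (p ^ 2) (smult ((N - 1) * N) ((L + 1) * W))" .
  have "degree (L ^ n) \<le> n" "degree (L ^ (n - 1)) \<le> n"
    using degree_power_le[of L n] degree_power_le[of L "n - 1"] by (simp_all add: L_def)
  then have degT: "degree T \<le> n"
    unfolding T_def using degree_F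
    by (intro degree_diff_le degree_add_le order_trans[OF degree_smult_le]) auto
  have T0: "poly T 0 = 0"
    using n by (simp add: T_def L_def k_def)
  have T1: "poly T 1 = (N - 1) * poly F 1 - k"
    using n by (simp add: T_def L_def)
  have D: "p ^ 2 dvd (N - 1) * poly F 1 - k"
    using dvd_poly_if_dvd_pderiv[OF p(1,2) degT dT, of 1] T0 T1 by simp
  have pp: "p dvd p ^ 2" by (simp add: power2_eq_square)
  have dvd: "p ^ 2 dvd (N - 1) * poly F 1 \<longleftrightarrow> p ^ 2 dvd k" "p dvd (N - 1) * poly F 1 \<longleftrightarrow> p dvd k"
    by (rule dvd_cong_if_dvd_diff[OF D], rule dvd_cong_if_dvd_diff[OF dvd_trans[OF pp D]])
  have pk: "p dvd k" "\<not> p ^ 2 dvd k" using k by (simp_all add: k_def N_def)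
  have small: "\<not> p dvd x" if "0 < x" "x \<le> N" for x
    using that p(2) zdvd_imp_le[of p x] by (auto simp: N_def)
  have pN: "\<not> p dvd N" using small[of N] n by (simp add: N_def)
  \<comment> \<open>Modulo \<open>p\<close> the other zero of F' is 0; this excludes it as a root of
    \<open>F\<close>.\<close>
  have nF0: "\<not> p dvd poly F 0"
  proof
    assume "p dvd poly F 0"
    then have "p dvd k - (N - 1) * poly F 0" using pk(1) by (intro dvd_diff dvd_mult)
    then show False using small[of 1] n by (simp add: k_def N_def)
  qed
  have "totally_ramified_at p 1 (Suc (n - 2))"
  proof (rule totally_ramified_atI[OF p(1,2)])
    show "p dvd poly F 1" using dvd(2) pk(1) small[of "N - 1"] p(1) n by (simp add: prime_dvd_mult_iff N_def)
    show "\<not> p ^ 2 dvd poly F 1" using dvd(1) pk(2) dvd_mult by blast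
    show "1 * pderiv F + 0 * F = [:- 1, 1:] ^ (n - 2) * smult N (L + 1) + smult p (smult p (smult N (L + 1) * W))"
      unfolding F' Y X by (simp add: Y_def L_def algebra_simps power2_eq_square)
    show "\<not> p dvd poly (smult N (L + 1)) 1" using small[of N] n by (simp add: L_def N_def)
    show "ipoly (smult N (L + 1)) (r i) \<notin> M" if "prime_over n r F M p" "i \<in> {1..n}" for M i
    proof
      interpret prime_over n r F M p by (rule that(1))
      assume "ipoly (smult N (L + 1)) (r i) \<in> M"
      then have "of_int N * r i \<in> M" by (simp add: ipoly_simps L_def)
      then show False
        using M_prime[of "of_int N" "r i", OF _ rootring_of_int rootring_root[OF that(2)]]
          M_of_int[of N] pN root_notin_if_not_dvd[OF that nF0] by blast
    qed
    show "\<not> p dvd poly 1 1" using small[of 1] n by (simp add: N_def)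
  qed (use n in auto)
  moreover have "Suc (n - 2) = n - 1" using n by simp
  ultimately show ?thesis by (simp only:)
qed

text \<open>Now F' = n X^(n - 3) (X - 1)^2 modulo p^2. The factor (n - 1)(n - 2) clears the
  denominators of the antiderivative X^n - 2n/(n - 1) X^(n - 1) + n/(n - 2) X^(n - 2), whose value
  at 1 then becomes 2.\<close>

lemma even_case_three:
  assumes n: "n = 2 * (h + 1)" "h \<ge> 1"
    and F': "pderiv F = [:0, int n:] * g ^ 2"
    and p: "prime p" "p > int n" "g = [:-1, 1:] * monom 1 (h - 1) + smult (p ^ 2) E"
    and k: "p dvd (int n - 1) * (int n - 2) * poly F 0 + 2" "\<not> p ^ 2 dvd (int n - 1) * (int n - 2) * poly F 0 + 2"
  shows "totally_ramified_at p 1 3"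
proof -
  define N where "N = int n"
  define k where "k = (N - 1) * (N - 2) * poly F 0 + 2"
  define Y where "Y = (monom 1 (n - 3) :: int poly)"
  define Z where "Z = ([:0, 1:] :: int poly)"
  obtain W where W: "g ^ 2 = ([:-1, 1:] * monom 1 (h - 1)) ^ 2 + smult (p ^ 2) W"
    using power2_add_smult[OF p(3)] by blast
  have L: "([:-1, 1:] :: int poly) = Z - 1" by (simp add: Z_def one_pCons)
  have Xn: "[:0, int n:] = smult N Z" by (simp add: Z_def N_def)
  obtain h' where h': "h = Suc h'" using n(2) by (cases h) auto
  have n': "n - 3 = Suc (2 * h')" using n h' by simp
  have XY: "Z * (monom 1 (h - 1)) ^ 2 = Y"
    using n' h' by (simp add: mult.commute[of h' 2] Y_def Z_def monom_power monom_altdef flip: power_Suc power_mult power_add)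
  have F'': "pderiv F = smult N ((Z - 1) ^ 2 * Y + smult (p ^ 2) (Z * W))"
    unfolding F' W Xn L XY[symmetric] power_mult_distrib
    by (simp add: distrib_left smult_add_right mult_ac)
  have sq: "(Z - 1) ^ 2 = Z ^ 2 - smult 2 Z + 1"
    by (simp add: Z_def power2_eq_square one_pCons)
  have m: "monom c (n - 1) = smult c (Z ^ 2 * Y)" "monom c (n - 2) = smult c (Z * Y)" "monom c (n - 3) = smult c Y" for c
    using n by (simp_all add: Y_def Z_def monom_altdef flip: power_Suc power_add)
  define T where "T = smult ((N - 1) * (N - 2)) F - (monom ((N - 1) * (N - 2)) n - monom (2 * N * (N - 2)) (n - 1)
      + monom (N * (N - 1)) (n - 2) + [:(N - 1) * (N - 2) * poly F 0:])"
  have n1: "int (n - 1) = N - 1" "int (n - 2) = N - 2" "n - 1 - 1 = n - 2" "n - 2 - 1 = n - 3"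
    using n by (auto simp: N_def)
  have dm: "pderiv (monom c n) = monom (N * c) (n - 1)" "pderiv (monom c (n - 1)) = monom ((N - 1) * c) (n - 2)"
    "pderiv (monom c (n - 2)) = monom ((N - 2) * c) (n - 3)" for c
    unfolding pderiv_monom n1 N_def[symmetric] by simp_all
  have "pderiv T = smult ((N - 1) * (N - 2)) (pderiv F) - (smult (N * ((N - 1) * (N - 2))) (Z ^ 2 * Y)
      - smult ((N - 1) * (2 * N * (N - 2))) (Z * Y) + smult ((N - 2) * (N * (N - 1))) Y)"
    unfolding T_def pderiv_diff pderiv_add pderiv_smult dm by (simp add: m pderiv_pCons mult.assoc)
  also have "\<dots> = smult (p ^ 2) (smult ((N - 1) * (N - 2) * N) (Z * W))"
    unfolding F'' sq by (simp add: algebra_simps smult_add_right smult_diff_right)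
  finally have dT: "pderiv T = smult (p ^ 2) (smult ((N - 1) * (N - 2) * N) (Z * W))" .
  have degT: "degree T \<le> n"
    unfolding T_def using degree_F
    by (intro degree_diff_le degree_add_le order_trans[OF degree_smult_le] order_trans[OF degree_monom_le]) auto
  have T0: "poly T 0 = 0"
    using n by (simp add: T_def poly_monom)
  have T1: "poly T 1 = (N - 1) * (N - 2) * poly F 1 - k"
    by (simp add: T_def poly_monom k_def algebra_simps)
  have D: "p ^ 2 dvd (N - 1) * (N - 2) * poly F 1 - k"
    using dvd_poly_if_dvd_pderiv[OF p(1,2) degT dT, of 1] T0 T1 by simp
  have pp: "p dvd p ^ 2" by (simp add: power2_eq_square)
  have dvd: "p ^ 2 dvd (N - 1) * (N - 2) * poly F 1 \<longleftrightarrow> p ^ 2 dvd k" "p dvd (N - 1) * (N - 2) * poly F 1 \<longleftrightarrow> p dvd k"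
    by (rule dvd_cong_if_dvd_diff[OF D], rule dvd_cong_if_dvd_diff[OF dvd_trans[OF pp D]])
  have pk: "p dvd k" "\<not> p ^ 2 dvd k" using k by (simp_all add: k_def N_def)
  have small: "\<not> p dvd x" if "0 < x" "x \<le> N" for x
    using that p(2) zdvd_imp_le[of p x] by (auto simp: N_def)
  have pN: "\<not> p dvd N" using small[of N] n by (simp add: N_def)
  have nF0: "\<not> p dvd poly F 0"
  proof
    assume "p dvd poly F 0"
    then have "p dvd k - (N - 1) * (N - 2) * poly F 0" using pk(1) by (intro dvd_diff dvd_mult)
    then show False using small[of 2] n by (simp add: k_def N_def)
  qed
  have "totally_ramified_at p 1 (Suc 2)"
  proof (rule totally_ramified_atI[OF p(1,2)])
    show "p dvd poly F 1" using dvd(2) pk(1) small[of "N - 1"] small[of "N - 2"] p(1) n by (simp add: prime_dvd_mult_iff N_def)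
    show "\<not> p ^ 2 dvd poly F 1" using dvd(1) pk(2) dvd_mult by blast
    show "1 * pderiv F + 0 * F = [:- 1, 1:] ^ 2 * smult N Y + smult p (smult p (smult N (Z * W)))"
      unfolding F'' L by (simp add: smult_add_right mult_ac power2_eq_square[of p])
    show "\<not> p dvd poly (smult N Y) 1" using small[of N] n by (simp add: Y_def poly_monom N_def)
    show "ipoly (smult N Y) (r i) \<notin> M" if "prime_over n r F M p" "i \<in> {1..n}" for M i
    proof
      interpret prime_over n r F M p by (rule that(1))
      assume "ipoly (smult N Y) (r i) \<in> M"
      then have "of_int N * r i ^ (n - 3) \<in> M" by (simp add: ipoly_simps Y_def)
      then have "r i ^ (n - 3) \<in> M"
        using M_prime[of "of_int N" "r i ^ (n - 3)", OF _ rootring_of_int rootring_power[OF rootring_root[OF that(2)]]]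
          M_of_int[of N] pN by blast
      then show False
        using M_prime_power that root_notin_if_not_dvd[OF that nF0] rootring_root by blast
    qed
    show "\<not> p dvd poly 1 1" using small[of 1] n by (simp add: N_def)
  qed auto
  then show ?thesis by (simp add: numeral_3_eq_3 numeral_2_eq_2)
qed

theorem galois_group_eq_alt_even:
  assumes n: "n = 2 * (h + 1)" "h \<ge> 1"
    and F': "pderiv F = [:0, int n:] * g ^ 2" and F0: "poly F 0 = (- 1) ^ (h + 1) * s ^ 2"
    and p1: "prime p1" "p1 > int n" "g = [:-1, 1:] ^ h + smult (p1 ^ 2) E1"
    and k1: "p1 dvd (int n - 1) * poly F 0 + 1" "\<not> p1 ^ 2 dvd (int n - 1) * poly F 0 + 1"
    and p2: "prime p2" "p2 > int n" "g = [:-1, 1:] * monom 1 (h - 1) + smult (p2 ^ 2) E2"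
    and k2: "p2 dvd (int n - 1) * (int n - 2) * poly F 0 + 2" "\<not> p2 ^ 2 dvd (int n - 1) * (int n - 2) * poly F 0 + 2"
    and no_root: "\<And>k. poly F k \<noteq> 0"
  shows "galois_group_eq (map_poly of_int F) (carrier (alt_group n))"
proof -
  have tr1: "totally_ramified_at p1 1 (n - 1)" by (rule even_case_power[OF n F' p1 k1])
  have tr2: "totally_ramified_at p2 1 3" by (rule even_case_three[OF n F' p2 k2])
  \<comment> \<open>n^n F(0) is (-1)^(h + 1) times the square of n^(h + 1) s. The sign of F(0)
    cancels that of the discriminant formula, whose exponent (h + 1)(2h + 1) has the parity of h +
    1.\<close>
  define Q where "Q x = of_int (int n ^ (h + 1) * s) * (\<Prod>i\<in>{1..n}. ipoly g (x i))" for x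
  have "n * (n - 1) = 2 * ((h + 1) * (2 * h + 1))" using n by (simp add: algebra_simps)
  then have e: "n * (n - 1) div 2 = (h + 1) * (2 * h + 1)" by simp
  have sgn_n: "(- 1 :: complex) ^ n = 1" using n by simp
  have sgn: "(- 1 :: complex) ^ (n * (n - 1) div 2) = (- 1) ^ (h + 1)"
    unfolding e by (simp add: minus_one_power_iff)
  show ?thesis
  proof (rule galois_group_eq_alt[OF tr2 tr1])
    show "\<exists>\<pi>\<in>gal. \<pi> i = j" if "i \<in> {1..n}" "j \<in> {1..n}" for i j
      by (rule trans_if_no_int_root[OF tr1 _ no_root that]) (use n in auto)
    show "Q \<in> polyfun \<rat> n"
      unfolding Q_def[abs_def]
      by (intro polyfun.mult polyfun.const polyfun_prod polyfun_poly polyfun.var) (auto simp: coeff_map_poly)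
    show "Q (r \<circ> \<pi>) = Q r" if "\<pi> \<in> gal" for \<pi>
      using prod_permute_roots[OF that, of "ipoly g"] by (simp add: Q_def)
    have "(- 1) ^ (h + 1) * vandermonde n r ^ 2 = (\<Prod>i\<in>{1..n}. of_int (int n) * r i * ipoly g (r i) ^ 2)"
      unfolding prod_pderiv_roots[unfolded sgn, symmetric] F' by (simp add: ipoly_simps mult_ac)
    also have "\<dots> = of_int (int n) ^ n * of_int (poly F 0) * (\<Prod>i\<in>{1..n}. ipoly g (r i)) ^ 2"
      by (simp add: prod.distrib prod_roots prod_power_distrib sgn_n)
    also have "\<dots> = (- 1) ^ (h + 1) * Q r ^ 2"
      by (simp add: Q_def F0 n(1) power_mult_distrib power_mult[symmetric] mult_ac)
    finally show "vandermonde n r ^ 2 = Q r ^ 2" by simp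
  qed (use n in auto)
qed


section \<open>Square discriminant and ramification conditions in odd degree\<close>

lemma odd_case_ramified:
  assumes n: "n \<ge> 5"
    and key: "[:- d, 0, 1:] * pderiv F - [:0, 2:] * F = smult (int n - 2) (g ^ 2)"
    and p: "prime p" "p > int n" and F: "p dvd poly F a" "\<not> p ^ 2 dvd poly F a"
    and g: "g = [:- a, 1:] ^ l * G + smult p E" and l: "l > 0"
    and ad: "\<not> p dvd a ^ 2 - d" and G: "\<not> p dvd poly G a"
    and G_roots: "\<And>M i. prime_over n r F M p \<Longrightarrow> i \<in> {1..n} \<Longrightarrow> ipoly G (r i) \<notin> M"
  shows "totally_ramified_at p a (Suc (2 * l))"
proof -
  obtain W where W: "g ^ 2 = ([:- a, 1:] ^ l * G) ^ 2 + smult p W"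
    using power2_add_smult[OF g] by blast
  have small: "\<not> p dvd int n - 2"
    using n p(2) zdvd_imp_le[of p "int n - 2"] by auto
  show ?thesis
  \<comment> \<open>Squaring doubles the multiplicity \<open>l\<close> of \<open>a\<close> as a zero
    of \<open>g\<close> modulo \<open>p\<close>, and \<open>F\<close> itself vanishes to one order
    more, because X^2 - d does not vanish at \<open>a\<close>.\<close>
  proof (rule totally_ramified_atI[OF p F])
    have "[:- d, 0, 1:] * pderiv F + (- [:0, 2:]) * F = smult (int n - 2) (g ^ 2)"
      using key by (simp only: minus_mult_left[symmetric] diff_conv_add_uminus)
    also have "\<dots> = [:- a, 1:] ^ (2 * l) * smult (int n - 2) (G ^ 2) + smult p (smult (int n - 2) W)"
      unfolding W power_mult_distrib by (simp add: smult_add_right power_mult[symmetric] mult.commute)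
    finally show "[:- d, 0, 1:] * pderiv F + (- [:0, 2:]) * F =
      [:- a, 1:] ^ (2 * l) * smult (int n - 2) (G ^ 2) + smult p (smult (int n - 2) W)" .
    show "\<not> p dvd poly [:- d, 0, 1:] a" using ad by (simp add: power2_eq_square)
    show "\<not> p dvd poly (smult (int n - 2) (G ^ 2)) a"
      using small G p(1) by (simp add: prime_dvd_mult_iff prime_dvd_power_iff)
    show "ipoly (smult (int n - 2) (G ^ 2)) (r i) \<notin> M" if "prime_over n r F M p" "i \<in> {1..n}" for M i
    proof
      interpret prime_over n r F M p by (rule that(1))
      assume "ipoly (smult (int n - 2) (G ^ 2)) (r i) \<in> M"
      then have "of_int (int n - 2) * ipoly G (r i) ^ 2 \<in> M" by (simp add: ipoly_simps)
      then have "ipoly G (r i) ^ 2 \<in> M"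
        using M_prime[of "of_int (int n - 2)" "ipoly G (r i) ^ 2"] M_of_int[of "int n - 2"] small that(2)
        by (metis rootring_ipoly rootring_of_int rootring_power rootring_root)
      then show False
        using M_prime_power[of "ipoly G (r i)" 2] G_roots[OF that] that(2) rootring_ipoly rootring_root by blast
    qed
  qed (use l in auto)
qed

end

text \<open>Conjugation in Z[sqrt d], stated so that \<delta> may be rational or not. It makes the
  product of the values at \<delta> and -\<delta> the integer A^2 - B^2 d.\<close>

lemma ipoly_conjugate:
  assumes "\<delta> ^ 2 = of_int d"
  shows "\<exists>A B. ipoly P \<delta> = of_int A + of_int B * \<delta> \<and> ipoly P (- \<delta>) = of_int A - of_int B * \<delta>"
proof (induction P)
  case 0
  then show ?case by (intro exI[of _ 0]) simp
next
  case (pCons a P)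
  then obtain A B where AB: "ipoly P \<delta> = of_int A + of_int B * \<delta>" "ipoly P (- \<delta>) = of_int A - of_int B * \<delta>"
    by blast
  have "\<delta> * \<delta> = of_int d" using assms by (simp add: power2_eq_square)
  then have "ipoly (pCons a P) \<delta> = of_int (a + B * d) + of_int A * \<delta> \<and>
      ipoly (pCons a P) (- \<delta>) = of_int (a + B * d) - of_int A * \<delta>"
    unfolding ipoly_pCons AB by (simp add: algebra_simps)
  then show ?case by blast
qed

context root_enum
begin

text \<open>At X = \<delta> and X = -\<delta>, with \<delta>^2 = d, the derivative drops out of
  \<open>key\<close>; the product of both values expresses -4 d times the product of all r_i^2 - d
  as a square. At the roots the other term drops out and F' appears. The sign of \<open>d\<close>
  and its factor n - 2 are just right to make the combination a square.\<close>

lemma odd_case_square: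
  assumes n: "n = 2 * m - 1" "m \<ge> 3" and d: "d = (- 1) ^ m * (int n - 2) * (int n - 4) ^ 2"
    and key: "[:- d, 0, 1:] * pderiv F - [:0, 2:] * F = smult (int n - 2) (g ^ 2)"
    and nz: "\<And>i. i \<in> {1..n} \<Longrightarrow> r i ^ 2 \<noteq> of_int d"
  shows "\<exists>Q\<in>polyfun \<rat> n. (\<forall>\<pi>\<in>gal. Q (r \<circ> \<pi>) = Q r) \<and> vandermonde n r ^ 2 = Q r ^ 2"
proof -
  define \<delta> where "\<delta> = csqrt (of_int d)"
  have \<delta>: "\<delta> ^ 2 = of_int d" by (simp add: \<delta>_def)
  have key': "(x ^ 2 - of_int d) * ipoly (pderiv F) x - 2 * x * ipoly F x = (of_nat n - 2) * ipoly g x ^ 2" for x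
    using arg_cong[OF key, of "\<lambda>P. ipoly P x"]
    by (simp only: ipoly_simps) (simp add: power2_eq_square algebra_simps)
  have "- 2 * \<delta> * ipoly F \<delta> = (of_nat n - 2) * ipoly g \<delta> ^ 2"
    using key'[of \<delta>] by (simp add: \<delta>)
  moreover have "2 * \<delta> * ipoly F (- \<delta>) = (of_nat n - 2) * ipoly g (- \<delta>) ^ 2"
    using key'[of "- \<delta>"] by (simp add: \<delta>)
  ultimately have "(- 2 * \<delta> * ipoly F \<delta>) * (2 * \<delta> * ipoly F (- \<delta>)) =
      ((of_nat n - 2) * ipoly g \<delta> ^ 2) * ((of_nat n - 2) * ipoly g (- \<delta>) ^ 2)" by simp
  moreover obtain A B where AB: "ipoly g \<delta> = of_int A + of_int B * \<delta>" "ipoly g (- \<delta>) = of_int A - of_int B * \<delta>"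
    using ipoly_conjugate[OF \<delta>, of g] by blast
  define c where "c = of_int (A ^ 2 - B ^ 2 * d) + (0 :: complex)"
  have c: "ipoly g \<delta> * ipoly g (- \<delta>) = c"
    unfolding AB c_def using \<delta> by (simp add: power2_eq_square algebra_simps)
  ultimately have FF: "- 4 * of_int d * (ipoly F \<delta> * ipoly F (- \<delta>)) = (of_nat n - 2) ^ 2 * c ^ 2"
    unfolding c[symmetric] \<delta>[symmetric] by (simp add: power2_eq_square mult_ac)
  have q_prod: "(\<Prod>i\<in>{1..n}. r i ^ 2 - of_int d) = ipoly F \<delta> * ipoly F (- \<delta>)"
  proof -
    have "(\<Prod>i\<in>{1..n}. r i ^ 2 - of_int d) = (\<Prod>i\<in>{1..n}. (\<delta> - r i) * (- \<delta> - r i))"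
      by (intro prod.cong) (auto simp: \<delta>[symmetric] power2_eq_square algebra_simps)
    then show ?thesis by (simp add: poly_F prod.distrib)
  qed
  have q_nz: "(\<Prod>i\<in>{1..n}. r i ^ 2 - of_int d) \<noteq> 0" using nz by (simp add: prod_zero_iff)
  have n5: "of_nat n - 2 \<noteq> (0 :: complex)" "int n - 4 \<noteq> 0" "int n - 2 \<noteq> 0"
    using n of_nat_eq_iff[of n 2, where 'a = complex] by auto
  have d_nz: "d \<noteq> 0" unfolding d using n5 by simp
  \<comment> \<open>If \<open>c\<close> were 0, some r_i^2 - d would vanish; \<open>c\<close> is the
    denominator of the final square root.\<close>
  have c_nz: "c \<noteq> 0" using FF q_nz q_prod d_nz by auto
  define G where "G = (\<Prod>i\<in>{1..n}. ipoly g (r i))"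
  define V where "V = vandermonde n r"
  have "(\<Prod>i\<in>{1..n}. (r i ^ 2 - of_int d) * ipoly (pderiv F) (r i)) = (\<Prod>i\<in>{1..n}. (of_nat n - 2) * ipoly g (r i) ^ 2)"
  proof (intro prod.cong refl)
    fix i assume "i \<in> {1..n}"
    then show "(r i ^ 2 - of_int d) * ipoly (pderiv F) (r i) = (of_nat n - 2) * ipoly g (r i) ^ 2"
      using key'[of "r i"] ipoly_root[of i] by simp
  qed
  then have 1: "(\<Prod>i\<in>{1..n}. r i ^ 2 - of_int d) * ((- 1) ^ (n * (n - 1) div 2) * V ^ 2) = (of_nat n - 2) ^ n * G ^ 2"
    by (simp add: prod.distrib prod_pderiv_roots V_def G_def prod_power_distrib)
  obtain m' where m': "m = Suc m'" using n by (cases m) auto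
  have n': "n = Suc (2 * m')" "n - 1 = 2 * m'" using n m' by auto
  have nn: "n * (n - 1) = 2 * (n * m')" using n' by (simp add: algebra_simps)
  have "n * (n - 1) div 2 = n * m'" unfolding nn by simp
  then have sgn: "(- 1 :: complex) ^ (n * (n - 1) div 2) = (- 1) ^ m'"
    unfolding n' by (simp add: minus_one_power_iff)
  have 2: "- 4 * of_int d * ((of_nat n - 2) ^ n * G ^ 2) = (of_nat n - 2) ^ 2 * c ^ 2 * ((- 1) ^ m' * V ^ 2)"
    unfolding 1[symmetric] sgn q_prod FF[symmetric] by (simp add: mult_ac)
  define z where "z = (of_nat n - 2 :: complex)"
  have zn: "z ^ n = z * (z ^ m') ^ 2" unfolding n'(1) by (simp add: power_mult[symmetric] mult.commute)
  have dz: "of_int d = - ((- 1) ^ m' * z * (of_nat n - 4) ^ 2)" unfolding d m' by (simp add: z_def)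
  have "- 4 * of_int d * ((of_nat n - 2) ^ n * G ^ 2) =
      (- 1) ^ m' * (4 * (of_nat n - 4) ^ 2 * ((of_nat n - 2) ^ m') ^ 2 * (of_nat n - 2) ^ 2 * G ^ 2)"
    unfolding z_def[symmetric] zn dz by (simp add: power2_eq_square mult_ac)
  with 2 have "(of_nat n - 2) ^ 2 * (c ^ 2 * V ^ 2) =
      (of_nat n - 2) ^ 2 * (4 * (of_nat n - 4) ^ 2 * ((of_nat n - 2) ^ m') ^ 2 * G ^ 2)"
    by (simp add: mult_ac)
  then have "c ^ 2 * V ^ 2 = 4 * (of_nat n - 4) ^ 2 * ((of_nat n - 2) ^ m') ^ 2 * G ^ 2"
    using n5 by simp
  note cV = this
  have "(inverse c * (2 * (of_nat n - 4) * (of_nat n - 2) ^ m') * G) ^ 2 =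
      inverse (c ^ 2) * (4 * (of_nat n - 4) ^ 2 * ((of_nat n - 2) ^ m') ^ 2 * G ^ 2)"
    by (simp only: power_mult_distrib power_inverse) simp
  then have V: "V ^ 2 = (inverse c * (2 * (of_nat n - 4) * (of_nat n - 2) ^ m') * G) ^ 2"
    using c_nz by (simp add: cV[symmetric])
  define C where "C = inverse c * (2 * (of_nat n - 4) * (of_nat n - 2) ^ m')"
  have C: "C \<in> \<rat>" by (simp add: C_def c_def)
  define Q where "Q x = C * (\<Prod>i\<in>{1..n}. ipoly g (x i))" for x
  have "Q \<in> polyfun \<rat> n"
    unfolding Q_def[abs_def]
    by (intro polyfun.mult polyfun.const C polyfun_prod polyfun_poly polyfun.var) (auto simp: coeff_map_poly)
  moreover have "Q (r \<circ> \<pi>) = Q r" if "\<pi> \<in> gal" for \<pi>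
    using prod_permute_roots[OF that, of "ipoly g"] by (simp add: Q_def)
  moreover have "vandermonde n r ^ 2 = Q r ^ 2" using V by (simp add: V_def C_def Q_def G_def)
  ultimately show ?thesis by blast
qed

text \<open>\<open>p0\<close> gives transitivity, \<open>p1\<close> a root 0 of multiplicity n - 2,
  and \<open>p2\<close> a triple root at \<open>\<rho>\<close>, a square root of \<open>c\<close>.
  The remaining zeros of \<open>g\<close> are candidates for further multiple roots; the explicit
  form of \<open>F\<close> modulo each prime shows that none of them is a root.\<close>

theorem galois_group_eq_alt_odd:
  assumes n: "n = 2 * m - 1" "m \<ge> 3" and d: "d = e * (int n - 4) ^ 2" "e = (- 1) ^ m * (int n - 2)"
    and c: "c = int n * (int n - 4) * e"
    and key: "[:- d, 0, 1:] * pderiv F - [:0, 2:] * F = smult (int n - 2) (g ^ 2)"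
    and p0: "prime p0" "p0 dvd int n" "F = monom 1 n + smult p0 E0" "\<not> p0 ^ 2 dvd poly F 0"
    and p1: "prime p1" "p1 > int n" "g = monom 1 (m - 2) * [:- c, 0, 1:] + smult p1 E1"
      "F = monom 1 (n - 2) * [:- (e * int n ^ 2), 0, 1:] + smult p1 E1'"
      "p1 dvd poly F 0" "\<not> p1 ^ 2 dvd poly F 0"
    and p2: "prime p2" "p2 > int n" "g = monom 1 (m - 2) * [:- c, 0, 1:] + smult p2 E2"
      "F = monom 1 (n - 2) * [:- (e * int n ^ 2), 0, 1:] + smult t [:- d, 0, 1:] + smult p2 E2'"
      "p2 dvd \<rho> ^ 2 - c" "p2 dvd poly F \<rho>" "\<not> p2 ^ 2 dvd poly F \<rho>"
  shows "galois_group_eq (map_poly of_int F) (carrier (alt_group n))"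
proof -
  define N where "N = int n"
  have n5: "n \<ge> 5" "N \<ge> 5" using n by (auto simp: N_def)
  have small: "\<not> p dvd x" if "p > N" "0 < x" "x \<le> N" for p x
    using that zdvd_imp_le[of p x] by auto
  have "e = N - 2 \<or> e = - (N - 2)" by (auto simp: d(2) N_def minus_one_power_iff)
  then have e_dvd: "p dvd e \<longleftrightarrow> p dvd N - 2" for p by (metis dvd_minus_iff)
  have unit: "\<not> p dvd e" "\<not> p dvd N" "\<not> p dvd N - 4" "\<not> p dvd 2" "\<not> p dvd 4" if "p > N" for p
    using small[OF that] n5 e_dvd by auto
  have pmul: "p dvd x * y \<longleftrightarrow> p dvd x \<or> p dvd y" if "prime p" for p x y :: int
    using that by (rule prime_dvd_mult_iff)
  have c_unit: "\<not> p dvd c" and d_unit: "\<not> p dvd d" if "p > N" "prime p" for p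
    using unit[OF that(1)] that(2) by (auto simp: c d(1) pmul power2_eq_square N_def[symmetric])
  have "odd n" using n by simp
  then have "odd p0" using p0(2) dvd_trans[of 2 p0 "int n"] by auto
  \<comment> \<open>A prime dividing both n and one of n - 2, n - 4 would be 2, but n is
    odd.\<close>
  have p0d: "\<not> p0 dvd d"
  proof
    assume "p0 dvd d"
    then have "p0 dvd N - 2 \<or> p0 dvd N - 4"
      by (auto simp: d(1) pmul[OF p0(1)] power2_eq_square N_def[symmetric] e_dvd)
    then have "p0 dvd N - (N - 2) \<or> p0 dvd N - (N - 4)"
      using dvd_diff[OF p0(2)[folded N_def], of "N - 2"] dvd_diff[OF p0(2)[folded N_def], of "N - 4"] by blast
    then have "p0 dvd 2 \<or> p0 dvd 2 * 2" by simp
    then have "p0 dvd 2" using pmul[OF p0(1)] by blast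
    then have "p0 = 2" using p0(1) prime_ge_2_int[of p0] zdvd_imp_le[of p0 2] by auto
    then show False using \<open>odd p0\<close> by simp
  qed
  \<comment> \<open>The Eisenstein shape puts all roots into an ideal over \<open>p0\<close>,
    whereas \<open>d\<close> is prime to \<open>p0\<close>.\<close>
  have nz: "r i ^ 2 \<noteq> of_int d" if i: "i \<in> {1..n}" for i
  proof
    assume eq: "r i ^ 2 = of_int d"
    obtain M where "prime_over n r F M p0" using ex_prime_over p0 by blast
    then interpret prime_over n r F M p0 .
    have "r i ^ n + of_int p0 * ipoly E0 (r i) = 0"
      using ipoly_root[OF i] by (subst (asm) p0(3)) (simp add: ipoly_simps)
    then have "r i ^ n = - (of_int p0 * ipoly E0 (r i))" by (simp add: eq_neg_iff_add_eq_0)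
    also have "\<dots> \<in> M" using i by (intro M_uminus M_mult2 M_p rootring_ipoly) auto
    finally have "r i \<in> M" by (rule M_prime_power) (use i in auto)
    then have "of_int d \<in> M" unfolding eq[symmetric] power2_eq_square using i by (intro M_mult) auto
    then show False using p0d M_of_int by blast
  qed
  have "d = (- 1) ^ m * (int n - 2) * (int n - 4) ^ 2" using d by simp
  from odd_case_square[OF n this key nz] obtain Q where
    Q: "Q \<in> polyfun \<rat> n" "\<And>\<pi>. \<pi> \<in> gal \<Longrightarrow> Q (r \<circ> \<pi>) = Q r" "vandermonde n r ^ 2 = Q r ^ 2" by blast
  have "totally_ramified_at p1 0 (Suc (2 * (m - 2)))"
  proof (rule odd_case_ramified[OF n5(1) key p1(1,2,5,6)])
    show "g = [:- 0, 1:] ^ (m - 2) * [:- c, 0, 1:] + smult p1 E1" using p1(3) by (simp add: monom_altdef)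
    show "\<not> p1 dvd 0 ^ 2 - d" using d_unit[of p1] p1 by (simp add: N_def)
    show "\<not> p1 dvd poly [:- c, 0, 1:] 0" using c_unit[of p1] p1 by (simp add: N_def)
    \<comment> \<open>A root that is nonzero modulo \<open>M\<close> has square e n^2 there, which
      differs from \<open>c\<close> by 4 n e.\<close>
    show "ipoly [:- c, 0, 1:] (r i) \<notin> M" if "prime_over n r F M p1" "i \<in> {1..n}" for M i
    proof
      interpret prime_over n r F M p1 by (rule that(1))
      assume "ipoly [:- c, 0, 1:] (r i) \<in> M"
      then have 1: "r i ^ 2 - of_int c \<in> M" by (simp add: ipoly_simps power2_eq_square)
      have "r i ^ (n - 2) * (r i ^ 2 - of_int (e * N ^ 2)) + of_int p1 * ipoly E1' (r i) = 0"
        using ipoly_root[OF that(2)]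
        by (subst (asm) p1(4)) (simp add: ipoly_simps N_def power2_eq_square algebra_simps)
      then have "r i ^ (n - 2) * (r i ^ 2 - of_int (e * N ^ 2)) = - (of_int p1 * ipoly E1' (r i))"
        by (simp add: eq_neg_iff_add_eq_0)
      also have "\<dots> \<in> M" using that by (intro M_uminus M_mult2 M_p rootring_ipoly) auto
      finally have "r i ^ (n - 2) \<in> M \<or> r i ^ 2 - of_int (e * N ^ 2) \<in> M"
        by (rule M_prime) (use that in \<open>auto intro!: rootring_intros simp del: of_int_mult of_int_power\<close>)
      then show False
      proof
        assume "r i ^ (n - 2) \<in> M"
        then have "r i \<in> M" by (rule M_prime_power) (use that in auto)
        then have "r i ^ 2 \<in> M" unfolding power2_eq_square using that by (intro M_mult) auto
        from M_diff[OF this 1] have "of_int c \<in> M" by simp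
        then show False using c_unit[of p1] p1 M_of_int by (simp add: N_def)
      next
        assume "r i ^ 2 - of_int (e * N ^ 2) \<in> M"
        from M_diff[OF this 1] have "of_int (c - e * N ^ 2) \<in> M" by simp
        then have "p1 dvd c - e * N ^ 2" using M_of_int by blast
        moreover have "c - e * N ^ 2 = - (4 * (N * e))" by (simp add: c N_def algebra_simps power2_eq_square)
        ultimately have "p1 dvd 4 * (N * e)" by simp
        then show False using unit[of p1] p1 by (simp add: pmul N_def)
      qed
    qed
  qed (use n in auto)
  moreover have "Suc (2 * (m - 2)) = n - 2" using n by simp
  ultimately have tr1: "totally_ramified_at p1 0 (n - 2)" by simp
  have \<rho>c: "\<not> p2 dvd \<rho>"
  proof
    assume "p2 dvd \<rho>"
    then have "p2 dvd \<rho> ^ 2" by (simp add: power2_eq_square)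
    from dvd_diff[OF this p2(5)] have "p2 dvd c" by simp
    then show False using c_unit[of p2] p2 by (simp add: N_def)
  qed
  have \<rho>d: "\<not> p2 dvd \<rho> ^ 2 - d"
  proof
    assume "p2 dvd \<rho> ^ 2 - d"
    then have "p2 dvd (\<rho> ^ 2 - d) - (\<rho> ^ 2 - c)" using p2(5) by (rule dvd_diff)
    moreover have "(\<rho> ^ 2 - d) - (\<rho> ^ 2 - c) = 4 * ((N - 4) * e)"
      by (simp add: c d(1) N_def algebra_simps power2_eq_square)
    ultimately show False using unit[of p2] p2 by (simp add: pmul N_def)
  qed
  have eval: "\<exists>k. poly F x = x ^ (n - 2) * (x ^ 2 - e * N ^ 2) + t * (x ^ 2 - d) + p2 * k" for x
    by (rule exI[of _ "poly E2' x"], subst p2(4)) (simp add: poly_monom N_def power2_eq_square algebra_simps)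
  \<comment> \<open>Otherwise F(\<rho>) would be congruent to \<rho>^(n - 2) (c - e n^2), which is
    nonzero modulo \<open>p2\<close>.\<close>
  have t_unit: "\<not> p2 dvd t"
  proof
    assume t: "p2 dvd t"
    obtain k where k: "poly F \<rho> = \<rho> ^ (n - 2) * (\<rho> ^ 2 - e * N ^ 2) + t * (\<rho> ^ 2 - d) + p2 * k" using eval by blast
    have "p2 dvd poly F \<rho> - t * (\<rho> ^ 2 - d) - p2 * k - \<rho> ^ (n - 2) * (\<rho> ^ 2 - c)"
      using p2(5,6) t by (intro dvd_diff) auto
    moreover have "poly F \<rho> - t * (\<rho> ^ 2 - d) - p2 * k - \<rho> ^ (n - 2) * (\<rho> ^ 2 - c) = \<rho> ^ (n - 2) * (c - e * N ^ 2)"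
      unfolding k by (simp add: algebra_simps)
    moreover have "c - e * N ^ 2 = - (4 * (N * e))" by (simp add: c N_def algebra_simps power2_eq_square)
    ultimately have "p2 dvd \<rho> ^ (n - 2) * (4 * (N * e))" by simp
    then show False using unit[of p2] p2 \<rho>c by (simp add: pmul prime_dvd_power_iff N_def) (metis prime_dvd_power)
  qed
  obtain q where q: "\<rho> ^ 2 - c = p2 * q" using p2(5) by blast
  have "totally_ramified_at p2 \<rho> (Suc (2 * 1))"
  proof (rule odd_case_ramified[OF n5(1) key p2(1,2,6,7)])
    have "[:- c, 0, 1:] = [:- \<rho>, 1:] * [:\<rho>, 1:] + smult p2 [:q:]"
      using q by (simp add: power2_eq_square)
    then show "g = [:- \<rho>, 1:] ^ 1 * ([:\<rho>, 1:] * monom 1 (m - 2)) + smult p2 (E2 + monom 1 (m - 2) * [:q:])"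
      unfolding p2(3) by (simp only: power_one_right distrib_left smult_add_right mult_smult_right mult_smult_left mult_ac add_ac)
    show "\<not> p2 dvd \<rho> ^ 2 - d" by (rule \<rho>d)
    have "\<not> p2 dvd (2 * \<rho>) * \<rho> ^ (m - 2)"
      using unit(4)[of p2] p2(1,2) \<rho>c pmul[OF p2(1)] prime_dvd_power[OF p2(1)] by (auto simp: N_def)
    then show "\<not> p2 dvd poly ([:\<rho>, 1:] * monom 1 (m - 2)) \<rho>" by (simp add: poly_monom mult.assoc)
    \<comment> \<open>The candidates are 0 and -\<rho>. Modulo \<open>p2\<close>, F(0) = -t d is
      nonzero; and as the odd part of \<open>F\<close> cancels, F(\<rho>) + F(-\<rho>) = 2 t
      (\<rho>^2 - d) is nonzero too, while F(\<rho>) = 0.\<close>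
    show "ipoly ([:\<rho>, 1:] * monom 1 (m - 2)) (r i) \<notin> M" if "prime_over n r F M p2" "i \<in> {1..n}" for M i
    proof
      interpret prime_over n r F M p2 by (rule that(1))
      assume "ipoly ([:\<rho>, 1:] * monom 1 (m - 2)) (r i) \<in> M"
      then have "(r i + of_int \<rho>) * r i ^ (m - 2) \<in> M" by (simp add: ipoly_simps algebra_simps)
      then have "r i + of_int \<rho> \<in> M \<or> r i ^ (m - 2) \<in> M"
        by (rule M_prime) (use that in \<open>auto intro!: rootring_intros\<close>)
      then show False
      proof
        assume "r i ^ (m - 2) \<in> M"
        then have ri: "r i \<in> M" by (rule M_prime_power) (use that in auto)
        have "\<not> p2 dvd poly F 0"
        proof
          assume F0: "p2 dvd poly F 0"
          obtain k where k: "poly F 0 = - (t * d) + p2 * k"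
            using eval[of 0] n5(1) by (auto simp: zero_power)
          have "p2 dvd p2 * k - poly F 0" by (rule dvd_diff[OF dvd_triv_left F0])
          then have "p2 dvd t * d" by (simp add: k)
          then show False using t_unit d_unit[of p2] p2 by (simp add: pmul N_def)
        qed
        then show False using root_notin_if_not_dvd[OF that] ri by blast
      next
        assume "r i + of_int \<rho> \<in> M"
        then have "r i - of_int (- \<rho>) \<in> M" by simp
        then have "ipoly F (r i) - ipoly F (of_int (- \<rho>)) \<in> M"
          using that by (intro M_cong_ipoly rootring_of_int) auto
        then have "of_int (poly F (- \<rho>)) \<in> M"
          using ipoly_root[OF that(2)] M_uminus unfolding ipoly_of_int by fastforce
        then have 1: "p2 dvd poly F (- \<rho>)" using M_of_int by blast
        obtain k k' where k: "poly F \<rho> = \<rho> ^ (n - 2) * (\<rho> ^ 2 - e * N ^ 2) + t * (\<rho> ^ 2 - d) + p2 * k"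
          "poly F (- \<rho>) = (- \<rho>) ^ (n - 2) * ((- \<rho>) ^ 2 - e * N ^ 2) + t * ((- \<rho>) ^ 2 - d) + p2 * k'" using eval by meson
        have "odd (n - 2)" using \<open>odd n\<close> n5 by simp
        then have "poly F \<rho> + poly F (- \<rho>) = 2 * (t * (\<rho> ^ 2 - d)) + p2 * (k + k')"
          unfolding k by (simp add: algebra_simps)
        moreover have "p2 dvd poly F \<rho> + poly F (- \<rho>)" using 1 p2(6) by (rule dvd_add[rotated])
        ultimately have "p2 dvd 2 * (t * (\<rho> ^ 2 - d))"
          using dvd_diff[OF _ dvd_triv_left[of p2 "k + k'"]] by fastforce
        then show False using unit(4)[of p2] p2 t_unit \<rho>d by (simp add: pmul N_def)
      qed
    qed
  qed simp_all
  then have tr2: "totally_ramified_at p2 \<rho> 3" by (simp add: numeral_3_eq_3 numeral_2_eq_2)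
  show ?thesis
  proof (rule galois_group_eq_alt[OF tr2 tr1 _ _ _ Q])
    show "\<exists>\<pi>\<in>gal. \<pi> i = j" if "i \<in> {1..n}" "j \<in> {1..n}" for i j
      by (rule trans_if_eisenstein[OF p0(1,3,4) that])
  qed (use n5 in auto)
qed

end

section \<open>A family in even degree\<close>

text \<open>\<open>C\<close> is chosen before \<open>B\<close>, so the number of polynomials grows
  like the coefficient bound to the power m/2.\<close>

definition alt_family :: "nat \<Rightarrow> nat \<Rightarrow> bool" where
  "alt_family n m \<longleftrightarrow> (\<exists>C>0. \<forall>B::nat. B \<ge> 1 \<longrightarrow> (\<exists>A :: int poly set. finite A \<and> card A = B ^ m \<and>
     (\<forall>F\<in>A. degree F = n \<and> lead_coeff F = 1 \<and> (\<forall>i. \<bar>poly.coeff F i\<bar> \<le> C * int B ^ 2) \<and>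
        galois_group_eq (map_poly of_int F) (carrier (alt_group n)))))"

lemma int_crt:
  fixes a b u v :: int
  assumes "coprime a b"
  shows "\<exists>x. a dvd x - u \<and> b dvd x - v"
proof -
  obtain y z where yz: "y * a + z * b = 1" using assms by (metis bezout_int coprime_imp_gcd_eq_1)
  have "(u * (z * b) + v * (y * a)) - u = a * (y * (v - u))"
    using arg_cong[OF yz, of "\<lambda>w. u * w"] by (simp add: algebra_simps)
  moreover have "(u * (z * b) + v * (y * a)) - v = b * (z * (u - v))"
    using arg_cong[OF yz, of "\<lambda>w. v * w"] by (simp add: algebra_simps)
  ultimately show ?thesis by (metis dvd_triv_left)
qed

lemma int_inverse_mod:
  fixes a b :: int
  assumes "coprime a b"
  shows "\<exists>x. b dvd a * x - 1"
proof -
  obtain y z where yz: "y * a + z * b = 1" using assms by (metis bezout_int coprime_imp_gcd_eq_1)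
  then have "a * y - 1 = b * (- z)" by (simp add: algebra_simps)
  then show ?thesis by (metis dvd_triv_left)
qed

lemma prime_gt_if_not_dvd_fact:
  assumes "prime (p :: int)" "\<not> p dvd fact n"
  shows "p > int n"
proof (rule ccontr)
  assume "\<not> ?thesis"
  then have "nat p dvd fact n" using assms(1) by (subst prime_dvd_fact_iff) (auto simp: prime_ge_0_int)
  then have "int (nat p) dvd int (fact n)" by (simp only: of_nat_dvd_iff)
  then show False using assms prime_ge_0_int[OF assms(1)] by simp
qed

lemma coprime_if_prime_not_dvd:
  "prime (p :: int) \<Longrightarrow> \<not> p dvd a \<Longrightarrow> coprime (p ^ k) a"
  by (simp add: prime_imp_coprime)

text \<open>A prime divisor of \<open>\<alpha> s\<^sup>2 + 1\<close> with \<open>s = 2 \<alpha> N\<close> divides none of \<open>2, \<alpha>, N\<close>; if its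
  square divides too, then replacing \<open>s\<close> by \<open>s + p\<close> lowers the multiplicity to one.\<close>

lemma ex_prime_exactly_dividing:
  fixes \<alpha> N :: int
  assumes "\<alpha> \<noteq> 0" "N \<noteq> 0"
  shows "\<exists>p s. prime p \<and> \<not> p dvd N \<and> \<not> p dvd 2 \<and> p dvd \<alpha> * s ^ 2 + 1 \<and> \<not> p ^ 2 dvd \<alpha> * s ^ 2 + 1"
proof -
  define s where "s = 2 * \<alpha> * N"
  define K where "K = \<alpha> * s ^ 2 + 1"
  have "\<bar>K\<bar> \<noteq> 1"
  proof -
    have "\<bar>\<alpha> * s ^ 2\<bar> \<ge> 4"
    proof -
      have "\<alpha> * N \<noteq> 0" using assms by simp
      then have "\<bar>\<alpha>\<bar> \<ge> 1" "\<bar>\<alpha> * N\<bar> \<ge> 1" using assms(1) by linarith+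
      then have "1 * 4 \<le> \<bar>\<alpha>\<bar> * (4 * \<bar>\<alpha> * N\<bar> ^ 2)"
        using one_le_power[of "\<bar>\<alpha> * N\<bar>" 2] by (intro mult_mono) linarith+
      then show ?thesis by (simp add: s_def abs_mult power_mult_distrib)
    qed
    then show ?thesis unfolding K_def by linarith
  qed
  then have "\<not> is_unit K" by simp
  moreover have "K \<noteq> 0"
  proof
    assume "K = 0"
    then have "s dvd 1" unfolding K_def by (metis add_eq_0_iff dvd_minus_iff dvd_mult dvd_power dvd_refl zero_less_numeral)
    moreover have "2 dvd s" by (simp add: s_def)
    ultimately have "2 dvd (1 :: int)" using dvd_trans by blast
    then show False by simp
  qed
  ultimately obtain p where p: "p dvd K" "prime p" using prime_divisor_exists by blast
  have ps: "\<not> p dvd s"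
  proof
    assume "p dvd s"
    then have "p dvd \<alpha> * s ^ 2" by (simp add: power2_eq_square)
    from dvd_diff[OF p(1) this] have "p dvd 1" by (simp add: K_def)
    then show False using p(2) not_prime_unit by blast
  qed
  then have pu: "\<not> p dvd N" "\<not> p dvd 2" "\<not> p dvd \<alpha>" by (auto simp: s_def)
  show ?thesis
  proof (cases "p ^ 2 dvd K")
    case False
    then show ?thesis using p pu by (auto simp: K_def)
  next
    case True
    have eq: "\<alpha> * (s + p) ^ 2 + 1 = K + p * (2 * \<alpha> * s) + p ^ 2 * \<alpha>"
      by (simp add: K_def power2_eq_square algebra_simps)
    have "p dvd \<alpha> * (s + p) ^ 2 + 1" unfolding eq using p(1) by (intro dvd_add) (auto simp: power2_eq_square)
    moreover have "\<not> p ^ 2 dvd \<alpha> * (s + p) ^ 2 + 1"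
    proof
      assume "p ^ 2 dvd \<alpha> * (s + p) ^ 2 + 1"
      then have "p ^ 2 dvd (K + p * (2 * \<alpha> * s) + p ^ 2 * \<alpha>) - p ^ 2 * \<alpha> - K"
        using True unfolding eq by (intro dvd_diff) auto
      then have "p * p dvd p * (2 * \<alpha> * s)" by (simp add: power2_eq_square)
      then have "p dvd 2 * \<alpha> * s" using p(2) by auto
      then show False using pu ps p(2) by (simp add: prime_dvd_mult_iff)
    qed
    ultimately show ?thesis using p(2) pu by blast
  qed
qed

lemma degree_lead_coeffI:
  assumes "poly.coeff (F :: int poly) n = 1" "\<And>l. l > n \<Longrightarrow> poly.coeff F l = 0"
  shows "degree F = n" "lead_coeff F = 1"
proof -
  show "degree F = n"
    using assms by (intro antisym degree_le le_degree) auto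
  then show "lead_coeff F = 1" using assms by simp
qed

lemma poly_eq_add_smultI:
  assumes "\<And>i. c dvd poly.coeff P i - poly.coeff Q i"
  shows "\<exists>E. P = Q + smult c (E :: int poly)"
proof -
  have "[:c:] dvd P - Q" using assms by (simp add: const_poly_dvd_iff)
  then obtain E where "P - Q = [:c:] * E" by blast
  then have "P = Q + smult c E" by (simp add: algebra_simps)
  then show ?thesis by blast
qed

lemma eq_if_square_eq_monic:
  fixes P Q :: "int poly"
  assumes "P ^ 2 = Q ^ 2" "poly.coeff P k = 1" "poly.coeff Q k = 1"
  shows "P = Q"
proof -
  have "P = Q \<or> P = - Q" using assms(1) by (simp add: power2_eq_iff)
  then show ?thesis using assms(2,3) by (auto dest: arg_cong[of _ _ "\<lambda>P. poly.coeff P k"])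
qed

lemma abs_coeff_monom: "\<bar>poly.coeff (monom c k) l\<bar> \<le> \<bar>c :: int\<bar>"
  by simp

lemma abs_coeff_sum: "\<bar>poly.coeff (\<Sum>i\<in>I. f i) l\<bar> \<le> (\<Sum>i\<in>I. \<bar>poly.coeff (f i) l :: int\<bar>)"
  unfolding coeff_sum by (rule sum_abs)

definition even_g :: "nat \<Rightarrow> nat \<Rightarrow> (nat \<Rightarrow> int) \<Rightarrow> int poly" where
  "even_g n h c = monom 1 h + (\<Sum>i<h. monom (fact n * c i) i)"

text \<open>The antiderivative of n X g^2 with value \<open>a\<close> at 0, for g =
  \<open>even_g n h c\<close>. The factor \<open>fact n\<close> in the lower coefficients of g makes
  the divisions by exponents exact; the leading coefficient n / (2h + 2) is 1 by itself.\<close>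

definition even_F :: "nat \<Rightarrow> nat \<Rightarrow> (nat \<Rightarrow> int) \<Rightarrow> int \<Rightarrow> int poly" where
  "even_F n h c a = monom 1 n + [:a:] +
     ((\<Sum>i<h. monom (2 * int n * c i * (fact n div int (i + h + 2))) (i + h + 2)) +
      (\<Sum>i<h. \<Sum>j<h. monom (int n * fact n * c i * c j * (fact n div int (i + j + 2))) (i + j + 2)))"

lemma mult_fact_div: "1 \<le> k \<Longrightarrow> k \<le> n \<Longrightarrow> int k * (fact n div int k) = fact n"
  using dvd_fact[of k n] by (metis dvd_mult_div_cancel of_nat_dvd_iff of_nat_fact)

lemma pderiv_sum': "pderiv (sum f I) = (\<Sum>i\<in>I. pderiv (f i))"
  by (induction I rule: infinite_finite_induct) (simp_all add: pderiv_add)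

lemma pderiv_even_F:
  assumes "n = 2 * (h + 1)"
  shows "pderiv (even_F n h c a) = [:0, int n:] * even_g n h c ^ 2"
proof -
  define S where "S = (\<Sum>i<h. monom (fact n * c i) i)"
  have X: "[:0, int n:] = monom (int n) 1" by (simp add: monom_altdef)
  have d1: "pderiv (monom (2 * int n * c i * (fact n div int (i + h + 2))) (i + h + 2)) =
      monom (int n) 1 * (2 * monom 1 h * monom (fact n * c i) i)" if "i < h" for i
  proof -
    have "int (i + h + 2) * (2 * int n * c i * (fact n div int (i + h + 2))) =
        2 * int n * c i * (int (i + h + 2) * (fact n div int (i + h + 2)))" by (simp only: mult_ac)
    also have "\<dots> = 2 * int n * c i * fact n"
      using that assms by (subst mult_fact_div) auto
    finally have *: "int (i + h + 2) * (2 * int n * c i * (fact n div int (i + h + 2))) = 2 * int n * c i * fact n" .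
    have two: "2 * monom 1 h = monom (2 :: int) h" by (simp add: mult_monom numeral_poly flip: monom_0)
    show ?thesis
      unfolding pderiv_monom two mult_monom * by (simp add: mult_ac add_ac Suc_eq_plus1)
  qed
  have d2: "pderiv (monom (int n * fact n * c i * c j * (fact n div int (i + j + 2))) (i + j + 2)) =
      monom (int n) 1 * (monom (fact n * c i) i * monom (fact n * c j) j)" if "i < h" "j < h" for i j
  proof -
    have "int (i + j + 2) * (int n * fact n * c i * c j * (fact n div int (i + j + 2))) =
        int n * fact n * c i * c j * (int (i + j + 2) * (fact n div int (i + j + 2)))" by (simp only: mult_ac)
    also have "\<dots> = int n * fact n * c i * c j * fact n"
      using that assms by (subst mult_fact_div) auto
    finally have *: "int (i + j + 2) * (int n * fact n * c i * c j * (fact n div int (i + j + 2))) =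
      int n * fact n * c i * c j * fact n" .
    show ?thesis
      unfolding pderiv_monom mult_monom * by (simp add: mult_ac add_ac Suc_eq_plus1)
  qed
  have d0: "pderiv (monom 1 n :: int poly) = monom (int n) 1 * (monom 1 h * monom 1 h)"
  proof -
    have "n - 1 = 1 + (h + h)" using assms by simp
    then show ?thesis by (simp only: pderiv_monom mult_monom) simp
  qed
  have s0: "pderiv [:a:] = 0" by (simp add: pderiv_pCons)
  have s1: "(\<Sum>i<h. pderiv (monom (2 * int n * c i * (fact n div int (i + h + 2))) (i + h + 2))) =
      (\<Sum>i<h. monom (int n) 1 * (2 * monom 1 h * monom (fact n * c i) i))"
    by (rule sum.cong[OF refl d1]) (simp only: lessThan_iff)
  have s2: "(\<Sum>i<h. \<Sum>j<h. pderiv (monom (int n * fact n * c i * c j * (fact n div int (i + j + 2))) (i + j + 2))) =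
      (\<Sum>i<h. \<Sum>j<h. monom (int n) 1 * (monom (fact n * c i) i * monom (fact n * c j) j))"
    by (rule sum.cong[OF refl sum.cong[OF refl d2]]) (simp_all only: lessThan_iff)
  have "pderiv (even_F n h c a) = monom (int n) 1 * (monom 1 h * monom 1 h) +
      ((\<Sum>i<h. monom (int n) 1 * (2 * monom 1 h * monom (fact n * c i) i)) +
       (\<Sum>i<h. \<Sum>j<h. monom (int n) 1 * (monom (fact n * c i) i * monom (fact n * c j) j)))"
    unfolding even_F_def pderiv_add pderiv_sum' d0 s1 s2 s0 by (simp only: add_0_right)
  also have "\<dots> = monom (int n) 1 * (monom 1 h * monom 1 h + 2 * monom 1 h * S + S * S)"
    unfolding S_def sum_product by (simp only: sum_distrib_left distrib_left add.assoc)
  also have "\<dots> = [:0, int n:] * even_g n h c ^ 2"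
    unfolding X even_g_def S_def[symmetric] by (simp add: power2_eq_square algebra_simps)
  finally show ?thesis .
qed

lemma coeff_even_g: "poly.coeff (even_g n h c) i = (if i < h then fact n * c i else if i = h then 1 else 0)"
proof -
  have "(\<Sum>j<h. if j = i then fact n * c j else 0) = (if i < h then fact n * c i else 0)"
    by (subst sum.delta) auto
  then show ?thesis by (auto simp: even_g_def coeff_sum)
qed

lemma even_F_monic:
  assumes "n = 2 * (h + 1)"
  shows "degree (even_F n h c a) = n" "lead_coeff (even_F n h c a) = 1"
proof -
  have z: "poly.coeff (even_F n h c a) l = (if l = n then 1 else 0)" if "l \<ge> n" for l
  proof -
    have "l \<noteq> 0" using that assms by simp
    then have "poly.coeff [:a:] l = 0" by (simp add: coeff_pCons split: nat.splits)
    then show ?thesis using that assms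
      unfolding even_F_def by (simp add: coeff_sum)
  qed
  show "degree (even_F n h c a) = n" "lead_coeff (even_F n h c a) = 1"
    by (rule degree_lead_coeffI(1); use z in simp) (rule degree_lead_coeffI(2)[where n = n]; use z in simp)
qed

lemma poly_even_F_0:
  assumes "n = 2 * (h + 1)"
  shows "poly (even_F n h c a) 0 = a"
  using assms by (simp add: even_F_def poly_sum poly_monom)

lemma even_F_cong_8:
  assumes "\<And>i. 8 dvd c i"
  shows "\<exists>E. even_F n h c a = monom 1 n + [:a:] + smult 8 E"
proof (rule poly_eq_add_smultI)
  fix l
  have "8 dvd (\<Sum>i<h. poly.coeff (monom (2 * int n * c i * (fact n div int (i + h + 2))) (i + h + 2)) l) +
      (\<Sum>i<h. \<Sum>j<h. poly.coeff (monom (int n * fact n * c i * c j * (fact n div int (i + j + 2))) (i + j + 2)) l)"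
    using assms by (intro dvd_add dvd_sum) (auto intro!: dvd_mult2 dvd_mult)
  then show "8 dvd poly.coeff (even_F n h c a) l - poly.coeff (monom 1 n + [:a:]) l"
    by (simp only: even_F_def coeff_add coeff_sum add_diff_cancel_left')
qed

text \<open>Modulo 8 the polynomial is X^n + a with a congruent to 4, since s is twice an odd
  number. A root would be even, and then its n-th power would be divisible by 8.\<close>

lemma even_F_no_root:
  assumes n: "n \<ge> 4" and c: "\<And>i. 8 dvd c i" and s: "4 dvd s - 2" and a: "a = s ^ 2 \<or> a = - (s ^ 2)"
  shows "poly (even_F n h c a) k \<noteq> 0"
proof
  assume root: "poly (even_F n h c a) k = 0"
  obtain E where "even_F n h c a = monom 1 n + [:a:] + smult 8 E" using even_F_cong_8[of c n h a] c by blast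
  then have eq: "k ^ n + a + 8 * poly E k = 0" using root by (simp add: poly_monom)
  obtain q where q: "s = 4 * q + 2" using s by (metis diff_add_cancel dvdE)
  then have s2: "s ^ 2 = 8 * (2 * q ^ 2 + 2 * q) + 4" by (simp add: power2_eq_square algebra_simps)
  have "a = 8 * (2 * q ^ 2 + 2 * q) + 4 \<or> a = 8 * (- (2 * q ^ 2 + 2 * q) - 1) + 4"
    using a unfolding s2 by auto
  then obtain y where y: "a = 8 * y + 4" by blast
  have "even k"
  proof (rule ccontr)
    assume "odd k"
    then have "odd (k ^ n + a + 8 * poly E k)" by (simp add: y)
    then show False using eq by simp
  qed
  then have "2 ^ n dvd k ^ n" by (rule dvd_power_same)
  moreover have "(8 :: int) dvd 2 ^ n" using le_imp_power_dvd[of 3 n "2 :: int"] n by simp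
  ultimately have "8 dvd k ^ n" using dvd_trans by blast
  then have "8 dvd k ^ n + a + 8 * poly E k - k ^ n - 8 * poly E k - 8 * y" unfolding eq by (intro dvd_diff) auto
  then show False by (simp add: y)
qed

lemma abs_coeff_even_F:
  assumes D: "D \<ge> 1" "\<And>i. i < h \<Longrightarrow> \<bar>c i\<bar> \<le> D" and a: "\<bar>a\<bar> \<le> D ^ 2"
  shows "\<bar>poly.coeff (even_F n h c a) l\<bar> \<le> (2 + 2 * int h * int n * fact n + int h ^ 2 * int n * fact n ^ 2) * D ^ 2"
proof -
  have fd: "\<bar>fact n div k\<bar> \<le> fact n" if "k \<ge> 1" for k :: int
    using zdiv_mono2[of "fact n" 1 k] that by (auto simp: abs_of_nonneg pos_imp_zdiv_nonneg_iff)
  have DD: "D \<le> D ^ 2" using D(1) by (simp add: power2_eq_square)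
  define t1 where "t1 = (\<Sum>i<h. monom (2 * int n * c i * (fact n div int (i + h + 2))) (i + h + 2))"
  define t2 where "t2 = (\<Sum>i<h. \<Sum>j<h. monom (int n * fact n * c i * c j * (fact n div int (i + j + 2))) (i + j + 2))"
  have "\<bar>poly.coeff t1 l\<bar> \<le> (\<Sum>i<h. \<bar>2 * int n * c i * (fact n div int (i + h + 2))\<bar>)"
    unfolding t1_def by (rule order_trans[OF abs_coeff_sum]) (intro sum_mono abs_coeff_monom)
  also have "\<dots> \<le> (\<Sum>i<h. 2 * int n * D * fact n)"
    unfolding abs_mult using D fd by (intro sum_mono mult_mono) (auto intro: mult_nonneg_nonneg simp del: of_nat_add)
  also have "\<dots> = 2 * int h * int n * fact n * D" by simp
  also have "\<dots> \<le> 2 * int h * int n * fact n * D ^ 2" using DD by (intro mult_left_mono) auto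
  finally have 1: "\<bar>poly.coeff t1 l\<bar> \<le> 2 * int h * int n * fact n * D ^ 2" .
  have "\<bar>poly.coeff t2 l\<bar> \<le> (\<Sum>i<h. \<Sum>j<h. \<bar>int n * fact n * c i * c j * (fact n div int (i + j + 2))\<bar>)"
    unfolding t2_def
    by (rule order_trans[OF abs_coeff_sum], rule sum_mono, rule order_trans[OF abs_coeff_sum]) (intro sum_mono abs_coeff_monom)
  also have "\<dots> \<le> (\<Sum>i<h. \<Sum>j<h. int n * fact n * D * D * fact n)"
    unfolding abs_mult using D fd by (intro sum_mono mult_mono) (auto intro: mult_nonneg_nonneg simp del: of_nat_add)
  also have "\<dots> = int h ^ 2 * int n * fact n ^ 2 * D ^ 2" by (simp add: power2_eq_square mult_ac)
  finally have 2: "\<bar>poly.coeff t2 l\<bar> \<le> int h ^ 2 * int n * fact n ^ 2 * D ^ 2" .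
  have "\<bar>poly.coeff [:a:] l\<bar> \<le> D ^ 2" using a by (cases l) auto
  moreover have "\<bar>poly.coeff (monom 1 n :: int poly) l\<bar> \<le> D ^ 2" using D(1) DD by simp
  moreover have "poly.coeff (even_F n h c a) l = poly.coeff (monom 1 n) l + poly.coeff [:a:] l + (poly.coeff t1 l + poly.coeff t2 l)"
    by (simp only: even_F_def t1_def t2_def coeff_add)
  ultimately have "\<bar>poly.coeff (even_F n h c a) l\<bar> \<le> D ^ 2 + D ^ 2 + (2 * int h * int n * fact n * D ^ 2 + int h ^ 2 * int n * fact n ^ 2 * D ^ 2)"
    using 1 2 by linarith
  then show ?thesis by (simp add: algebra_simps)
qed

theorem alt_family_even:
  assumes n: "n = 2 * (h + 1)" "h \<ge> 1"
  shows "alt_family n (h + 1)"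
proof -
  define \<epsilon> where "\<epsilon> = (- 1 :: int) ^ (h + 1)"
  have \<epsilon>: "\<epsilon> = 1 \<or> \<epsilon> = - 1" by (auto simp: \<epsilon>_def minus_one_power_iff)
  have N4: "int n \<ge> 4" using n by simp
  \<comment> \<open>\<open>\<epsilon>\<close> is the sign of F(0), so this is the condition at the
    first prime for F(0) = \<epsilon> s1^2.\<close>
  obtain p1 s1 where p1: "prime p1" "\<not> p1 dvd fact n" "\<not> p1 dvd 2"
    "p1 dvd ((int n - 1) * \<epsilon>) * s1 ^ 2 + 1" "\<not> p1 ^ 2 dvd ((int n - 1) * \<epsilon>) * s1 ^ 2 + 1"
    using ex_prime_exactly_dividing[of "(int n - 1) * \<epsilon>" "fact n"] \<epsilon> N4 by auto
  have "p1 \<noteq> 0" using p1 by auto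
  \<comment> \<open>As n - 2 = 2 h, the number in the condition at the second prime is twice (n - 1)
    h \<epsilon> s^2 + 1. Excluding \<open>p1\<close> as well keeps the two primes distinct.\<close>
  obtain p2 s2 where p2: "prime p2" "\<not> p2 dvd fact n * p1" "\<not> p2 dvd 2"
    "p2 dvd ((int n - 1) * int h * \<epsilon>) * s2 ^ 2 + 1" "\<not> p2 ^ 2 dvd ((int n - 1) * int h * \<epsilon>) * s2 ^ 2 + 1"
    using ex_prime_exactly_dividing[of "(int n - 1) * int h * \<epsilon>" "fact n * p1"] \<epsilon> N4 n(2) \<open>p1 \<noteq> 0\<close> by auto
  have p2': "\<not> p2 dvd fact n" "\<not> p2 dvd p1" using p2(2) by auto
  have gt: "p1 > int n" "p2 > int n" using prime_gt_if_not_dvd_fact p1 p2 p2' by auto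
  have cop12: "coprime (p1 ^ 2) (p2 ^ 2)"
    using coprime_if_prime_not_dvd[OF p2(1) p2'(2), of 2] by (simp add: coprime_commute)
  have cop8: "coprime (p1 ^ 2) 8" "coprime (p2 ^ 2) 8" "coprime (p1 ^ 2) 4" "coprime (p2 ^ 2) 4"
  proof -
    have "coprime (q ^ 2) (2 ^ k)" if "prime q" "\<not> q dvd 2" for q :: int and k
      using prime_imp_coprime[OF that] by simp
    from this[OF p1(1,3), of 3] this[OF p2(1,3), of 3] this[OF p1(1,3), of 2] this[OF p2(1,3), of 2]
    show "coprime (p1 ^ 2) 8" "coprime (p2 ^ 2) 8" "coprime (p1 ^ 2) 4" "coprime (p2 ^ 2) 4" by simp_all
  qed
  have crt3: "\<exists>x. p1 ^ 2 dvd x - u \<and> p2 ^ 2 dvd x - v \<and> w dvd x - z"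
    if cw: "coprime (p1 ^ 2) w" "coprime (p2 ^ 2) w" for u v w z :: int
  proof -
    obtain y where y: "p1 ^ 2 dvd y - u" "p2 ^ 2 dvd y - v" using int_crt[OF cop12] by blast
    obtain x where x: "p1 ^ 2 * p2 ^ 2 dvd x - y" "w dvd x - z"
      using int_crt[of "p1 ^ 2 * p2 ^ 2" w y z] cw by (auto simp: coprime_mult_left_iff)
    have "p1 ^ 2 dvd x - u" using dvd_add[OF dvd_trans[OF dvd_triv_left x(1)] y(1)] by simp
    moreover have "p2 ^ 2 dvd x - v" using dvd_add[OF dvd_trans[OF dvd_triv_right x(1)] y(2)] by simp
    ultimately show ?thesis using x(2) by blast
  qed
  obtain s0' where s0': "p1 ^ 2 dvd s0' - s1" "p2 ^ 2 dvd s0' - s2" "4 dvd s0' - 2"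
    using crt3[OF cop8(3,4)] by blast
  define P where "P = 8 * p1 ^ 2 * p2 ^ 2"
  have P: "P > 0" using p1 p2 by (auto simp: P_def prime_gt_0_int)
  have Pd: "p1 ^ 2 dvd P" "p2 ^ 2 dvd P" "4 dvd P" "8 dvd P" by (auto simp: P_def)
  \<comment> \<open>A positive representative of the class of \<open>s0'\<close>, so that \<epsilon>
    s^2 determines s in the injectivity argument.\<close>
  define s0 where "s0 = s0' + P * \<bar>s0'\<bar> + P"
  have s0_pos: "s0 > 0"
  proof -
    have "1 * \<bar>s0'\<bar> \<le> P * \<bar>s0'\<bar>" using P by (intro mult_right_mono) auto
    then show ?thesis using P unfolding s0_def by linarith
  qed
  \<comment> \<open>Inverses of \<open>fact n\<close>: the lower coefficients of
    \<open>even_g\<close> are \<open>fact n * c i\<close> and have to match those of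
    \<open>gA\<close> and \<open>gB\<close>.\<close>
  obtain v1 v2 where v: "p1 ^ 2 dvd fact n * v1 - 1" "p2 ^ 2 dvd fact n * v2 - 1"
    using int_inverse_mod[of "fact n" "p1 ^ 2"] int_inverse_mod[of "fact n" "p2 ^ 2"]
      coprime_if_prime_not_dvd[OF p1(1,2), of 2] coprime_if_prime_not_dvd[OF p2(1) p2'(1), of 2]
    by (auto simp: coprime_commute)
  define gA where "gA = ([:-1, 1:] ^ h :: int poly)"
  define gB where "gB = ([:-1, 1:] * monom 1 (h - 1) :: int poly)"
  have "\<exists>x. p1 ^ 2 dvd x - v1 * poly.coeff gA i \<and> p2 ^ 2 dvd x - v2 * poly.coeff gB i \<and> 8 dvd x - 0" for i
    by (rule crt3[OF cop8(1,2)])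
  then obtain c0 where c0: "\<And>i. p1 ^ 2 dvd c0 i - v1 * poly.coeff gA i"
    "\<And>i. p2 ^ 2 dvd c0 i - v2 * poly.coeff gB i" "\<And>i. 8 dvd c0 i" by (metis diff_zero)
  have mon: "degree gA = h" "lead_coeff gA = 1" "degree gB = h" "lead_coeff gB = 1"
  proof -
    show "degree gA = h" unfolding gA_def by (simp add: degree_power_eq)
    show "lead_coeff gA = 1" unfolding gA_def lead_coeff_power by simp
    show "degree gB = h"
      unfolding gB_def by (subst degree_mult_eq) (use n(2) in \<open>simp_all add: degree_monom_eq monom_eq_0_iff\<close>)
    show "lead_coeff gB = 1" unfolding gB_def lead_coeff_mult by (simp add: degree_monom_eq)
  qed
  \<comment> \<open>Large enough that every parameter, shifted by \<open>P\<close> times a number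
    below B, is at most D B.\<close>
  define D where "D = P + s0 + (\<Sum>i<h. \<bar>c0 i\<bar>) + 1"
  define C where "C = (2 + 2 * int h * int n * fact n + int h ^ 2 * int n * fact n ^ 2) * D ^ 2"
  have D1: "D \<ge> 1" using P s0_pos by (simp add: D_def sum_nonneg)
  define cc where "cc k i = c0 i + P * int (k i)" for k :: "nat \<Rightarrow> nat" and i
  define ss where "ss \<tau> = s0 + P * int \<tau>" for \<tau> :: nat
  define \<Phi> where "\<Phi> = (\<lambda>(k, \<tau>). even_F n h (cc k) (\<epsilon> * ss \<tau> ^ 2))"
  have good: "galois_group_eq (map_poly of_int (even_F n h (cc k) (\<epsilon> * ss \<tau> ^ 2))) (carrier (alt_group n))" for k \<tau>
  proof -
    define F where "F = even_F n h (cc k) (\<epsilon> * ss \<tau> ^ 2)"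
    define g where "g = even_g n h (cc k)"
    have cong: "q dvd fact n * cc k i - x" if "q dvd P" "q dvd fact n * v - 1" "q dvd c0 i - v * x" for q v x i
    proof -
      have "fact n * cc k i - x = fact n * (c0 i - v * x) + (fact n * v - 1) * x + fact n * (P * int (k i))"
        by (simp add: cc_def algebra_simps)
      then show ?thesis using that by (auto intro!: dvd_add)
    qed
    have "p1 ^ 2 dvd poly.coeff g i - poly.coeff gA i" for i
      using cong[OF Pd(1) v(1) c0(1)] mon(1,2) by (auto simp: g_def coeff_even_g coeff_eq_0)
    then obtain E1 where E1: "g = gA + smult (p1 ^ 2) E1" using poly_eq_add_smultI by blast
    have "p2 ^ 2 dvd poly.coeff g i - poly.coeff gB i" for i
      using cong[OF Pd(2) v(2) c0(2)] mon(3,4) by (auto simp: g_def coeff_even_g coeff_eq_0)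
    then obtain E2 where E2: "g = gB + smult (p2 ^ 2) E2" using poly_eq_add_smultI by blast
    obtain r where "root_enum n r F"
      using ex_root_enum[of F n] even_F_monic[OF n(1)] by (auto simp: F_def)
    then interpret root_enum n r F .
    have F0: "poly F 0 = \<epsilon> * ss \<tau> ^ 2" by (simp add: F_def poly_even_F_0[OF n(1)])
    have sq: "q dvd \<alpha> * ss \<tau> ^ 2 + 1 \<longleftrightarrow> q dvd \<alpha> * s ^ 2 + 1" if "q dvd P" "q dvd s0' - s" for q \<alpha> s
    proof (rule dvd_cong_if_dvd_diff)
      have "q dvd (s0' - s) + P * (\<bar>s0'\<bar> + 1 + int \<tau>)" using that by auto
      moreover have "(s0' - s) + P * (\<bar>s0'\<bar> + 1 + int \<tau>) = ss \<tau> - s" by (simp add: ss_def s0_def algebra_simps)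
      ultimately have "q dvd \<alpha> * (ss \<tau> + s) * (ss \<tau> - s)" by simp
      then show "q dvd (\<alpha> * ss \<tau> ^ 2 + 1) - (\<alpha> * s ^ 2 + 1)" by (simp add: algebra_simps power2_eq_square)
    qed
    have pp: "p1 dvd p1 ^ 2" "p2 dvd p2 ^ 2" by (simp_all add: power2_eq_square)
    have k1: "(int n - 1) * poly F 0 + 1 = ((int n - 1) * \<epsilon>) * ss \<tau> ^ 2 + 1" by (simp add: F0)
    have k2: "(int n - 1) * (int n - 2) * poly F 0 + 2 = 2 * (((int n - 1) * int h * \<epsilon>) * ss \<tau> ^ 2 + 1)"
      unfolding F0 using n(1) by (simp add: algebra_simps)
    have "galois_group_eq (map_poly of_int F) (carrier (alt_group n))"
    proof (rule galois_group_eq_alt_even[OF n _ _ p1(1) gt(1) _ _ _ p2(1) gt(2)])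
      show "pderiv F = [:0, int n:] * g ^ 2" unfolding F_def g_def by (rule pderiv_even_F[OF n(1)])
      show "poly F 0 = (- 1) ^ (h + 1) * ss \<tau> ^ 2" by (simp add: F0 \<epsilon>_def)
      show "g = [:- 1, 1:] ^ h + smult (p1 ^ 2) E1" using E1 by (simp add: gA_def)
      show "g = [:- 1, 1:] * monom 1 (h - 1) + smult (p2 ^ 2) E2" using E2 by (simp only: gB_def)
      show "p1 dvd (int n - 1) * poly F 0 + 1"
        unfolding k1 using sq[OF dvd_trans[OF pp(1) Pd(1)] dvd_trans[OF pp(1) s0'(1)]] p1(4) by blast
      show "\<not> p1 ^ 2 dvd (int n - 1) * poly F 0 + 1"
        unfolding k1 using sq[OF Pd(1) s0'(1)] p1(5) by blast
      show "p2 dvd (int n - 1) * (int n - 2) * poly F 0 + 2"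
        unfolding k2 by (rule dvd_mult) (use sq[OF dvd_trans[OF pp(2) Pd(2)] dvd_trans[OF pp(2) s0'(2)]] p2(4) in blast)
      have "coprime (p2 ^ 2) 2" by (rule coprime_if_prime_not_dvd[OF p2(1,3)])
      then show "\<not> p2 ^ 2 dvd (int n - 1) * (int n - 2) * poly F 0 + 2"
        unfolding k2 coprime_dvd_mult_right_iff[OF \<open>coprime (p2 ^ 2) 2\<close>] using sq[OF Pd(2) s0'(2)] p2(5) by blast
      show "poly F x \<noteq> 0" for x
        unfolding F_def
      proof (rule even_F_no_root)
        show "8 dvd cc k i" for i unfolding cc_def using c0(3) Pd(4) by (intro dvd_add dvd_mult2)
        have "4 dvd (s0' - 2) + P * (\<bar>s0'\<bar> + 1 + int \<tau>)" using s0'(3) Pd(3) by (intro dvd_add dvd_mult2)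
        moreover have "(s0' - 2) + P * (\<bar>s0'\<bar> + 1 + int \<tau>) = ss \<tau> - 2" by (simp add: ss_def s0_def algebra_simps)
        ultimately show "4 dvd ss \<tau> - 2" by simp
      qed (use N4 \<epsilon> in auto)
    qed
    then show ?thesis by (simp add: F_def)
  qed
  \<comment> \<open>The derivative determines g^2 and, through the leading coefficient, g; the
    constant term determines the last parameter.\<close>
  have inj: "inj_on \<Phi> (({..<h} \<rightarrow>\<^sub>E {..<B}) \<times> {..<B})" for B
  proof (rule inj_onI, clarify)
    fix k \<tau> k' \<tau>' assume kk: "k \<in> {..<h} \<rightarrow>\<^sub>E {..<B}" "k' \<in> {..<h} \<rightarrow>\<^sub>E {..<B}"
      and eq: "\<Phi> (k, \<tau>) = \<Phi> (k', \<tau>')"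
    have "[:0, int n:] * even_g n h (cc k) ^ 2 = [:0, int n:] * even_g n h (cc k') ^ 2"
      using arg_cong[OF eq, of pderiv] by (simp only: \<Phi>_def prod.case pderiv_even_F[OF n(1)])
    then have "even_g n h (cc k) ^ 2 = even_g n h (cc k') ^ 2"
      using N4 by (subst (asm) mult_cancel_left) simp
    then have "even_g n h (cc k) = even_g n h (cc k')"
      by (rule eq_if_square_eq_monic[of _ _ h]) (simp_all add: coeff_even_g)
    then have ceq: "poly.coeff (even_g n h (cc k)) i = poly.coeff (even_g n h (cc k')) i" for i by simp
    have "k i = k' i" if "i < h" for i
      using ceq[of i] that P by (simp add: coeff_even_g cc_def)
    then have "k = k'" using kk by (intro PiE_ext[of k _ _ k']) auto
    have "\<epsilon> * ss \<tau> ^ 2 = \<epsilon> * ss \<tau>' ^ 2"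
      using arg_cong[OF eq, of "\<lambda>F. poly F 0"] by (simp add: \<Phi>_def poly_even_F_0[OF n(1)])
    moreover have "ss \<tau> \<ge> 0" "ss \<tau>' \<ge> 0" using s0_pos P by (auto simp: ss_def)
    ultimately have "ss \<tau> = ss \<tau>'" using \<epsilon> by (auto simp: power2_eq_iff_nonneg)
    then have "\<tau> = \<tau>'" using P by (simp add: ss_def)
    then show "k = k' \<and> \<tau> = \<tau>'" using \<open>k = k'\<close> by simp
  qed
  have bound: "\<bar>poly.coeff (\<Phi> (k, \<tau>)) l\<bar> \<le> C * int B ^ 2"
    if "k \<in> {..<h} \<rightarrow>\<^sub>E {..<B}" "\<tau> < B" for k \<tau> B l
  proof -
    have B1: "int B \<ge> 1" using that(2) by simp
    have lin: "\<bar>x + P * int y\<bar> \<le> D * int B" if "\<bar>x\<bar> + P \<le> D" "y < B" for x y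
    proof -
      have "\<bar>x + P * int y\<bar> \<le> \<bar>x\<bar> * 1 + P * int y" using P by (simp add: abs_triangle_ineq[THEN order_trans] abs_mult)
      also have "\<dots> \<le> \<bar>x\<bar> * int B + P * int B" using B1 that(2) P by (intro add_mono mult_left_mono) auto
      also have "\<dots> = (\<bar>x\<bar> + P) * int B" by (simp add: algebra_simps)
      also have "\<dots> \<le> D * int B" using that(1) by (intro mult_right_mono) auto
      finally show ?thesis .
    qed
    have "\<bar>cc k i\<bar> \<le> D * int B" if "i < h" for i
    proof -
      have "\<bar>c0 i\<bar> \<le> (\<Sum>i<h. \<bar>c0 i\<bar>)" using that by (intro member_le_sum) auto
      moreover have "k i < B" using \<open>k \<in> _\<close> that by auto
      ultimately show ?thesis unfolding cc_def using s0_pos by (intro lin) (auto simp: D_def)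
    qed
    moreover have "\<bar>ss \<tau>\<bar> \<le> D * int B"
      unfolding ss_def using that(2) s0_pos by (intro lin) (auto simp: D_def sum_nonneg)
    then have "\<bar>ss \<tau>\<bar> ^ 2 \<le> (D * int B) ^ 2" by (rule power_mono) simp
    then have "\<bar>\<epsilon> * ss \<tau> ^ 2\<bar> \<le> (D * int B) ^ 2"
      using \<epsilon> by (elim disjE) simp_all
    moreover have "D * int B \<ge> 1" using D1 B1 mult_mono[of 1 D 1 "int B"] by simp
    ultimately have "\<bar>poly.coeff (\<Phi> (k, \<tau>)) l\<bar> \<le> (2 + 2 * int h * int n * fact n + int h ^ 2 * int n * fact n ^ 2) * (D * int B) ^ 2"
      unfolding \<Phi>_def prod.case by (intro abs_coeff_even_F)
    then show ?thesis by (simp add: C_def power_mult_distrib mult_ac)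
  qed
  have "C > 0" unfolding C_def using D1 by (intro mult_pos_pos add_pos_nonneg) auto
  show ?thesis
    unfolding alt_family_def
  proof (intro exI[of _ C] conjI allI impI \<open>C > 0\<close>)
    fix B :: nat
    let ?A = "\<Phi> ` (({..<h} \<rightarrow>\<^sub>E {..<B}) \<times> {..<B})"
    show "\<exists>A. finite A \<and> card A = B ^ (h + 1) \<and> (\<forall>F\<in>A. degree F = n \<and> lead_coeff F = 1 \<and>
        (\<forall>i. \<bar>poly.coeff F i\<bar> \<le> C * int B ^ 2) \<and> galois_group_eq (map_poly of_int F) (carrier (alt_group n)))"
    proof (intro exI[of _ ?A] conjI ballI allI)
      show "finite ?A" by (intro finite_imageI finite_cartesian_product finite_PiE) auto
      show "card ?A = B ^ (h + 1)"
        by (subst card_image[OF inj]) (simp add: card_cartesian_product card_PiE power_add)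
      fix F assume "F \<in> ?A"
      then obtain k \<tau> where k: "k \<in> {..<h} \<rightarrow>\<^sub>E {..<B}" "\<tau> < B" "F = \<Phi> (k, \<tau>)" by auto
      show "degree F = n" "lead_coeff F = 1" "galois_group_eq (map_poly of_int F) (carrier (alt_group n))"
        using even_F_monic[OF n(1)] good by (auto simp: k(3) \<Phi>_def)
      show "\<bar>poly.coeff F i\<bar> \<le> C * int B ^ 2" for i using bound[OF k(1,2)] by (simp add: k(3))
    qed
  qed
qed

section \<open>A family in odd degree\<close>

text \<open>This is (X^2 - d)^2 times the derivative of Q / (X^2 - d), which explains the kernel.
  For g^2 to be in the image, g^2 / (X^2 - d)^2 must have no residues; it suffices that 2 X g' - g
  vanishes where X^2 = d. For \<open>odd_e d i\<close> below, this expression is (2i - 5)(2i - 1)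
  X^(i - 2) (X^2 - d).\<close>

definition wronskian_op :: "int \<Rightarrow> int poly \<Rightarrow> int poly" where
  "wronskian_op d Q = [:- d, 0, 1:] * pderiv Q - [:0, 2:] * Q"

lemma wronskian_op_add: "wronskian_op d (P + Q) = wronskian_op d P + wronskian_op d Q"
  and wronskian_op_diff: "wronskian_op d (P - Q) = wronskian_op d P - wronskian_op d Q"
  and wronskian_op_smult: "wronskian_op d (smult a Q) = smult a (wronskian_op d Q)"
  unfolding wronskian_op_def
  by (simp_all only: pderiv_add pderiv_diff pderiv_smult distrib_left right_diff_distrib mult_smult_right smult_diff_right)
     (simp_all add: algebra_simps)?

lemma wronskian_op_sum: "wronskian_op d (sum f J) = (\<Sum>i\<in>J. wronskian_op d (f i))"
  by (induction J rule: infinite_finite_induct) (simp_all add: wronskian_op_add, simp_all add: wronskian_op_def)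

lemma smult_sum_distrib: "smult a (sum f J) = (\<Sum>i\<in>J. smult a (f i))"
  by (induction J rule: infinite_finite_induct) (simp_all add: smult_add_right)

lemma smult_left_cancel: "a \<noteq> 0 \<Longrightarrow> smult a p = smult a q \<longleftrightarrow> p = q" for a :: "'a :: idom"
  by (simp add: poly_eq_iff)

lemma int_poly_ext: "(\<And>x. poly P x = poly Q x) \<Longrightarrow> P = (Q :: int poly)"
  by (subst poly_eq_poly_eq_iff[symmetric]) (rule ext)

lemma wronskian_op_monom:
  "wronskian_op d (monom a (Suc l)) = monom (a * (int l - 1)) (l + 2) - monom (a * d * (int l + 1)) l"
  by (rule int_poly_ext) (simp add: wronskian_op_def pderiv_monom poly_monom algebra_simps power2_eq_square)

lemma wronskian_op_quadratic: "wronskian_op d [:- d, 0, 1:] = 0"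
  by (rule int_poly_ext) (simp add: wronskian_op_def pderiv_pCons algebra_simps)

lemma monom_mult_quadratic: "monom 1 k * [:- c, 0, 1:] = (monom 1 (k + 2) - monom c k :: int poly)"
  by (rule int_poly_ext) (simp add: poly_monom algebra_simps power2_eq_square)

text \<open>The products \<open>e\<^sub>i e\<^sub>j\<close> and \<open>e\<^sub>i g\<^sub>0\<close> lie in the image of \<^const>\<open>wronskian_op\<close>, up to the
  factors \<open>i + j - 3\<close> and \<open>i + m - 3\<close>; multiplying the parameters by \<open>n!\<close> clears these. So
  \<open>(n - 2) g\<^sup>2\<close> has an integral preimage for every \<open>g\<close> in the family.\<close>

definition odd_e :: "int \<Rightarrow> nat \<Rightarrow> int poly" where
  "odd_e d i = monom (2 * int i - 5) i - monom ((2 * int i - 1) * d) (i - 2)"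

text \<open>For d = e (n - 4)^2 and c = n (n - 4) e this is \<open>odd_e d m\<close> divided by its
  leading coefficient n - 4; the factor (n - 4)^2 in \<open>d\<close> makes the quotient
  integral.\<close>

definition odd_g0 :: "nat \<Rightarrow> int \<Rightarrow> int poly" where
  "odd_g0 m c = monom 1 (m - 2) * [:- c, 0, 1:]"

text \<open>The preimage belonging to the square of \<open>odd_g0\<close>: it is
  \<open>odd_H2 d m m\<close> divided by (n - 4)^2. The number n - 2 in the differential equation is
  the factor i + j - 3 at i = j = m.\<close>

definition odd_F0 :: "nat \<Rightarrow> int \<Rightarrow> int poly" where
  "odd_F0 n e = monom 1 (n - 2) * [:- (e * int n ^ 2), 0, 1:]"

text \<open>\<open>odd_H2 d i m\<close> divided by n - 4.\<close>

definition odd_H1 :: "nat \<Rightarrow> nat \<Rightarrow> int \<Rightarrow> nat \<Rightarrow> int poly" where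
  "odd_H1 n m e i = monom (2 * int i - 5) (i + m - 1) - monom (e * (int n - 4) * int n * (2 * int i - 1)) (i + m - 3)"

definition odd_H2 :: "int \<Rightarrow> nat \<Rightarrow> nat \<Rightarrow> int poly" where
  "odd_H2 d i j = monom ((2 * int i - 5) * (2 * int j - 5)) (i + j - 1)
     - monom (d * (2 * int i - 1) * (2 * int j - 1)) (i + j - 3)"

lemma wronskian_op_H2:
  assumes "i \<ge> 2" "j \<ge> 2"
  shows "wronskian_op d (odd_H2 d i j) = smult (int (i + j - 3)) (odd_e d i * odd_e d j)"
proof -
  obtain i' j' where ij: "i = i' + 2" "j = j' + 2" using assms by (metis le_add_diff_inverse2)
  have e: "i + j - 1 = Suc (i' + j' + 2)" "i + j - 3 = Suc (i' + j')" by (simp_all add: ij)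
  show ?thesis
    unfolding odd_H2_def odd_e_def e wronskian_op_diff wronskian_op_monom
    by (rule int_poly_ext) (simp add: ij poly_monom power_add algebra_simps power2_eq_square)
qed

lemma wronskian_op_H1:
  assumes "i \<ge> 2" "m \<ge> 2" "n = 2 * m - 1"
  shows "wronskian_op (e * (int n - 4) ^ 2) (odd_H1 n m e i) =
    smult (int (i + m - 3)) (odd_e (e * (int n - 4) ^ 2) i * odd_g0 m (int n * (int n - 4) * e))"
proof -
  obtain i' m' where ij: "i = i' + 2" "m = m' + 2" using assms by (metis le_add_diff_inverse2)
  have e: "i + m - 1 = Suc (i' + m' + 2)" "i + m - 3 = Suc (i' + m')" by (simp_all add: ij)
  have n: "int n = 2 * int m' + 3" using assms ij by simp
  show ?thesis
    unfolding odd_H1_def odd_e_def odd_g0_def e wronskian_op_diff wronskian_op_monom n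
    by (rule int_poly_ext) (simp add: ij poly_monom power_add algebra_simps power2_eq_square)
qed

lemma wronskian_op_F0:
  assumes "m \<ge> 2" "n = 2 * m - 1"
  shows "wronskian_op (e * (int n - 4) ^ 2) (odd_F0 n e) = smult (int n - 2) (odd_g0 m (int n * (int n - 4) * e) ^ 2)"
proof -
  obtain m' where m: "m = m' + 2" using assms by (metis le_add_diff_inverse2)
  have e: "n - 2 = Suc (2 * m')" "Suc (2 * m') + 2 = Suc (2 * m' + 2)" using assms m by simp_all
  have n: "int n = 2 * int m' + 3" using assms m by simp
  show ?thesis
    unfolding odd_F0_def odd_g0_def monom_mult_quadratic e wronskian_op_diff wronskian_op_monom n
    by (rule int_poly_ext) (simp add: m poly_monom power_add power_mult algebra_simps power2_eq_square power_mult_distrib)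
qed

text \<open>The factor \<open>P\<close> freezes \<open>g\<close> modulo the chosen primes, and
  likewise \<open>F\<close> apart from its term in t, so that the remaining arithmetic conditions
  fall on t. The factor \<open>fact n\<close> makes the solution integral.\<close>

definition odd_g :: "nat \<Rightarrow> nat \<Rightarrow> int \<Rightarrow> int \<Rightarrow> (nat \<Rightarrow> int) \<Rightarrow> int poly" where
  "odd_g n m e P k = odd_g0 m (int n * (int n - 4) * e) +
     smult P (smult (fact n) (\<Sum>i\<in>{2..<m}. smult (k i) (odd_e (e * (int n - 4) ^ 2) i)))"

text \<open>The contribution of the parameters to the solution, with one factor \<open>P\<close>
  removed: first the cross terms with \<open>odd_g0\<close>, then the products of two
  parameters.\<close>

definition odd_R :: "nat \<Rightarrow> nat \<Rightarrow> int \<Rightarrow> int \<Rightarrow> (nat \<Rightarrow> int) \<Rightarrow> int poly" where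
  "odd_R n m e P k =
     (\<Sum>i\<in>{2..<m}. smult (2 * (int n - 2) * k i * (fact n div int (i + m - 3))) (odd_H1 n m e i)) +
     smult (P * fact n) (\<Sum>i\<in>{2..<m}. \<Sum>j\<in>{2..<m}.
       smult ((int n - 2) * k i * k j * (fact n div int (i + j - 3))) (odd_H2 (e * (int n - 4) ^ 2) i j))"

definition odd_F :: "nat \<Rightarrow> nat \<Rightarrow> int \<Rightarrow> int \<Rightarrow> (nat \<Rightarrow> int) \<Rightarrow> int \<Rightarrow> int poly" where
  "odd_F n m e P k t = odd_F0 n e + smult t [:- (e * (int n - 4) ^ 2), 0, 1:] + smult P (odd_R n m e P k)"

lemma wronskian_op_odd_F:
  assumes m: "m \<ge> 2" and n: "n = 2 * m - 1"
  shows "wronskian_op (e * (int n - 4) ^ 2) (odd_F n m e P k t) = smult (int n - 2) (odd_g n m e P k ^ 2)"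
proof -
  define d where "d = e * (int n - 4) ^ 2"
  define g0 where "g0 = odd_g0 m (int n * (int n - 4) * e)"
  define T where "T = (\<Sum>i\<in>{2..<m}. smult (k i) (odd_e d i))"
  have s1: "(\<Sum>i\<in>{2..<m}. smult (2 * (int n - 2) * k i * (fact n div int (i + m - 3))) (wronskian_op d (odd_H1 n m e i))) =
      (\<Sum>i\<in>{2..<m}. smult (2 * (int n - 2) * fact n) (smult (k i) (odd_e d i) * g0))"
  proof (rule sum.cong[OF refl])
    fix i assume i: "i \<in> {2..<m}"
    have "2 * (int n - 2) * k i * (fact n div int (i + m - 3)) * int (i + m - 3) =
        2 * (int n - 2) * k i * (int (i + m - 3) * (fact n div int (i + m - 3)))" by (simp only: mult_ac)
    also have "\<dots> = 2 * (int n - 2) * fact n * k i"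
      using i n by (subst mult_fact_div) auto
    finally show "smult (2 * (int n - 2) * k i * (fact n div int (i + m - 3))) (wronskian_op d (odd_H1 n m e i)) =
      smult (2 * (int n - 2) * fact n) (smult (k i) (odd_e d i) * g0)"
      unfolding d_def g0_def using i wronskian_op_H1[OF _ m n, of i e] by (simp only: smult_smult mult_smult_left atLeastLessThan_iff)
  qed
  have s2: "(\<Sum>i\<in>{2..<m}. \<Sum>j\<in>{2..<m}. smult ((int n - 2) * k i * k j * (fact n div int (i + j - 3))) (wronskian_op d (odd_H2 d i j))) =
      (\<Sum>i\<in>{2..<m}. \<Sum>j\<in>{2..<m}. smult ((int n - 2) * fact n) (smult (k i) (odd_e d i) * smult (k j) (odd_e d j)))"
  proof (rule sum.cong[OF refl], rule sum.cong[OF refl])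
    fix i j assume ij: "i \<in> {2..<m}" "j \<in> {2..<m}"
    have "(int n - 2) * k i * k j * (fact n div int (i + j - 3)) * int (i + j - 3) =
        (int n - 2) * k i * k j * (int (i + j - 3) * (fact n div int (i + j - 3)))" by (simp only: mult_ac)
    also have "\<dots> = (int n - 2) * fact n * (k i * k j)"
      using ij n by (subst mult_fact_div) auto
    finally have *: "(int n - 2) * k i * k j * (fact n div int (i + j - 3)) * int (i + j - 3) = (int n - 2) * fact n * (k i * k j)" .
    have "wronskian_op d (odd_H2 d i j) = smult (int (i + j - 3)) (odd_e d i * odd_e d j)"
      by (rule wronskian_op_H2) (use ij in auto)
    then show "smult ((int n - 2) * k i * k j * (fact n div int (i + j - 3))) (wronskian_op d (odd_H2 d i j)) =
      smult ((int n - 2) * fact n) (smult (k i) (odd_e d i) * smult (k j) (odd_e d j))"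
      by (simp only: smult_smult mult_smult_left mult_smult_right * mult.commute[of "k j" "k i"])
  qed
  have T1: "(\<Sum>i\<in>{2..<m}. smult a (smult (k i) (odd_e d i) * g0)) = smult a (T * g0)" for a
    unfolding T_def sum_distrib_right smult_sum_distrib ..
  have T2: "(\<Sum>i\<in>{2..<m}. \<Sum>j\<in>{2..<m}. smult a (smult (k i) (odd_e d i) * smult (k j) (odd_e d j))) = smult a (T * T)" for a
    unfolding T_def sum_product smult_sum_distrib ..
  have "wronskian_op d (odd_F n m e P k t) = smult (int n - 2) (g0 ^ 2) +
      smult P (smult (2 * (int n - 2) * fact n) (T * g0) + smult (P * fact n) (smult ((int n - 2) * fact n) (T * T)))"
    unfolding odd_F_def odd_R_def wronskian_op_add wronskian_op_smult wronskian_op_sum d_def[symmetric]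
      s1 s2 T1 T2 wronskian_op_quadratic
    using wronskian_op_F0[OF m n, of e] by (simp add: d_def g0_def)
  also have "\<dots> = smult (int n - 2) ((g0 + smult P (smult (fact n) T)) ^ 2)"
    by (rule int_poly_ext) (simp add: algebra_simps power2_eq_square)
  finally show ?thesis by (simp add: odd_g_def d_def g0_def T_def)
qed

lemma odd_F_monic:
  assumes m: "m \<ge> 3" and n: "n = 2 * m - 1"
  shows "degree (odd_F n m e P k t) = n" "lead_coeff (odd_F n m e P k t) = 1"
proof -
  have z: "poly.coeff (odd_F n m e P k t) l = (if l = n then 1 else 0)" if "l \<ge> n" for l
  proof -
    have n2: "n - 2 + 2 = n" "n \<ge> 5" using m n by auto
    have 1: "poly.coeff (odd_F0 n e) l = (if l = n then 1 else 0)"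
      unfolding odd_F0_def monom_mult_quadratic n2(1) using that n2 by auto
    have 2: "poly.coeff (smult t [:- (e * (int n - 4) ^ 2), 0, 1:]) l = 0"
      using that n2 by (intro coeff_eq_0) (auto intro: le_less_trans[OF degree_smult_le])
    have 3: "poly.coeff (odd_H1 n m e i) l = 0" if "i \<in> {2..<m}" for i
      using that \<open>l \<ge> n\<close> n by (auto simp: odd_H1_def)
    have 4: "poly.coeff (odd_H2 d i j) l = 0" if "i \<in> {2..<m}" "j \<in> {2..<m}" for i j d
      using that \<open>l \<ge> n\<close> n by (auto simp: odd_H2_def)
    have "poly.coeff (odd_R n m e P k) l = 0"
      unfolding odd_R_def coeff_add coeff_smult coeff_sum using 3 4 by simp
    then show ?thesis unfolding odd_F_def coeff_add 1 2 by simp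
  qed
  show "degree (odd_F n m e P k t) = n" "lead_coeff (odd_F n m e P k t) = 1"
    by (rule degree_lead_coeffI(1); use z in simp) (rule degree_lead_coeffI(2)[where n = n]; use z in simp)
qed

lemma poly_odd_F_0:
  assumes m: "m \<ge> 3" and n: "n = 2 * m - 1"
  shows "poly (odd_F n m e P k t) 0 = - (t * (e * (int n - 4) ^ 2))"
proof -
  have 1: "poly (odd_F0 n e) 0 = 0" using m n by (simp add: odd_F0_def poly_monom zero_power)
  have 3: "poly (odd_H1 n m e i) 0 = 0" if "i \<in> {2..<m}" for i
    using that by (simp add: odd_H1_def poly_monom zero_power)
  have 4: "poly (odd_H2 d i j) 0 = 0" if "i \<in> {2..<m}" "j \<in> {2..<m}" for i j d
    using that by (simp add: odd_H2_def poly_monom zero_power)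
  have "poly (odd_R n m e P k) 0 = 0"
    unfolding odd_R_def poly_add poly_smult poly_sum using 3 4 by simp
  then show ?thesis using 1 by (simp add: odd_F_def)
qed

section \<open>Size and injectivity of the odd family\<close>

definition l1norm :: "int poly \<Rightarrow> int" where
  "l1norm Q = (\<Sum>i\<le>degree Q. \<bar>poly.coeff Q i\<bar>)"

lemma abs_coeff_le_l1norm: "\<bar>poly.coeff Q l\<bar> \<le> l1norm Q"
proof (cases "l \<le> degree Q")
  case True
  then show ?thesis unfolding l1norm_def by (intro member_le_sum) auto
next
  case False
  then show ?thesis unfolding l1norm_def by (simp add: coeff_eq_0 sum_nonneg)
qed

lemma l1norm_nonneg: "l1norm Q \<ge> 0"
  by (simp add: l1norm_def sum_nonneg)

definition odd_bound :: "nat \<Rightarrow> nat \<Rightarrow> int \<Rightarrow> int \<Rightarrow> int \<Rightarrow> int" where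
  "odd_bound n m e P T = 1 + (l1norm (odd_F0 n e) + T * l1norm [:- (e * (int n - 4) ^ 2), 0, 1:] + P *
     ((\<Sum>i\<in>{2..<m}. \<bar>2 * (int n - 2) * (fact n div int (i + m - 3))\<bar> * l1norm (odd_H1 n m e i)) +
      (P * fact n) * (\<Sum>i\<in>{2..<m}. \<Sum>j\<in>{2..<m}.
       \<bar>(int n - 2) * (fact n div int (i + j - 3))\<bar> * l1norm (odd_H2 (e * (int n - 4) ^ 2) i j))))"

lemma abs_coeff_odd_F:
  assumes B: "B \<ge> 1" "\<And>i. i \<in> {2..<m} \<Longrightarrow> \<bar>k i\<bar> \<le> B" and t: "\<bar>t\<bar> \<le> T * B ^ 2" and P: "P \<ge> 0"
  shows "\<bar>poly.coeff (odd_F n m e P k t) l\<bar> \<le> odd_bound n m e P T * B ^ 2"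
proof -
  have BB: "1 \<le> B ^ 2" "B \<le> B ^ 2" using B(1) mult_mono[of 1 B 1 B] by (simp_all add: power2_eq_square)
  define q where "q = [:- (e * (int n - 4) ^ 2), 0, 1:]"
  define t1 where "t1 = (\<Sum>i\<in>{2..<m}. smult (2 * (int n - 2) * k i * (fact n div int (i + m - 3))) (odd_H1 n m e i))"
  define t2 where "t2 = (\<Sum>i\<in>{2..<m}. \<Sum>j\<in>{2..<m}.
       smult ((int n - 2) * k i * k j * (fact n div int (i + j - 3))) (odd_H2 (e * (int n - 4) ^ 2) i j))"
  define b1 where "b1 = (\<Sum>i\<in>{2..<m}. \<bar>2 * (int n - 2) * (fact n div int (i + m - 3))\<bar> * l1norm (odd_H1 n m e i))"
  define b2 where "b2 = (\<Sum>i\<in>{2..<m}. \<Sum>j\<in>{2..<m}.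
       \<bar>(int n - 2) * (fact n div int (i + j - 3))\<bar> * l1norm (odd_H2 (e * (int n - 4) ^ 2) i j))"
  have "\<bar>poly.coeff t1 l\<bar> \<le> (\<Sum>i\<in>{2..<m}. \<bar>2 * (int n - 2) * (fact n div int (i + m - 3))\<bar> * l1norm (odd_H1 n m e i) * B ^ 2)"
    unfolding t1_def
  proof (rule order_trans[OF abs_coeff_sum], rule sum_mono)
    fix i assume i: "i \<in> {2..<m}"
    have "\<bar>poly.coeff (smult (2 * (int n - 2) * k i * (fact n div int (i + m - 3))) (odd_H1 n m e i)) l\<bar> =
      \<bar>2 * (int n - 2) * (fact n div int (i + m - 3))\<bar> * \<bar>poly.coeff (odd_H1 n m e i) l\<bar> * \<bar>k i\<bar>"
      by (simp only: coeff_smult abs_mult mult_ac)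
    also have "\<dots> \<le> \<bar>2 * (int n - 2) * (fact n div int (i + m - 3))\<bar> * l1norm (odd_H1 n m e i) * B ^ 2"
      using order_trans[OF B(2)[OF i] BB(2)]
      by (intro mult_mono mult_left_mono abs_coeff_le_l1norm mult_nonneg_nonneg l1norm_nonneg) auto
    finally show "\<bar>poly.coeff (smult (2 * (int n - 2) * k i * (fact n div int (i + m - 3))) (odd_H1 n m e i)) l\<bar> \<le> \<dots>" .
  qed
  then have 1: "\<bar>poly.coeff t1 l\<bar> \<le> b1 * B ^ 2" by (simp add: b1_def sum_distrib_right)
  have "\<bar>poly.coeff t2 l\<bar> \<le> (\<Sum>i\<in>{2..<m}. \<Sum>j\<in>{2..<m}.
       \<bar>(int n - 2) * (fact n div int (i + j - 3))\<bar> * l1norm (odd_H2 (e * (int n - 4) ^ 2) i j) * B ^ 2)"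
    unfolding t2_def
  proof (rule order_trans[OF abs_coeff_sum], rule sum_mono, rule order_trans[OF abs_coeff_sum], rule sum_mono)
    fix i j assume ij: "i \<in> {2..<m}" "j \<in> {2..<m}"
    have "\<bar>poly.coeff (smult ((int n - 2) * k i * k j * (fact n div int (i + j - 3))) (odd_H2 (e * (int n - 4) ^ 2) i j)) l\<bar> =
      \<bar>(int n - 2) * (fact n div int (i + j - 3))\<bar> * \<bar>poly.coeff (odd_H2 (e * (int n - 4) ^ 2) i j) l\<bar> * (\<bar>k i\<bar> * \<bar>k j\<bar>)"
      by (simp only: coeff_smult abs_mult mult_ac)
    also have "\<dots> \<le> \<bar>(int n - 2) * (fact n div int (i + j - 3))\<bar> * l1norm (odd_H2 (e * (int n - 4) ^ 2) i j) * (B * B)"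
      using B ij by (intro mult_mono mult_left_mono abs_coeff_le_l1norm mult_nonneg_nonneg l1norm_nonneg) auto
    finally show "\<bar>poly.coeff (smult ((int n - 2) * k i * k j * (fact n div int (i + j - 3))) (odd_H2 (e * (int n - 4) ^ 2) i j)) l\<bar> \<le>
      \<bar>(int n - 2) * (fact n div int (i + j - 3))\<bar> * l1norm (odd_H2 (e * (int n - 4) ^ 2) i j) * B ^ 2"
      by (simp only: power2_eq_square)
  qed
  then have 2: "\<bar>poly.coeff t2 l\<bar> \<le> b2 * B ^ 2" by (simp add: b2_def sum_distrib_right)
  have 3: "\<bar>poly.coeff (odd_F0 n e) l\<bar> \<le> l1norm (odd_F0 n e) * B ^ 2"
    using abs_coeff_le_l1norm[of "odd_F0 n e" l] mult_left_mono[OF BB(1) l1norm_nonneg[of "odd_F0 n e"]] by linarith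
  have "\<bar>t * poly.coeff q l\<bar> \<le> T * B ^ 2 * l1norm q"
    unfolding abs_mult using t by (intro mult_mono abs_coeff_le_l1norm) (auto intro: order_trans[OF abs_ge_zero t])
  then have 4: "\<bar>t * poly.coeff q l\<bar> \<le> T * l1norm q * B ^ 2" by (simp only: mult_ac)
  have eq: "poly.coeff (odd_F n m e P k t) l = poly.coeff (odd_F0 n e) l + t * poly.coeff q l +
      P * (poly.coeff t1 l + P * fact n * poly.coeff t2 l)"
    by (simp only: odd_F_def odd_R_def q_def t1_def t2_def coeff_add coeff_smult)
  have "\<bar>P * fact n * poly.coeff t2 l\<bar> \<le> P * fact n * (b2 * B ^ 2)"
    unfolding abs_mult using P 2 by (intro mult_mono) auto
  then have "\<bar>P * (poly.coeff t1 l + P * fact n * poly.coeff t2 l)\<bar> \<le> P * (b1 * B ^ 2 + P * fact n * (b2 * B ^ 2))"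
    unfolding abs_mult[of P] using P 1 by (intro mult_mono) auto
  then have "\<bar>poly.coeff (odd_F n m e P k t) l\<bar> \<le> l1norm (odd_F0 n e) * B ^ 2 + T * l1norm q * B ^ 2 +
      P * (b1 * B ^ 2 + P * fact n * (b2 * B ^ 2)) + 1 * B ^ 2"
    unfolding eq using 3 4 BB(1) by linarith
  also have "\<dots> = odd_bound n m e P T * B ^ 2"
    unfolding odd_bound_def q_def[symmetric] b1_def[symmetric] b2_def[symmetric] by (simp add: algebra_simps)
  finally show ?thesis .
qed

lemma odd_bound_pos: "P \<ge> 0 \<Longrightarrow> T \<ge> 0 \<Longrightarrow> odd_bound n m e P T > 0"
  unfolding odd_bound_def
  by (intro add_pos_nonneg add_nonneg_nonneg mult_nonneg_nonneg sum_nonneg l1norm_nonneg) auto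

text \<open>Triangularity: \<open>odd_e d i\<close> has degree i, and its leading coefficient 2i - 5
  is odd, hence nonzero. At the largest index \<open>j\<close> where the parameters differ, no other
  term contributes to the \<open>j\<close>-th coefficient.\<close>

lemma odd_e_independent:
  assumes "(\<Sum>i\<in>{2..<m}. smult (k i) (odd_e d i)) = (\<Sum>i\<in>{2..<m}. smult (k' i) (odd_e d i))" "i \<in> {2..<m}"
  shows "k i = k' i"
proof (rule ccontr)
  assume neq: "k i \<noteq> k' i"
  define S where "S = {i\<in>{2..<m}. k i \<noteq> k' i}"
  have S: "finite S" "S \<noteq> {}" using assms(2) neq by (auto simp: S_def)
  define j where "j = Max S"
  have j: "j \<in> S" "\<And>i. i \<in> S \<Longrightarrow> i \<le> j" using S by (auto simp: j_def)
  have "(\<Sum>i\<in>{2..<m}. (k i - k' i) * poly.coeff (odd_e d i) j) = 0"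
    using arg_cong[OF assms(1), of "\<lambda>P. poly.coeff P j"] by (simp add: coeff_sum left_diff_distrib sum_subtractf)
  also have "(\<Sum>i\<in>{2..<m}. (k i - k' i) * poly.coeff (odd_e d i) j) = (\<Sum>i\<in>{j}. (k i - k' i) * poly.coeff (odd_e d i) j)"
  proof (rule sum.mono_neutral_right)
    show "{j} \<subseteq> {2..<m}" using j by (auto simp: S_def)
    show "\<forall>i\<in>{2..<m} - {j}. (k i - k' i) * poly.coeff (odd_e d i) j = 0"
    proof
      fix i assume i: "i \<in> {2..<m} - {j}"
      show "(k i - k' i) * poly.coeff (odd_e d i) j = 0"
      proof (cases "i < j")
        case True
        then show ?thesis by (auto simp: odd_e_def)
      next
        case False
        then have "i \<notin> S" using j(2)[of i] i by auto
        then show ?thesis using i by (simp add: S_def)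
      qed
    qed
  qed simp
  finally have "(k j - k' j) * (2 * int j - 5) = 0" using j by (auto simp: odd_e_def S_def)
  moreover have "2 * int j - 5 \<noteq> 0" by presburger
  ultimately show False using j by (simp add: S_def)
qed

lemma coeff_odd_g:
  assumes "m \<ge> 2"
  shows "poly.coeff (odd_g n m e P k) m = 1"
proof -
  have "m - 2 + 2 = m" using assms by simp
  moreover have "poly.coeff (odd_e d i) m = 0" if "i \<in> {2..<m}" for i d using that by (auto simp: odd_e_def)
  ultimately show ?thesis
    unfolding odd_g_def odd_g0_def monom_mult_quadratic using assms by (simp add: coeff_sum)
qed

theorem alt_family_odd:
  assumes n: "n = 2 * m - 1" and m: "m \<ge> 3"
  shows "alt_family n m"
proof -
  define N where "N = int n"
  define e where "e = (- 1) ^ m * (N - 2)"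
  define d where "d = e * (N - 4) ^ 2"
  define c where "c = N * (N - 4) * e"
  define q where "q = [:- d, 0, 1:]"
  have N5: "N \<ge> 5" "odd n" using n m by (auto simp: N_def)
  have "e = N - 2 \<or> e = - (N - 2)" by (auto simp: e_def minus_one_power_iff)
  then have e_dvd: "x dvd e \<longleftrightarrow> x dvd N - 2" for x by (metis dvd_minus_iff)
  have e_nz: "e \<noteq> 0" using N5 by (simp add: e_def)
  have c_nz: "c \<noteq> 0" using N5 e_nz by (simp add: c_def)
  have "\<not> is_unit N" "N \<noteq> 0" using N5 by auto
  \<comment> \<open>\<open>odd_F0\<close> is X^n modulo every divisor of n, so a prime factor of n
    can serve as the Eisenstein prime.\<close>
  then obtain p0 where p0: "p0 dvd N" "prime p0" using prime_divisor_exists by blast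
  have pmul: "p dvd x * y \<longleftrightarrow> p dvd x \<or> p dvd y" if "prime p" for p x y :: int
    using that by (rule prime_dvd_mult_iff)
  have small: "\<not> p dvd x" if "p > N" "0 < x" "x \<le> N" for p x
    using that zdvd_imp_le[of p x] by auto
  have p0_le: "p0 \<le> N" using zdvd_imp_le[OF p0(1)] N5 by simp
  have p02: "\<not> p0 dvd 2"
  proof
    assume "p0 dvd 2"
    then have "p0 = 2" using prime_ge_2_int[OF p0(2)] zdvd_imp_le[of p0 2] by auto
    then show False using p0(1) N5 by (simp add: N_def)
  qed
  have p0d: "\<not> p0 dvd d"
  proof
    assume "p0 dvd d"
    then have "p0 dvd N - 2 \<or> p0 dvd N - 4" by (auto simp: d_def pmul[OF p0(2)] power2_eq_square e_dvd)
    then have "p0 dvd N - (N - 2) \<or> p0 dvd N - (N - 4)"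
      using dvd_diff[OF p0(1), of "N - 2"] dvd_diff[OF p0(1), of "N - 4"] by blast
    then have "p0 dvd 2 \<or> p0 dvd 2 * 2" by simp
    then show False using p02 pmul[OF p0(2)] by blast
  qed
  obtain p1n where p1n: "prime p1n" "p1n > n" using bigger_prime by blast
  define p1 where "p1 = int p1n"
  have p1: "prime p1" "p1 > N" using p1n by (auto simp: p1_def N_def)
  have p01: "\<not> p0 dvd p1" using p0 p1 p0_le primes_dvd_imp_eq[of p0 p1] by auto
  \<comment> \<open>Modulo such a prime c (p1 s)^2 = 1, so \<open>c\<close> is a square with root
    \<rho> = c p1 s.\<close>
  obtain p2 s where p2: "prime p2" "\<not> p2 dvd (fact n * p1)" "\<not> p2 dvd 2" "p2 dvd c * (p1 * s) ^ 2 - 1"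
  proof -
    obtain p x where px: "prime p" "\<not> p dvd fact n * p1" "\<not> p dvd 2" "p dvd (- c * p1 ^ 2) * x ^ 2 + 1"
      using ex_prime_exactly_dividing[of "- c * p1 ^ 2" "fact n * p1"] c_nz p1 by auto
    have eq: "c * (p1 * x) ^ 2 - 1 = - ((- c * p1 ^ 2) * x ^ 2 + 1)" by (simp add: power_mult_distrib)
    have "p dvd c * (p1 * x) ^ 2 - 1" unfolding eq dvd_minus_iff by (rule px(4))
    with px(1-3) show ?thesis by (rule that)
  qed
  have p2': "\<not> p2 dvd fact n" "\<not> p2 dvd p1" using p2(2) by auto
  have p2N: "p2 > N" using prime_gt_if_not_dvd_fact[OF p2(1) p2'(1)] by (simp add: N_def)
  have p20: "\<not> p2 dvd p0" using zdvd_imp_le[of p2 p0] p2N p0_le prime_gt_0_int[OF p0(2)] by auto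
  have unit: "\<not> p dvd e" "\<not> p dvd N" "\<not> p dvd N - 4" "\<not> p dvd 4" if "p > N" for p
    using small[OF that] N5 e_dvd by auto
  have p1d: "\<not> p1 dvd d" using unit[OF p1(2)] p1(1) by (simp add: d_def pmul power2_eq_square)
  define \<rho> where "\<rho> = c * (p1 * s)"
  have "\<rho> ^ 2 - c = c * (c * (p1 * s) ^ 2 - 1)" by (simp add: \<rho>_def power2_eq_square algebra_simps)
  then have \<rho>c: "p2 dvd \<rho> ^ 2 - c" using p2(4) by simp
  have \<rho>d: "\<not> p2 dvd \<rho> ^ 2 - d"
  proof
    assume "p2 dvd \<rho> ^ 2 - d"
    then have "p2 dvd (\<rho> ^ 2 - d) - (\<rho> ^ 2 - c)" using \<rho>c by (rule dvd_diff)
    moreover have "(\<rho> ^ 2 - d) - (\<rho> ^ 2 - c) = 4 * ((N - 4) * e)"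
      by (simp add: c_def d_def algebra_simps power2_eq_square)
    ultimately show False using unit[OF p2N] p2(1) by (simp add: pmul)
  qed
  obtain w where w: "p2 ^ 2 dvd (\<rho> ^ 2 - d) * w - 1"
    using int_inverse_mod[of "\<rho> ^ 2 - d" "p2 ^ 2"] coprime_if_prime_not_dvd[OF p2(1) \<rho>d, of 2] by (auto simp: coprime_commute)
  define f where "f = poly (odd_F0 n e) \<rho>"
  have cop: "coprime ((p0 * p1) ^ 2) (p2 ^ 2)"
    using coprime_if_prime_not_dvd[OF p2(1) p20, of 2] coprime_if_prime_not_dvd[OF p2(1) p2'(2), of 2]
    by (simp add: coprime_commute power_mult_distrib)
  \<comment> \<open>The first congruence makes F(0) = -t d divisible exactly once by
    \<open>p0\<close> and by \<open>p1\<close>. The second, with \<open>w\<close> inverse to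
    \<rho>^2 - d, solves f + t (\<rho>^2 - d) = p2 modulo p2^2, so that \<open>p2\<close> divides
    F(\<rho>) exactly once.\<close>
  obtain t0 where t0: "(p0 * p1) ^ 2 dvd t0 - p0 * p1" "p2 ^ 2 dvd t0 - w * (p2 - f)"
    using int_crt[OF cop] by blast
  define P where "P = (p0 * p1) ^ 2 * p2 ^ 2"
  have P: "P > 0" using p0 p1 p2 by (auto simp: P_def prime_gt_0_int)
  have Pd: "(p0 * p1) ^ 2 dvd P" "p2 ^ 2 dvd P" by (auto simp: P_def)
  define kk where "kk k i = int (k i)" for k :: "nat \<Rightarrow> nat" and i :: nat
  define tt where "tt \<tau> = t0 + P * int \<tau>" for \<tau> :: nat
  define \<Phi> where "\<Phi> = (\<lambda>(k, \<tau>). odd_F n m e P (kk k) (tt \<tau>))"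
  have good: "galois_group_eq (map_poly of_int (\<Phi> (k, \<tau>))) (carrier (alt_group n))" for k \<tau>
  proof -
    define F where "F = \<Phi> (k, \<tau>)"
    define g where "g = odd_g n m e P (kk k)"
    define t where "t = tt \<tau>"
    define R where "R = odd_R n m e P (kk k)"
    have F: "F = odd_F0 n e + smult t q + smult P R"
      by (simp add: F_def \<Phi>_def odd_F_def t_def R_def q_def d_def N_def)
    have "degree F = n" "lead_coeff F = 1" unfolding F_def \<Phi>_def using odd_F_monic[OF m n] by simp_all
    then obtain r where "root_enum n r F" using ex_root_enum[of F n] by blast
    then interpret root_enum n r F .
    have t1: "(p0 * p1) ^ 2 dvd t - p0 * p1" and t2: "p2 ^ 2 dvd t - w * (p2 - f)"
      using dvd_add[OF t0(1) dvd_mult2[OF Pd(1), of "int \<tau>"]] dvd_add[OF t0(2) dvd_mult2[OF Pd(2), of "int \<tau>"]]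
      by (simp_all add: t_def tt_def algebra_simps)
    obtain y where y: "t = p0 * p1 * (1 + p0 * p1 * y)"
    proof -
      obtain y where "t - p0 * p1 = (p0 * p1) ^ 2 * y" using t1 by (elim dvdE)
      then have "t = p0 * p1 * (1 + p0 * p1 * y)" by (simp add: algebra_simps power2_eq_square)
      then show ?thesis by (rule that)
    qed
    have F0: "poly F 0 = - (t * d)"
      unfolding F_def \<Phi>_def using poly_odd_F_0[OF m n] by (simp add: t_def d_def N_def)
    have exact: "p dvd poly F 0 \<and> \<not> p ^ 2 dvd poly F 0"
      if p: "prime p" "t = p * z * (1 + p * z * y)" "\<not> p dvd z" "\<not> p dvd d" for p z
    proof
      show "p dvd poly F 0" unfolding F0 p(2) by simp
      show "\<not> p ^ 2 dvd poly F 0"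
      proof
        assume "p ^ 2 dvd poly F 0"
        then have "p * p dvd p * (z * (1 + p * z * y) * d)"
          unfolding F0 dvd_minus_iff p(2) power2_eq_square by (simp only: mult_ac)
        then have "p dvd z * (1 + p * z * y) * d" using p(1) by auto
        then have "p dvd 1 + p * (z * y)" using p by (simp add: pmul mult.assoc)
        then have "p dvd 1" using dvd_diff[OF _ dvd_triv_left[of p "z * y"], of "1 + p * (z * y)"] by simp
        then show False using p(1) not_prime_unit by blast
      qed
    qed
    have "\<not> p1 dvd p0" using zdvd_imp_le[of p1 p0] p1 p0_le prime_gt_0_int[OF p0(2)] by auto
    then have ex0: "p0 dvd poly F 0" "\<not> p0 ^ 2 dvd poly F 0" and ex1: "p1 dvd poly F 0" "\<not> p1 ^ 2 dvd poly F 0"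
      using exact[OF p0(2) y p01 p0d] exact[of p1 p0] p1 y p1d by (simp_all add: mult_ac)
    have F\<rho>: "p2 ^ 2 dvd poly F \<rho> - p2"
    proof -
      have "poly F \<rho> - p2 = (t - w * (p2 - f)) * (\<rho> ^ 2 - d) + ((\<rho> ^ 2 - d) * w - 1) * (p2 - f) + P * poly R \<rho>"
        unfolding F by (simp add: q_def f_def power2_eq_square algebra_simps)
      then show ?thesis using t2 w Pd(2) by auto
    qed
    have ex2: "p2 dvd poly F \<rho>" "\<not> p2 ^ 2 dvd poly F \<rho>"
    proof -
      have "p2 dvd poly F \<rho> - p2" using dvd_trans[OF _ F\<rho>, of p2] by (simp add: power2_eq_square)
      from dvd_add[OF this dvd_refl] show "p2 dvd poly F \<rho>" by simp
      show "\<not> p2 ^ 2 dvd poly F \<rho>"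
      proof
        assume "p2 ^ 2 dvd poly F \<rho>"
        from dvd_diff[OF this F\<rho>] have "p2 * p2 dvd p2 * 1" by (simp add: power2_eq_square)
        then have "p2 dvd 1" using p2(1) by (subst (asm) dvd_times_left_cancel_iff) auto
        then show False using p2(1) not_prime_unit by blast
      qed
    qed
    obtain a0 a1 a2 where a: "P = p0 * a0" "P = p1 * a1" "P = p2 * a2"
      by (metis P_def power2_eq_square mult.assoc mult.left_commute)
    obtain b where b: "e * N ^ 2 = p0 * b" using p0(1) by (metis dvdE dvd_mult dvd_mult2 power2_eq_square)
    define y0 where "y0 = p1 * (1 + p0 * p1 * y)"
    define y1 where "y1 = p0 * (1 + p0 * p1 * y)"
    have y': "t = p0 * y0" "t = p1 * y1" by (simp_all add: y y0_def y1_def)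
    have g: "g = monom 1 (m - 2) * [:- c, 0, 1:] + smult P (smult (fact n) (\<Sum>i\<in>{2..<m}. smult (kk k i) (odd_e d i)))"
      by (simp add: g_def odd_g_def odd_g0_def c_def d_def N_def)
    define G where "G = smult (fact n) (\<Sum>i\<in>{2..<m}. smult (kk k i) (odd_e d i))"
    have F00: "odd_F0 n e = monom 1 (n - 2) * [:- (e * int n ^ 2), 0, 1:]" by (simp add: odd_F0_def)
    have n2: "n - 2 + 2 = n" using n m by simp
    have "galois_group_eq (map_poly of_int F) (carrier (alt_group n))"
    proof (rule galois_group_eq_alt_odd[OF n m])
      show "d = e * (int n - 4) ^ 2" "e = (- 1) ^ m * (int n - 2)" "c = int n * (int n - 4) * e"
        by (simp_all add: d_def e_def c_def N_def)
      show "[:- d, 0, 1:] * pderiv F - [:0, 2:] * F = smult (int n - 2) (g ^ 2)"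
        using wronskian_op_odd_F[OF _ n, of e P "kk k" t] m
        by (simp add: wronskian_op_def F_def \<Phi>_def g_def t_def d_def N_def)
      show "prime p0" "p0 dvd int n" "\<not> p0 ^ 2 dvd poly F 0" using p0 ex0 by (simp_all add: N_def)
      show "F = monom 1 n + smult p0 (- monom b (n - 2) + smult y0 q + smult a0 R)"
        unfolding F F00 monom_mult_quadratic n2 N_def[symmetric] b y'(1) a(1)
        by (simp add: smult_add_right smult_diff_right smult_monom algebra_simps)
      show "prime p1" "p1 > int n" "p1 dvd poly F 0" "\<not> p1 ^ 2 dvd poly F 0" using p1 ex1 by (simp_all add: N_def)
      show "g = monom 1 (m - 2) * [:- c, 0, 1:] + smult p1 (smult a1 G)"
        unfolding g G_def[symmetric] a(2) by (simp only: smult_smult)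
      show "F = monom 1 (n - 2) * [:- (e * int n ^ 2), 0, 1:] + smult p1 (smult y1 q + smult a1 R)"
        unfolding F F00 y'(2) a(2) by (simp only: smult_smult smult_add_right add.assoc)
      show "prime p2" "p2 > int n" "p2 dvd \<rho> ^ 2 - c" "p2 dvd poly F \<rho>" "\<not> p2 ^ 2 dvd poly F \<rho>"
        using p2 p2N \<rho>c ex2 by (simp_all add: N_def)
      show "g = monom 1 (m - 2) * [:- c, 0, 1:] + smult p2 (smult a2 G)"
        unfolding g G_def[symmetric] a(3) by (simp only: smult_smult)
      show "F = monom 1 (n - 2) * [:- (e * int n ^ 2), 0, 1:] + smult t [:- d, 0, 1:] + smult p2 (smult a2 R)"
        unfolding F F00 q_def a(3) by (simp only: smult_smult)
    qed
    then show ?thesis by (simp add: F_def)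
  qed
  \<comment> \<open>Applying the operator recovers g^2, hence g and, by independence, the numbers
    \<open>k i\<close>; then F(0) = -t d gives t.\<close>
  have inj: "inj_on \<Phi> (({2..<m} \<rightarrow>\<^sub>E {..<B}) \<times> {..<B'})" for B B'
  proof (rule inj_onI, clarify)
    fix k \<tau> k' \<tau>' assume k: "k \<in> {2..<m} \<rightarrow>\<^sub>E {..<B}" "k' \<in> {2..<m} \<rightarrow>\<^sub>E {..<B}"
      and eq: "\<Phi> (k, \<tau>) = \<Phi> (k', \<tau>')"
    have m2: "m \<ge> 2" using m by simp
    have "smult (N - 2) (odd_g n m e P (kk k) ^ 2) = smult (N - 2) (odd_g n m e P (kk k') ^ 2)"
      using arg_cong[OF eq, of "wronskian_op d"] wronskian_op_odd_F[OF m2 n]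
      by (simp add: \<Phi>_def d_def N_def)
    then have "odd_g n m e P (kk k) ^ 2 = odd_g n m e P (kk k') ^ 2"
      using N5 by (simp add: smult_left_cancel)
    then have "odd_g n m e P (kk k) = odd_g n m e P (kk k')"
      by (rule eq_if_square_eq_monic[of _ _ m]) (simp_all add: coeff_odd_g[OF m2])
    then have "(\<Sum>i\<in>{2..<m}. smult (kk k i) (odd_e d i)) = (\<Sum>i\<in>{2..<m}. smult (kk k' i) (odd_e d i))"
      using P by (simp add: odd_g_def d_def N_def smult_left_cancel)
    then have "kk k i = kk k' i" if "i \<in> {2..<m}" for i using odd_e_independent that by blast
    then have "k i = k' i" if "i \<in> {2..<m}" for i using that by (simp add: kk_def)
    then have "k = k'" using k by (intro PiE_ext[of k _ _ k']) auto
    have "d \<noteq> 0" using p0d by auto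
    have "tt \<tau> * d = tt \<tau>' * d"
      using arg_cong[OF eq, of "\<lambda>F. poly F 0"] poly_odd_F_0[OF m n] by (simp add: \<Phi>_def d_def N_def)
    then have "tt \<tau> = tt \<tau>'" using \<open>d \<noteq> 0\<close> by simp
    then have "\<tau> = \<tau>'" using P by (simp add: tt_def)
    then show "k = k' \<and> \<tau> = \<tau>'" using \<open>k = k'\<close> by simp
  qed
  define C where "C = odd_bound n m e P (\<bar>t0\<bar> + P)"
  have "C > 0" unfolding C_def using P by (intro odd_bound_pos) auto
  have bound: "\<bar>poly.coeff (\<Phi> (k, \<tau>)) l\<bar> \<le> C * int B ^ 2"
    if B: "B \<ge> 1" and k: "k \<in> {2..<m} \<rightarrow>\<^sub>E {..<B}" and \<tau>: "\<tau> < B ^ 2" for k \<tau> B l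
  proof -
    have "\<bar>tt \<tau>\<bar> \<le> (\<bar>t0\<bar> + P) * int B ^ 2"
    proof -
      have "(1 :: int) \<le> int B ^ 2" using B by (simp add: one_le_power)
      then have "\<bar>t0\<bar> * 1 \<le> \<bar>t0\<bar> * int B ^ 2" by (intro mult_left_mono) auto
      moreover have "int \<tau> \<le> int B ^ 2" using \<tau> by (metis less_imp_le of_nat_le_iff of_nat_power)
      then have "P * int \<tau> \<le> P * int B ^ 2" using P by (intro mult_left_mono) auto
      moreover have "\<bar>tt \<tau>\<bar> \<le> \<bar>t0\<bar> + P * int \<tau>"
        using abs_triangle_ineq[of t0 "P * int \<tau>"] P by (simp add: tt_def abs_mult)
      ultimately show ?thesis unfolding distrib_right by linarith
    qed
    moreover have "\<bar>kk k i\<bar> \<le> int B" if "i \<in> {2..<m}" for i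
      using PiE_mem[OF k that] by (simp add: kk_def)
    ultimately show ?thesis
      unfolding \<Phi>_def C_def prod.case using B P by (intro abs_coeff_odd_F) auto
  qed
  show ?thesis
    unfolding alt_family_def
  proof (intro exI[of _ C] conjI allI impI \<open>C > 0\<close>)
    fix B :: nat assume B: "B \<ge> 1"
    \<comment> \<open>\<open>F\<close> is linear in t, so the shift of t may run up to B^2, while
      the m - 2 others stay below B; the total is B^m.\<close>
    let ?A = "\<Phi> ` (({2..<m} \<rightarrow>\<^sub>E {..<B}) \<times> {..<B ^ 2})"
    show "\<exists>A. finite A \<and> card A = B ^ m \<and> (\<forall>F\<in>A. degree F = n \<and> lead_coeff F = 1 \<and>
        (\<forall>i. \<bar>poly.coeff F i\<bar> \<le> C * int B ^ 2) \<and> galois_group_eq (map_poly of_int F) (carrier (alt_group n)))"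
    proof (intro exI[of _ ?A] conjI ballI allI)
      show "finite ?A" by (intro finite_imageI finite_cartesian_product finite_PiE) auto
      have "m - 2 + 2 = m" using m by simp
      then show "card ?A = B ^ m"
        by (subst card_image[OF inj]) (simp add: card_cartesian_product card_PiE flip: power_add)
      fix F assume "F \<in> ?A"
      then obtain k \<tau> where k: "k \<in> {2..<m} \<rightarrow>\<^sub>E {..<B}" "\<tau> < B ^ 2" "F = \<Phi> (k, \<tau>)" by auto
      show "degree F = n" "lead_coeff F = 1" unfolding k(3) \<Phi>_def using odd_F_monic[OF m n] by simp_all
      show "galois_group_eq (map_poly of_int F) (carrier (alt_group n))" using good by (simp add: k(3))
      show "\<bar>poly.coeff F i\<bar> \<le> C * int B ^ 2" for i using bound[OF B k(1,2)] by (simp add: k(3))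
    qed
  qed
qed

section \<open>Counting\<close>

lemma monic_poly_coeff:
  assumes "degree (F :: int poly) = n" "lead_coeff F = 1"
  shows "monic_poly n (\<lambda>i. if i < n then poly.coeff F i else 0) = map_poly of_int F"
proof (rule poly_eqI)
  fix i
  have "poly.coeff F i = 0" if "i > n" using that assms(1) by (simp add: coeff_eq_0)
  moreover have "(\<Sum>j<n. if j = i then of_int (poly.coeff F j) else 0) = (if i < n then of_int (poly.coeff F i) else 0 :: rat)"
    by (subst sum.delta) auto
  ultimately show "poly.coeff (monic_poly n (\<lambda>i. if i < n then poly.coeff F i else 0)) i = poly.coeff (map_poly of_int F :: rat poly) i"
    using assms by (auto simp: monic_poly_def coeff_sum coeff_map_poly not_less_iff_gr_or_eq)
qed

lemma card_int_box:
  assumes "L \<ge> (1 :: real)"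
  defines "I \<equiv> {a :: int. real_of_int a \<in> {-L..L}}"
  shows "finite I" "I \<noteq> {}" "real (card I) \<le> 3 * L"
proof -
  have I: "I = {- \<lfloor>L\<rfloor>..\<lfloor>L\<rfloor>}" unfolding I_def by (auto simp: le_floor_iff) linarith+
  show "finite I" by (simp add: I)
  have f: "\<lfloor>L\<rfloor> \<ge> 1" using assms(1) by simp
  then show "I \<noteq> {}" by (simp add: I)
  have "real (card I) = 2 * real_of_int \<lfloor>L\<rfloor> + 1" using f by (simp add: I)
  also have "\<dots> \<le> 3 * L" using assms(1) of_int_floor_le[of L] by linarith
  finally show "real (card I) \<le> 3 * L" .
qed

text \<open>Take for B the integer part of sqrt (L / C): the coefficients are then at most L, and B
  is at least half of that root. The box has at most (3 L)^n points, all equally likely; these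
  estimates give the constant \<open>c\<close>.\<close>

lemma prob_ge_if_alt_family:
  assumes "alt_family n m"
  shows "\<exists>c::real. c > 0 \<and> (\<forall>\<^sub>F L::real in at_top.
    measure_pmf.prob (random_monic_poly n L) {f. galois_group_eq f (carrier (alt_group n))} \<ge> c * L powr (real m / 2 - real n))"
proof -
  obtain C where C: "C > 0" and fam: "\<And>B::nat. B \<ge> 1 \<Longrightarrow> \<exists>A :: int poly set. finite A \<and> card A = B ^ m \<and>
     (\<forall>F\<in>A. degree F = n \<and> lead_coeff F = 1 \<and> (\<forall>i. \<bar>poly.coeff F i\<bar> \<le> C * int B ^ 2) \<and>
        galois_group_eq (map_poly of_int F) (carrier (alt_group n)))"
    using assms unfolding alt_family_def by blast
  define c where "c = (1 / (2 * sqrt (real_of_int C))) ^ m / 3 ^ n"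
  have "c > 0" using C by (simp add: c_def)
  moreover have "measure_pmf.prob (random_monic_poly n L) {f. galois_group_eq f (carrier (alt_group n))} \<ge> c * L powr (real m / 2 - real n)"
    if L: "L \<ge> max 1 (real_of_int C)" for L
  proof -
    have L1: "L \<ge> 1" "L > 0" using L by auto
    define x where "x = sqrt (L / real_of_int C)"
    define B where "B = nat \<lfloor>x\<rfloor>"
    have x1: "x \<ge> 1" unfolding x_def using L C by simp
    have fl: "\<lfloor>x\<rfloor> \<ge> 1" using x1 by (simp add: le_floor_iff)
    have rB: "real B = real_of_int \<lfloor>x\<rfloor>" unfolding B_def using fl by simp
    have "real B \<ge> 1" unfolding rB using fl by linarith
    moreover have "x < real B + 1" "real B \<le> x" unfolding rB by linarith+
    ultimately have B: "real B \<le> x" "x / 2 \<le> real B" "B \<ge> 1" by linarith+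
    have "real B ^ 2 \<le> x ^ 2" using B(1) by (intro power_mono) auto
    then have CB: "real_of_int C * real B ^ 2 \<le> L" using C L1 by (simp add: x_def field_simps)
    obtain A :: "int poly set" where A: "finite A" "card A = B ^ m"
      "\<And>F. F \<in> A \<Longrightarrow> degree F = n \<and> lead_coeff F = 1 \<and> (\<forall>i. \<bar>poly.coeff F i\<bar> \<le> C * int B ^ 2) \<and>
        galois_group_eq (map_poly of_int F) (carrier (alt_group n))"
      using fam[OF B(3)] by blast
    define I where "I = {a :: int. real_of_int a \<in> {-L..L}}"
    have I: "finite I" "I \<noteq> {}" "real (card I) \<le> 3 * L"
      using card_int_box[OF L1(1)] by (simp_all add: I_def)
    have card_pos: "real (card I) > 0" using I by (simp add: card_gt_0_iff)
    define P where "P = Pi_pmf {..<n} 0 (\<lambda>_. pmf_of_set I)"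
    \<comment> \<open>\<open>Pi_pmf\<close> has the default 0, so the function must vanish from n on
      to have positive mass; the leading 1 is put back by \<open>monic_poly\<close>.\<close>
    define a where "a F = (\<lambda>i. if i < n then poly.coeff F i else 0)" for F :: "int poly"
    have aI: "a F i \<in> I" if "F \<in> A" "i < n" for F i
    proof -
      have "\<bar>poly.coeff F i\<bar> \<le> C * int B ^ 2" using A(3)[OF that(1)] by blast
      then have "real_of_int \<bar>poly.coeff F i\<bar> \<le> real_of_int (C * int B ^ 2)" by (simp only: of_int_le_iff)
      then have "\<bar>real_of_int (poly.coeff F i)\<bar> \<le> L" using CB by simp
      then show ?thesis using that(2) by (auto simp: I_def a_def abs_le_iff)
    qed
    have pmf_a: "pmf P (a F) = (1 / real (card I)) ^ n" if "F \<in> A" for F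
    proof -
      have "pmf P (a F) = (\<Prod>i<n. pmf (pmf_of_set I) (a F i))"
        unfolding P_def by (rule pmf_Pi') (auto simp: a_def)
      also have "\<dots> = (\<Prod>i<n. 1 / real (card I))"
        using aI[OF that] I by (intro prod.cong) auto
      finally show ?thesis by simp
    qed
    have inj: "inj_on a A"
    proof (rule inj_onI)
      fix F G assume FG: "F \<in> A" "G \<in> A" "a F = a G"
      show "F = G"
      proof (rule poly_eqI)
        fix i
        consider "i < n" | "i = n" | "i > n" by linarith
        then show "poly.coeff F i = poly.coeff G i"
        proof cases
          case 1
          then show ?thesis using fun_cong[OF FG(3), of i] by (simp add: a_def)
        next
          case 2
          then show ?thesis using A(3)[OF FG(1)] A(3)[OF FG(2)] by metis
        next
          case 3
          then show ?thesis using A(3)[OF FG(1)] A(3)[OF FG(2)] by (simp add: coeff_eq_0)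
        qed
      qed
    qed
    have "real (B ^ m) * (1 / real (card I)) ^ n = (\<Sum>y\<in>a ` A. pmf P y)"
      by (simp add: sum.reindex[OF inj] pmf_a A(2))
    also have "\<dots> = measure_pmf.prob P (a ` A)"
      using A(1) by (simp add: measure_measure_pmf_finite)
    also have "\<dots> \<le> measure_pmf.prob P (monic_poly n -` {f. galois_group_eq f (carrier (alt_group n))})"
    proof (rule measure_pmf.finite_measure_mono)
      have "galois_group_eq (monic_poly n (a F)) (carrier (alt_group n))" if "F \<in> A" for F
        using A(3)[OF that] monic_poly_coeff[of F n] unfolding a_def by metis
      then show "a ` A \<subseteq> monic_poly n -` {f. galois_group_eq f (carrier (alt_group n))}" by auto
    qed simp
    also have "\<dots> = measure_pmf.prob (random_monic_poly n L) {f. galois_group_eq f (carrier (alt_group n))}"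
      by (simp add: random_monic_poly_def P_def I_def)
    finally have lower: "real (B ^ m) * (1 / real (card I)) ^ n \<le>
      measure_pmf.prob (random_monic_poly n L) {f. galois_group_eq f (carrier (alt_group n))}" .
    have "L powr (real m / 2) = sqrt L ^ m"
      using L1 by (simp add: powr_half_sqrt[symmetric] powr_realpow[symmetric] powr_powr)
    then have "c * L powr (real m / 2 - real n) = (1 / (2 * sqrt (real_of_int C))) ^ m / 3 ^ n * (sqrt L ^ m / L ^ n)"
      using L1 by (simp add: c_def powr_diff powr_realpow)
    also have "\<dots> = (x / 2) ^ m * (1 / (3 * L)) ^ n"
      by (simp add: x_def real_sqrt_divide power_divide power_mult_distrib)
    also have "\<dots> \<le> real B ^ m * (1 / real (card I)) ^ n"
      using B x1 I(3) card_pos L1 by (intro mult_mono power_mono divide_left_mono) auto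
    also have "\<dots> = real (B ^ m) * (1 / real (card I)) ^ n" by simp
    finally show ?thesis using lower by linarith
  qed
  ultimately show ?thesis
    using eventually_ge_at_top[of "max 1 (real_of_int C)"] by (blast intro: eventually_mono)
qed


theorem theorem1p2:
  fixes n :: nat and k :: real
  assumes "n \<ge> 4"
    and "k = 1 / 2 * real_of_int \<lfloor>(real n + 1) / 2\<rfloor>"
  shows "\<exists>c::real. c > 0 \<and>
           (\<forall>\<^sub>F L::real in at_top.
              measure_pmf.prob (random_monic_poly n L)
                {f. galois_group_eq f (carrier (alt_group n))} \<ge> c * L powr (k - real n))"
proof -
  \<comment> \<open>The exponent is h + 1 for n = 2 (h + 1) and m for n = 2 m - 1.\<close>
  have family: "alt_family n ((n + 1) div 2)"
  proof (cases "even n")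
    case True
    then obtain l where "n = 2 * l" by (elim evenE)
    then have "n = 2 * ((l - 1) + 1)" "l - 1 \<ge> 1" "(n + 1) div 2 = l - 1 + 1" using assms(1) by auto
    then show ?thesis using alt_family_even by metis
  next
    case False
    then obtain l where "n = 2 * l + 1" by (elim oddE)
    then have "n = 2 * (l + 1) - 1" "l + 1 \<ge> 3" "(n + 1) div 2 = l + 1" using assms(1) by auto
    then show ?thesis using alt_family_odd by metis
  qed
  have k: "k = real ((n + 1) div 2) / 2"
    using assms(2) floor_divide_of_nat_eq[of "n + 1" 2, where 'a = real] by simp
  show ?thesis unfolding k by (rule prob_ge_if_alt_family[OF family])
qed

end
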